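(* Let $n,N\ge1$, $M\in\mathrm{rep}_{\mathbb C}(\Delta_n,\mathrm I_N)$, $\mathbf e\in\mathbb Z_{\ge0}^{\mathbb Z_n}$. For each $[E]\in\mathrm{gsub}_{\mathbf e}(M)$ the quiver Grassmannian $\mathrm{Gr}_{\mathbf{dim}\,\hat E}(\hat M)$ is isomorphic to a tower of fibrations $$\mathrm{Gr}_{\mathbf{dim}\,\hat E}(\hat M)=X_1\to X_2\to\cdots\to X_N=\prod_{i\in\mathbb Z_n}\mathrm{Gr}_{\hat e^{(i,N)}}\big(\mathbb C^{\hat m^{(i,N)}}\big),$$ where $\hat{\mathbf e}:=\mathbf{dim}\,\hat E$ and $\hat{\mathbf m}:=\mathbf{dim}\,\hat M$, and each map $X_k\to X_{k+1}$ for $k\in[N-1]$ is a fibration with fibre isomorphic to a product of ordinary Grassmannians of subspaces.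
   Context: All representations are finite dimensional over $\mathbb C$; $[m]:=\{1,\dots,m\}$; $\mathbb Z_n:=\mathbb Z/n\mathbb Z$. "Fibration" means locally trivial fibre bundle of algebraic varieties. Cycle quiver: $\Delta_n$ has vertex set $\mathbb Z_n$ and one arrow $i\to i+1$ for each $i\in\mathbb Z_n$. A representation $M$ consists of vector spaces $M^{(i)}$ and linear maps $M_i:M^{(i)}\to M^{(i+1)}$. $\mathrm{rep}_{\mathbb C}(\Delta_n,\mathrm I_N)$ is the category of representations of $\Delta_n$ in which every composition of $N$ consecutive maps vanishes. Cylinder quiver: $\hat\Delta_{n,N}$ has vertices $(i,k)$, $i\in\mathbb Z_n$, $k\in[N]$, and arrows $\alpha_{i,k}:(i,k)\to(i,k+1)$ for $k\in[N-1]$ and $\beta_{i,k}:(i,k)\to(i+1,k-1)$ for $k\in[N]\setminus\{1\}$. Functor $\Lambda$: for $M\in\mathrm{rep}_{\mathbb C}(\Delta_n,\mathrm I_N)$ let $\hat M=\Lambda(M)$ be the representation of $\hat\Delta_{n,N}$ with $\hat M^{(i,1)}=M^{(i)}$, $\hat M^{(i,k)}=M_{i+k-2}\circ\cdots\circ M_i(M^{(i)})\subseteq M^{(i+k-1)}$ for $k\ge2$; $\hat M_{\alpha_{i,k}}$ is the restriction of $M_{i+k-1}$, and $\hat M_{\beta_{i,k}}:\hat M^{(i,k)}\hookrightarrow\hat M^{(i+1,k-1)}$ is the natural inclusion of subspaces of $M^{(i+k-1)}$. Quiver Grassmannians: for a representation $V$ of a quiver and a dimension vector $\mathbf f$, $\mathrm{Gr}_{\mathbf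 f}(V)$ is the closed subvariety of $\prod_v\mathrm{Gr}_{f_v}(V^{(v)})$ consisting of all subrepresentations of $V$ of dimension vector $\mathbf f$. $\mathbf{dim}\,V$ denotes the dimension vector of $V$. For an isomorphism class $[E]$ of $\Delta_n$-representations the stratum $\mathcal S_{[E]}\subseteq\mathrm{Gr}_{\mathbf e}(M)$ is the set of all $U\in\mathrm{Gr}_{\mathbf e}(M)$ with $U\cong E$. $\mathrm{gsub}_{\mathbf e}(M)$ is the set of isomorphism classes $[E]$ such that $\mathcal S_{[E]}$ is (nonempty and) open in $\mathrm{Gr}_{\mathbf e}(M)$. $\mathrm{Gr}_a(\mathbb C^b)$ is the ordinary Grassmannian of $a$-dimensional subspaces of $\mathbb C^b$. *)

theory Defs
  imports
    "HOL-Analysis.Abstract_Topology"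
    "HOL-Library.Function_Algebras"
    "HOL-Library.FuncSet"
    "Graph_Theory.Digraph"
begin

section \<open>Complex vector spaces\<close>

class complex_vector = ab_group_add +
  fixes scaleC :: "complex \<Rightarrow> 'a \<Rightarrow> 'a"
  assumes scaleC_add_right: "scaleC c (x + y) = scaleC c x + scaleC c y"
    and scaleC_add_left: "scaleC (c + d) x = scaleC c x + scaleC d x"
    and scaleC_scaleC: "scaleC c (scaleC d x) = scaleC (c * d) x"
    and scaleC_one: "scaleC 1 x = x"

global_interpretation complex_vector:
  vector_space "scaleC :: complex \<Rightarrow> 'a \<Rightarrow> 'a::complex_vector"
  by unfold_locales (rule scaleC_add_right scaleC_add_left scaleC_scaleC scaleC_one)+

instantiation complex :: complex_vector
begin

definition "scaleC_complex (c::complex) (z::complex) = c * z"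

instance
  by standard (simp_all add: scaleC_complex_def algebra_simps)

end

instantiation "fun" :: (type, complex_vector) complex_vector
begin

definition "scaleC_fun c (f :: 'a \<Rightarrow> 'b) = (\<lambda>x. scaleC c (f x))"

instance
  by standard
    (simp_all add: scaleC_fun_def fun_eq_iff scaleC_add_right scaleC_add_left
      scaleC_scaleC scaleC_one)

end

definition fin_dim_subspace :: "'v::complex_vector set \<Rightarrow> bool" where
  "fin_dim_subspace S \<longleftrightarrow>
     complex_vector.subspace S \<and> (\<exists>B. finite B \<and> S \<subseteq> complex_vector.span B)"

definition clinear_on ::
  "'v::complex_vector set \<Rightarrow> ('v \<Rightarrow> 'w::complex_vector) \<Rightarrow> bool" where
  "clinear_on S f \<longleftrightarrow>
     (\<forall>x\<in>S. \<forall>y\<in>S. f (x + y) = f x + f y) \<and> (\<forall>c. \<forall>x\<in>S. f (scaleC c x) = scaleC c (f x))"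

text \<open>The space \<open>\<complex>\<^sup>m\<close>, as the sequences vanishing from index \<open>m\<close> on.\<close>

definition coord_space :: "nat \<Rightarrow> (nat \<Rightarrow> complex) set" where
  "coord_space m = {x. \<forall>i\<ge>m. x i = 0}"


section \<open>Algebraic varieties as spaces with functions\<close>

text \<open>
  A space with functions is a topological space with a sheaf of \<open>\<complex>\<close>-valued functions.
  A regular function on an open set \<open>U\<close> is represented by a total function of which only the
  values on \<open>U\<close> are relevant; \<open>reg_fun X U\<close> is meaningful only for \<open>U\<close> open.
\<close>

record 'a fspace =
  zar :: "'a topology"
  reg_fun :: "'a set \<Rightarrow> ('a \<Rightarrow> complex) set"

abbreviation points :: "'a fspace \<Rightarrow> 'a set" where
  "points X \<equiv> topspace (zar X)"

definition fun_sheaf :: "'a fspace \<Rightarrow> bool" where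
  "fun_sheaf X \<longleftrightarrow>
     (\<forall>U V f. openin (zar X) U \<longrightarrow> openin (zar X) V \<longrightarrow> V \<subseteq> U \<longrightarrow>
        f \<in> reg_fun X U \<longrightarrow> f \<in> reg_fun X V) \<and>
     (\<forall>U f. openin (zar X) U \<longrightarrow>
        (\<forall>x\<in>U. \<exists>W g. openin (zar X) W \<and> x \<in> W \<and> W \<subseteq> U \<and> g \<in> reg_fun X W \<and> (\<forall>y\<in>W. f y = g y)) \<longrightarrow>
        f \<in> reg_fun X U)"

definition morphism :: "'a fspace \<Rightarrow> 'b fspace \<Rightarrow> ('a \<Rightarrow> 'b) \<Rightarrow> bool" where
  "morphism X Y \<phi> \<longleftrightarrow>
     continuous_map (zar X) (zar Y) \<phi> \<and>
     (\<forall>U g. openin (zar Y) U \<longrightarrow> g \<in> reg_fun Y U \<longrightarrow>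
        (\<lambda>x. g (\<phi> x)) \<in> reg_fun X {x \<in> points X. \<phi> x \<in> U})"

definition isomorphism :: "'a fspace \<Rightarrow> 'b fspace \<Rightarrow> ('a \<Rightarrow> 'b) \<Rightarrow> bool" where
  "isomorphism X Y \<phi> \<longleftrightarrow>
     morphism X Y \<phi> \<and>
     (\<exists>\<psi>. morphism Y X \<psi> \<and> (\<forall>x\<in>points X. \<psi> (\<phi> x) = x) \<and> (\<forall>y\<in>points Y. \<phi> (\<psi> y) = y))"

definition isomorphic :: "'a fspace \<Rightarrow> 'b fspace \<Rightarrow> bool" where
  "isomorphic X Y \<longleftrightarrow> (\<exists>\<phi>. isomorphism X Y \<phi>)"

text \<open>The structure induced on a subset (used for locally closed ones).\<close>

definition induced :: "'a fspace \<Rightarrow> 'a set \<Rightarrow> 'a fspace" where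
  "induced X Z =
     \<lparr>zar = subtopology (zar X) Z,
      reg_fun = (\<lambda>U. {f. \<forall>x\<in>U. \<exists>W g. openin (zar X) W \<and> x \<in> W \<and> g \<in> reg_fun X W \<and>
                                   (\<forall>y\<in>U \<inter> W. f y = g y)})\<rparr>"

inductive_set gen_algebra :: "('a \<Rightarrow> complex) set \<Rightarrow> ('a \<Rightarrow> complex) set"
  for G :: "('a \<Rightarrow> complex) set" where
  const: "(\<lambda>_. c) \<in> gen_algebra G"
| gen: "f \<in> G \<Longrightarrow> f \<in> gen_algebra G"
| add: "f \<in> gen_algebra G \<Longrightarrow> g \<in> gen_algebra G \<Longrightarrow> (\<lambda>x. f x + g x) \<in> gen_algebra G"
| mult: "f \<in> gen_algebra G \<Longrightarrow> g \<in> gen_algebra G \<Longrightarrow> (\<lambda>x. f x * g x) \<in> gen_algebra G"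

text \<open>
  The common pattern behind affine space and products: given pairs \<open>(B, A)\<close> of a set and an algebra
  of functions on it, the open sets are generated by the nonvanishing loci in \<open>B\<close> of the elements of
  \<open>A\<close>, and the regular functions are those which locally are quotients \<open>p / q\<close> with \<open>p, q \<in> A\<close>.
\<close>

definition fraction_space :: "('a set \<times> ('a \<Rightarrow> complex) set) set \<Rightarrow> 'a fspace" where
  "fraction_space \<B> =
     \<lparr>zar = topology_generated_by {{x \<in> B. q x \<noteq> 0} | B A q. (B, A) \<in> \<B> \<and> q \<in> A},
      reg_fun = (\<lambda>U. {f. \<forall>x\<in>U. \<exists>B A p q. (B, A) \<in> \<B> \<and> p \<in> A \<and> q \<in> A \<and> x \<in> B \<and> q x \<noteq> 0 \<and>
                                   (\<forall>y\<in>U \<inter> B. q y \<noteq> 0 \<longrightarrow> f y = p y / q y)})\<rparr>"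

definition affine_space :: "nat \<Rightarrow> (nat \<Rightarrow> complex) fspace" where
  "affine_space d =
     fraction_space {(coord_space d, gen_algebra ((\<lambda>i x. x i) ` {..<d}))}"

definition prod_fspace :: "'a fspace \<Rightarrow> 'b fspace \<Rightarrow> ('a \<times> 'b) fspace" where
  "prod_fspace X Y = fraction_space
     {(U \<times> V, gen_algebra ({\<lambda>z. g (fst z) | g. g \<in> reg_fun X U} \<union> {\<lambda>z. h (snd z) | h. h \<in> reg_fun Y V}))
        | U V. openin (zar X) U \<and> openin (zar Y) V}"

text \<open>Products over a finite index set \<open>I\<close>.\<close>

definition Prod_fspace :: "'i set \<Rightarrow> ('i \<Rightarrow> 'a fspace) \<Rightarrow> ('i \<Rightarrow> 'a) fspace" where
  "Prod_fspace I X = fraction_space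
     {(PiE I U, gen_algebra {\<lambda>z. g (z i) | i g. i \<in> I \<and> g \<in> reg_fun (X i) (U i)})
        | U. \<forall>i\<in>I. openin (zar (X i)) (U i)}"

definition affine_variety :: "'a fspace \<Rightarrow> bool" where
  "affine_variety X \<longleftrightarrow>
     (\<exists>d Z. closedin (zar (affine_space d)) Z \<and> isomorphic X (induced (affine_space d) Z))"

text \<open>Varieties are separated, but not assumed to be irreducible or connected.\<close>

definition variety :: "'a fspace \<Rightarrow> bool" where
  "variety X \<longleftrightarrow>
     fun_sheaf X \<and>
     (\<exists>\<U>. finite \<U> \<and> \<Union>\<U> = points X \<and>
        (\<forall>U\<in>\<U>. openin (zar X) U \<and> affine_variety (induced X U))) \<and>
     closedin (zar (prod_fspace X X)) {(x, x) | x. x \<in> points X}"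

text \<open>Locally trivial (in the Zariski topology) fibre bundle \<open>p : X \<rightarrow> Y\<close> with fibre \<open>F\<close>.\<close>

definition fibration :: "'a fspace \<Rightarrow> 'b fspace \<Rightarrow> ('a \<Rightarrow> 'b) \<Rightarrow> 'c fspace \<Rightarrow> bool" where
  "fibration X Y p F \<longleftrightarrow>
     morphism X Y p \<and>
     (\<forall>y\<in>points Y. \<exists>U \<phi>. openin (zar Y) U \<and> y \<in> U \<and>
        isomorphism (induced X {x \<in> points X. p x \<in> U}) (prod_fspace (induced Y U) F) \<phi> \<and>
        (\<forall>x\<in>points X. p x \<in> U \<longrightarrow> fst (\<phi> x) = p x))"


section \<open>Grassmannians\<close>

text \<open>
  The variety of \<open>a\<close>-frames (linearly independent \<open>a\<close>-tuples) in \<open>V\<close>, an open subvariety of the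
  affine space \<open>V\<^sup>a\<close>; the polynomial functions on the latter are generated by the linear functionals
  of the individual vectors.
\<close>

definition frames :: "nat \<Rightarrow> 'v::complex_vector set \<Rightarrow> (nat \<Rightarrow> 'v) fspace" where
  "frames a V = fraction_space
     {({s \<in> {..<a} \<rightarrow>\<^sub>E V. inj_on s {..<a} \<and> complex_vector.independent (s ` {..<a})},
       gen_algebra {\<lambda>s. l (s j) | j l. j < a \<and> Vector_Spaces.linear scaleC scaleC l})}"

definition frame_span :: "nat \<Rightarrow> (nat \<Rightarrow> 'v::complex_vector) \<Rightarrow> 'v set" where
  "frame_span a s = complex_vector.span (s ` {..<a})"

definition gr_points :: "nat \<Rightarrow> 'v::complex_vector set \<Rightarrow> 'v set set" where
  "gr_points a V = {U. complex_vector.subspace U \<and> U \<subseteq> V \<and> complex_vector.dim U = a}"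

text \<open>
  The Grassmannian of \<open>a\<close>-dimensional subspaces of a finite dimensional space \<open>V\<close>, as the quotient of
  the variety of \<open>a\<close>-frames by \<open>GL\<^sub>a\<close>: a set of subspaces is open, and a function of subspaces is
  regular, iff its pull-back along the map sending a frame to its span is.
\<close>

definition gr :: "nat \<Rightarrow> 'v::complex_vector set \<Rightarrow> 'v set fspace" where
  "gr a V =
     \<lparr>zar = topology (\<lambda>\<O>. \<O> \<subseteq> gr_points a V \<and>
        openin (zar (frames a V)) {s \<in> points (frames a V). frame_span a s \<in> \<O>}),
      reg_fun = (\<lambda>\<O>. {f. (\<lambda>s. f (frame_span a s)) \<in>
        reg_fun (frames a V) {s \<in> points (frames a V). frame_span a s \<in> \<O>}})\<rparr>"

lemma openin_gr:
  "openin (zar (gr a V)) \<O> \<longleftrightarrow>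
     \<O> \<subseteq> gr_points a V \<and>
     openin (zar (frames a V)) {s \<in> points (frames a V). frame_span a s \<in> \<O>}"
proof -
  let ?T = "zar (frames a V)"
  let ?pre = "\<lambda>\<O>. {s \<in> topspace ?T. frame_span a s \<in> \<O>}"
  have "istopology (\<lambda>\<O>. \<O> \<subseteq> gr_points a V \<and> openin ?T (?pre \<O>))"
    unfolding istopology_def
  proof (intro conjI allI impI)
    fix S S' assume A: "S \<subseteq> gr_points a V \<and> openin ?T (?pre S)" "S' \<subseteq> gr_points a V \<and> openin ?T (?pre S')"
    then show "S \<inter> S' \<subseteq> gr_points a V" by blast
    have "?pre (S \<inter> S') = ?pre S \<inter> ?pre S'" by blast
    then show "openin ?T (?pre (S \<inter> S'))" using A by (simp add: openin_Int)
  next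
    fix \<K> assume A: "\<forall>K\<in>\<K>. K \<subseteq> gr_points a V \<and> openin ?T (?pre K)"
    then show "\<Union>\<K> \<subseteq> gr_points a V" by blast
    have "?pre (\<Union>\<K>) = (\<Union>K\<in>\<K>. ?pre K)" by blast
    then show "openin ?T (?pre (\<Union>\<K>))" using A by auto
  qed
  then show ?thesis by (simp add: gr_def topology_inverse')
qed


section \<open>Quiver representations and quiver Grassmannians\<close>

text \<open>
  A quiver is a directed multigraph. The spaces of a representation are subspaces of one ambient
  vector space, and only the values of the map at an arrow on the space at its tail are relevant.
\<close>

record ('a, 'b, 'v) qrep =
  qspace :: "'a \<Rightarrow> 'v set"
  qmap :: "'b \<Rightarrow> 'v \<Rightarrow> 'v"

definition is_rep :: "('a, 'b) pre_digraph \<Rightarrow> ('a, 'b, 'v::complex_vector) qrep \<Rightarrow> bool" where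
  "is_rep Q V \<longleftrightarrow>
     (\<forall>v\<in>verts Q. fin_dim_subspace (qspace V v)) \<and>
     (\<forall>r\<in>arcs Q. clinear_on (qspace V (tail Q r)) (qmap V r) \<and>
        qmap V r ` qspace V (tail Q r) \<subseteq> qspace V (head Q r))"

definition rep_iso ::
  "('a, 'b) pre_digraph \<Rightarrow> ('a, 'b, 'v::complex_vector) qrep \<Rightarrow>
     ('a, 'b, 'w::complex_vector) qrep \<Rightarrow> bool" where
  "rep_iso Q V W \<longleftrightarrow>
     (\<exists>\<phi>. (\<forall>v\<in>verts Q. clinear_on (qspace V v) (\<phi> v) \<and> bij_betw (\<phi> v) (qspace V v) (qspace W v)) \<and>
          (\<forall>r\<in>arcs Q. \<forall>x\<in>qspace V (tail Q r).
             \<phi> (head Q r) (qmap V r x) = qmap W r (\<phi> (tail Q r) x)))"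

definition dim_vec :: "('a, 'b, 'v::complex_vector) qrep \<Rightarrow> 'a \<Rightarrow> nat" where
  "dim_vec V v = complex_vector.dim (qspace V v)"

definition quiver_gr ::
  "('a, 'b) pre_digraph \<Rightarrow> ('a, 'b, 'v::complex_vector) qrep \<Rightarrow> ('a \<Rightarrow> nat) \<Rightarrow>
     ('a \<Rightarrow> 'v set) fspace" where
  "quiver_gr Q V f =
     induced (Prod_fspace (verts Q) (\<lambda>v. gr (f v) (qspace V v)))
       {U \<in> PiE (verts Q) (\<lambda>v. gr_points (f v) (qspace V v)).
          \<forall>r\<in>arcs Q. qmap V r ` U (tail Q r) \<subseteq> U (head Q r)}"

definition stratum ::
  "('a, 'b) pre_digraph \<Rightarrow> ('a \<Rightarrow> nat) \<Rightarrow> ('a, 'b, 'v::complex_vector) qrep \<Rightarrow>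
     ('a, 'b, 'w::complex_vector) qrep \<Rightarrow> ('a \<Rightarrow> 'v set) set" where
  "stratum Q e M E =
     {U \<in> points (quiver_gr Q M e). rep_iso Q \<lparr>qspace = U, qmap = qmap M\<rparr> E}"

text \<open>The representations whose isomorphism class lies in \<open>gsub\<^sub>e(M)\<close>.\<close>

definition gsub ::
  "('a, 'b) pre_digraph \<Rightarrow> ('a \<Rightarrow> nat) \<Rightarrow> ('a, 'b, 'v::complex_vector) qrep \<Rightarrow>
     ('a, 'b, 'w::complex_vector) qrep set" where
  "gsub Q e M =
     {E. is_rep Q E \<and> stratum Q e M E \<noteq> {} \<and> openin (zar (quiver_gr Q M e)) (stratum Q e M E)}"


section \<open>The cycle quiver and the cylinder quiver\<close>

text \<open>\<open>\<int>/n\<int>\<close> is represented by \<open>{..<n}\<close>; the arrow \<open>i \<rightarrow> i + 1\<close> is named \<open>i\<close>.\<close>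

definition cycle_quiver :: "nat \<Rightarrow> (nat, nat) pre_digraph" where
  "cycle_quiver n = \<lparr>verts = {..<n}, arcs = {..<n}, tail = (\<lambda>i. i), head = (\<lambda>i. (i + 1) mod n)\<rparr>"

text \<open>The composition \<open>M\<^bsub>i+l-1\<^esub> \<circ> \<dots> \<circ> M\<^sub>i\<close> of \<open>l\<close> consecutive maps.\<close>

primrec cycle_comp :: "nat \<Rightarrow> (nat, nat, 'v) qrep \<Rightarrow> nat \<Rightarrow> nat \<Rightarrow> 'v \<Rightarrow> 'v" where
  "cycle_comp n M i 0 = id"
| "cycle_comp n M i (Suc l) = qmap M ((i + l) mod n) \<circ> cycle_comp n M i l"

definition cycle_reps :: "nat \<Rightarrow> nat \<Rightarrow> (nat, nat, 'v::complex_vector) qrep set" where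
  "cycle_reps n N =
     {M. is_rep (cycle_quiver n) M \<and> (\<forall>i<n. \<forall>x\<in>qspace M i. cycle_comp n M i N x = 0)}"

datatype cyl_arrow = Alpha nat nat | Beta nat nat

fun cyl_tail :: "cyl_arrow \<Rightarrow> nat \<times> nat" where
  "cyl_tail (Alpha i k) = (i, k)"
| "cyl_tail (Beta i k) = (i, k)"

fun cyl_head :: "nat \<Rightarrow> cyl_arrow \<Rightarrow> nat \<times> nat" where
  "cyl_head n (Alpha i k) = (i, k + 1)"
| "cyl_head n (Beta i k) = ((i + 1) mod n, k - 1)"

definition cylinder_quiver :: "nat \<Rightarrow> nat \<Rightarrow> (nat \<times> nat, cyl_arrow) pre_digraph" where
  "cylinder_quiver n N =
     \<lparr>verts = {..<n} \<times> {1..N},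
      arcs = {Alpha i k | i k. i < n \<and> k \<in> {1..<N}} \<union> {Beta i k | i k. i < n \<and> k \<in> {2..N}},
      tail = cyl_tail, head = cyl_head n\<rparr>"

fun Lambda_space :: "nat \<Rightarrow> (nat, nat, 'v) qrep \<Rightarrow> nat \<times> nat \<Rightarrow> 'v set" where
  "Lambda_space n M (i, k) = cycle_comp n M i (k - 1) ` qspace M i"

fun Lambda_map :: "nat \<Rightarrow> (nat, nat, 'v) qrep \<Rightarrow> cyl_arrow \<Rightarrow> 'v \<Rightarrow> 'v" where
  "Lambda_map n M (Alpha i k) = qmap M ((i + k - 1) mod n)"
| "Lambda_map n M (Beta i k) = id"

definition Lambda :: "nat \<Rightarrow> (nat, nat, 'v) qrep \<Rightarrow> (nat \<times> nat, cyl_arrow, 'v) qrep" where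
  "Lambda n M = \<lparr>qspace = Lambda_space n M, qmap = Lambda_map n M\<rparr>"

end

theory Submission
  imports Defs
begin

text \<open>
  A point of the quiver Grassmannian of \<open>\<Lambda> M\<close> is a choice of subspaces \<open>U\<^bsub>i,k\<^esub>\<close> of the spaces of
  \<open>\<Lambda> M\<close>, of given dimensions, subject to one inclusion for each arrow. Every arrow joins two
  neighbouring levels. Once the levels above \<open>k\<close> are fixed, those between \<open>k\<close> and \<open>k + 1\<close> say that
  \<open>U\<^bsub>i-1,k+1\<^esub> \<subseteq> U\<^bsub>i,k\<^esub> \<subseteq> \<alpha>\<^sup>-\<^sup>1(U\<^bsub>i,k+1\<^esub>)\<close>, separately for each \<open>i\<close>. The lower bound is always
  contained in the upper one: \<open>\<alpha>\<close> maps \<open>U\<^bsub>i-1,k+1\<^esub>\<close> into \<open>U\<^bsub>i-1,k+2\<^esub> \<subseteq> U\<^bsub>i,k+1\<^esub>\<close>, and to zero if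
  \<open>k + 1 = N\<close>, as \<open>N\<close> consecutive maps of \<open>M\<close> compose to zero. The upper bound has constant dimension, as
  \<open>\<alpha>\<close> maps the space of \<open>\<Lambda> M\<close> at \<open>(i, k)\<close> onto that at \<open>(i, k + 1)\<close>. So the possible \<open>U\<^bsub>i,k\<^esub>\<close> form a
  Grassmannian of a quotient of constant dimension. Accordingly \<open>X\<^sub>k\<close> is the quiver Grassmannian of the full
  subquiver on the levels from \<open>k\<close> on (\<open>tower\<close>), and \<open>X\<^sub>k \<rightarrow> X\<^bsub>k+1\<^esub>\<close> forgets level \<open>k\<close>
  (\<open>fibration_tower\<close>). On level \<open>N\<close> alone there are no conditions (\<open>top_of_tower\<close>).

  What remains is to show that these spaces are varieties and that the bundles are locally trivial.
  This rests on linear algebra with coefficients in regular functions. A regular family of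
  tuples of vectors that is independent at a point has, near that point, a regular family of dual
  functionals (\<open>local_dual\<close>); hence independence is an open condition and coordinates are regular. It
  follows that a regular family of subspaces of constant dimension is a morphism to a Grassmannian
  (\<open>morphism_to_gr\<close>), that every morphism to a Grassmannian locally has a regular frame (\<open>local_frame\<close>),
  and that inclusion of one family of subspaces in another is a closed condition (\<open>closed_incidence\<close>). With
  the usual charts this shows that quiver Grassmannians are varieties (\<open>variety_quiver_gr\<close>). For the local
  triviality, a regular flag of bases adapted to the lower and upper bounds identifies all the
  quotients with one coordinate space (\<open>fibration_of_intermediate_subspaces\<close>).
\<close>

section \<open>Spaces with functions\<close>

text \<open>What the structure sheaf of a variety satisfies and all that is used of it: the regular functions
  form sheaves of algebras, and a regular function is invertible on the complement of its zeros, which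
  is open. Subspaces and products have their universal properties in this category, so that
  morphisms can be handled by components, without choosing equations.\<close>

definition locally_ringed :: "'a fspace \<Rightarrow> bool" where
  "locally_ringed X \<longleftrightarrow> fun_sheaf X \<and>
     (\<forall>U c. openin (zar X) U \<longrightarrow> (\<lambda>_. c) \<in> reg_fun X U) \<and>
     (\<forall>U f g. openin (zar X) U \<longrightarrow> f \<in> reg_fun X U \<longrightarrow> g \<in> reg_fun X U \<longrightarrow>
        (\<lambda>x. f x + g x) \<in> reg_fun X U \<and> (\<lambda>x. f x * g x) \<in> reg_fun X U) \<and>
     (\<forall>U f. openin (zar X) U \<longrightarrow> f \<in> reg_fun X U \<longrightarrow>
        openin (zar X) {x \<in> U. f x \<noteq> 0} \<and> (\<lambda>x. 1 / f x) \<in> reg_fun X {x \<in> U. f x \<noteq> 0})"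

lemma locally_ringed_sheaf: "locally_ringed X \<Longrightarrow> fun_sheaf X"
  by (simp add: locally_ringed_def)

lemma reg_restrict:
  "locally_ringed X \<Longrightarrow> f \<in> reg_fun X U \<Longrightarrow> openin (zar X) U \<Longrightarrow> openin (zar X) V \<Longrightarrow> V \<subseteq> U \<Longrightarrow>
     f \<in> reg_fun X V"
  using locally_ringed_sheaf[of X] by (simp add: fun_sheaf_def)

lemma reg_glue:
  assumes "locally_ringed X" "openin (zar X) U"
    and "\<And>x. x \<in> U \<Longrightarrow> \<exists>W g. openin (zar X) W \<and> x \<in> W \<and> W \<subseteq> U \<and> g \<in> reg_fun X W \<and> (\<forall>y\<in>W. f y = g y)"
  shows "f \<in> reg_fun X U"
proof -
  have glue: "\<forall>U f. openin (zar X) U \<longrightarrow>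
        (\<forall>x\<in>U. \<exists>W g. openin (zar X) W \<and> x \<in> W \<and> W \<subseteq> U \<and> g \<in> reg_fun X W \<and> (\<forall>y\<in>W. f y = g y)) \<longrightarrow>
        f \<in> reg_fun X U"
    using locally_ringed_sheaf[OF assms(1)] unfolding fun_sheaf_def by (rule conjunct2)
  show ?thesis by (rule glue[rule_format, OF assms(2)]) (rule assms(3))
qed

lemma reg_cong:
  assumes "locally_ringed X" "openin (zar X) U" "g \<in> reg_fun X U" "\<And>x. x \<in> U \<Longrightarrow> f x = g x"
  shows "f \<in> reg_fun X U"
  using assms by (intro reg_glue) auto

lemma reg_const: "locally_ringed X \<Longrightarrow> openin (zar X) U \<Longrightarrow> (\<lambda>_. c) \<in> reg_fun X U"
  by (simp add: locally_ringed_def)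

lemma reg_add:
  "locally_ringed X \<Longrightarrow> openin (zar X) U \<Longrightarrow> f \<in> reg_fun X U \<Longrightarrow> g \<in> reg_fun X U \<Longrightarrow>
     (\<lambda>x. f x + g x) \<in> reg_fun X U"
  by (simp add: locally_ringed_def)

lemma reg_mult:
  "locally_ringed X \<Longrightarrow> openin (zar X) U \<Longrightarrow> f \<in> reg_fun X U \<Longrightarrow> g \<in> reg_fun X U \<Longrightarrow>
     (\<lambda>x. f x * g x) \<in> reg_fun X U"
  by (simp add: locally_ringed_def)

lemma reg_sum:
  assumes "locally_ringed X" "openin (zar X) U" "\<And>j. j \<in> J \<Longrightarrow> f j \<in> reg_fun X U"
  shows "(\<lambda>x. \<Sum>j\<in>J. f j x) \<in> reg_fun X U"
  using assms(3)
proof (induction J rule: infinite_finite_induct)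
  case (insert j J)
  then have "(\<lambda>x. f j x + (\<Sum>j\<in>J. f j x)) \<in> reg_fun X U"
    using assms(1,2) by (intro reg_add) auto
  then show ?case using insert by simp
qed (use assms reg_const in auto)

lemma open_nonzero:
  "locally_ringed X \<Longrightarrow> openin (zar X) U \<Longrightarrow> f \<in> reg_fun X U \<Longrightarrow> openin (zar X) {x \<in> U. f x \<noteq> 0}"
  by (simp add: locally_ringed_def)

lemma reg_inverse:
  "locally_ringed X \<Longrightarrow> openin (zar X) U \<Longrightarrow> f \<in> reg_fun X U \<Longrightarrow>
     (\<lambda>x. 1 / f x) \<in> reg_fun X {x \<in> U. f x \<noteq> 0}"
  by (simp add: locally_ringed_def)

lemma reg_divide:
  assumes "locally_ringed X" "openin (zar X) U" "f \<in> reg_fun X U" "g \<in> reg_fun X U"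
    and "\<And>x. x \<in> U \<Longrightarrow> g x \<noteq> 0"
  shows "(\<lambda>x. f x / g x) \<in> reg_fun X U"
proof -
  have "{x \<in> U. g x \<noteq> 0} = U" using assms(5) by auto
  then have "(\<lambda>x. 1 / g x) \<in> reg_fun X U" using reg_inverse[OF assms(1,2,4)] by simp
  from reg_mult[OF assms(1-3) this] show ?thesis by simp
qed

subsection \<open>Morphisms\<close>

lemma morphismI:
  assumes "\<And>x. x \<in> points X \<Longrightarrow> \<phi> x \<in> points Y"
    and "\<And>U. openin (zar Y) U \<Longrightarrow> openin (zar X) {x \<in> points X. \<phi> x \<in> U}"
    and "\<And>U g. openin (zar Y) U \<Longrightarrow> g \<in> reg_fun Y U \<Longrightarrow>
        (\<lambda>x. g (\<phi> x)) \<in> reg_fun X {x \<in> points X. \<phi> x \<in> U}"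
  shows "morphism X Y \<phi>"
  using assms unfolding morphism_def continuous_map_def by blast

lemma morphism_points: "morphism X Y \<phi> \<Longrightarrow> x \<in> points X \<Longrightarrow> \<phi> x \<in> points Y"
  unfolding morphism_def continuous_map_def by blast

lemma morphism_open: "morphism X Y \<phi> \<Longrightarrow> openin (zar Y) U \<Longrightarrow> openin (zar X) {x \<in> points X. \<phi> x \<in> U}"
  unfolding morphism_def continuous_map_def by blast

lemma morphism_reg:
  "morphism X Y \<phi> \<Longrightarrow> openin (zar Y) U \<Longrightarrow> g \<in> reg_fun Y U \<Longrightarrow>
     (\<lambda>x. g (\<phi> x)) \<in> reg_fun X {x \<in> points X. \<phi> x \<in> U}"
  unfolding morphism_def by blast

lemma morphism_reg_open:
  assumes "locally_ringed X" "morphism X Y \<phi>" "openin (zar Y) U" "g \<in> reg_fun Y U"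
    "openin (zar X) W" "\<And>x. x \<in> W \<Longrightarrow> \<phi> x \<in> U"
  shows "(\<lambda>x. g (\<phi> x)) \<in> reg_fun X W"
proof (rule reg_restrict[OF assms(1) morphism_reg[OF assms(2-4)] morphism_open[OF assms(2,3)] assms(5)])
  show "W \<subseteq> {x \<in> points X. \<phi> x \<in> U}" using assms(5,6) openin_subset by fastforce
qed

lemma morphism_closed:
  "morphism X Y \<phi> \<Longrightarrow> closedin (zar Y) C \<Longrightarrow> closedin (zar X) {x \<in> points X. \<phi> x \<in> C}"
  unfolding morphism_def by (blast intro: closedin_continuous_map_preimage)

lemma morphism_compose:
  assumes "morphism X Y \<phi>" "morphism Y Z \<psi>"
  shows "morphism X Z (\<lambda>x. \<psi> (\<phi> x))"
proof (rule morphismI)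
  fix U assume U: "openin (zar Z) U"
  have eq: "{x \<in> points X. \<phi> x \<in> {y \<in> points Y. \<psi> y \<in> U}} = {x \<in> points X. \<psi> (\<phi> x) \<in> U}"
    using morphism_points[OF assms(1)] by auto
  show "openin (zar X) {x \<in> points X. \<psi> (\<phi> x) \<in> U}"
    using morphism_open[OF assms(1) morphism_open[OF assms(2) U]] eq by simp
  fix g assume g: "g \<in> reg_fun Z U"
  show "(\<lambda>x. g (\<psi> (\<phi> x))) \<in> reg_fun X {x \<in> points X. \<psi> (\<phi> x) \<in> U}"
    using morphism_reg[OF assms(1) morphism_open[OF assms(2) U] morphism_reg[OF assms(2) U g]] eq
    by simp
qed (use assms morphism_points in metis)

lemma morphism_cong:
  assumes "locally_ringed X" "morphism X Y \<phi>" "\<And>x. x \<in> points X \<Longrightarrow> \<psi> x = \<phi> x"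
  shows "morphism X Y \<psi>"
proof (rule morphismI)
  fix U assume U: "openin (zar Y) U"
  have eq: "{x \<in> points X. \<psi> x \<in> U} = {x \<in> points X. \<phi> x \<in> U}" using assms(3) by auto
  show "openin (zar X) {x \<in> points X. \<psi> x \<in> U}" using morphism_open[OF assms(2) U] eq by simp
  fix g assume g: "g \<in> reg_fun Y U"
  show "(\<lambda>x. g (\<psi> x)) \<in> reg_fun X {x \<in> points X. \<psi> x \<in> U}" unfolding eq
    by (rule reg_cong[OF assms(1) morphism_open[OF assms(2) U] morphism_reg[OF assms(2) U g]])
      (use assms(3) in auto)
qed (use assms morphism_points in metis)

lemma morphism_id: "locally_ringed X \<Longrightarrow> morphism X X (\<lambda>x. x)"
  by (rule morphismI) (auto simp: Collect_conj_eq Int_absorb1 openin_subset intro: reg_restrict)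

subsection \<open>Induced structures\<close>

lemma points_induced [simp]: "points (induced X Z) = points X \<inter> Z"
  by (simp add: induced_def)

lemma openin_induced: "openin (zar (induced X Z)) U \<longleftrightarrow> (\<exists>T. openin (zar X) T \<and> U = T \<inter> Z)"
  by (simp add: induced_def openin_subtopology)

lemma reg_induced:
  "f \<in> reg_fun (induced X Z) U \<longleftrightarrow>
     (\<forall>x\<in>U. \<exists>W g. openin (zar X) W \<and> x \<in> W \<and> g \<in> reg_fun X W \<and> (\<forall>y\<in>U \<inter> W. f y = g y))"
  by (simp add: induced_def)

lemma reg_inducedE:
  assumes "f \<in> reg_fun (induced X Z) U" "x \<in> U"
  obtains W g where "openin (zar X) W" "x \<in> W" "g \<in> reg_fun X W" "\<And>y. y \<in> U \<Longrightarrow> y \<in> W \<Longrightarrow> f y = g y"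
proof -
  obtain W g where "openin (zar X) W \<and> x \<in> W \<and> g \<in> reg_fun X W \<and> (\<forall>y\<in>U \<inter> W. f y = g y)"
    using bspec[OF assms(1)[unfolded reg_induced] assms(2)] by (elim exE)
  then show thesis by (intro that[of W g]) auto
qed

lemma reg_inducedI:
  assumes "\<And>x. x \<in> U \<Longrightarrow> \<exists>W g. openin (zar X) W \<and> x \<in> W \<and> g \<in> reg_fun X W \<and> (\<forall>y\<in>U \<inter> W. f y = g y)"
  shows "f \<in> reg_fun (induced X Z) U"
  using assms unfolding reg_induced by (intro ballI)

lemma locally_ringed_induced:
  assumes X: "locally_ringed X"
  shows "locally_ringed (induced X Z)"
  unfolding locally_ringed_def
proof (intro conjI allI impI)
  have binary: "(\<lambda>x. F (f x) (g x)) \<in> reg_fun (induced X Z) U"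
    if f: "f \<in> reg_fun (induced X Z) U" and g: "g \<in> reg_fun (induced X Z) U"
      and F: "\<And>W f g. openin (zar X) W \<Longrightarrow> f \<in> reg_fun X W \<Longrightarrow> g \<in> reg_fun X W \<Longrightarrow>
        (\<lambda>x. F (f x) (g x)) \<in> reg_fun X W" for F f g U
  proof (rule reg_inducedI)
    fix x assume x: "x \<in> U"
    obtain W f' where W: "openin (zar X) W" "x \<in> W" "f' \<in> reg_fun X W" "\<And>y. y \<in> U \<Longrightarrow> y \<in> W \<Longrightarrow> f y = f' y"
      by (rule reg_inducedE[OF f x]) (rule that)
    obtain W' g' where W': "openin (zar X) W'" "x \<in> W'" "g' \<in> reg_fun X W'" "\<And>y. y \<in> U \<Longrightarrow> y \<in> W' \<Longrightarrow> g y = g' y"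
      by (rule reg_inducedE[OF g x]) (rule that)
    have WW: "openin (zar X) (W \<inter> W')" using W W' by blast
    have "(\<lambda>x. F (f' x) (g' x)) \<in> reg_fun X (W \<inter> W')"
      by (intro F WW reg_restrict[OF X W(3,1) WW] reg_restrict[OF X W'(3,1) WW]) auto
    then show "\<exists>W h. openin (zar X) W \<and> x \<in> W \<and> h \<in> reg_fun X W \<and> (\<forall>y\<in>U \<inter> W. F (f y) (g y) = h y)"
      using WW W W' by (intro exI[of _ "W \<inter> W'"] exI[of _ "\<lambda>x. F (f' x) (g' x)"]) auto
  qed
  show "(\<lambda>x. f x + g x) \<in> reg_fun (induced X Z) U" "(\<lambda>x. f x * g x) \<in> reg_fun (induced X Z) U"
    if "f \<in> reg_fun (induced X Z) U" "g \<in> reg_fun (induced X Z) U" for f g U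
    using binary[OF that] reg_add[OF X] reg_mult[OF X] by blast+
  show "(\<lambda>_. c) \<in> reg_fun (induced X Z) U" if "openin (zar (induced X Z)) U" for U c
    using that reg_const[OF X] unfolding reg_induced openin_induced by blast
  show "fun_sheaf (induced X Z)"
    unfolding fun_sheaf_def
  proof (intro conjI allI impI)
    fix U V f assume VU: "V \<subseteq> U" and f: "f \<in> reg_fun (induced X Z) U"
    show "f \<in> reg_fun (induced X Z) V"
    proof (rule reg_inducedI)
      fix x assume "x \<in> V"
      then have x: "x \<in> U" using VU by blast
      obtain W g where W: "openin (zar X) W" "x \<in> W" "g \<in> reg_fun X W"
        "\<And>y. y \<in> U \<Longrightarrow> y \<in> W \<Longrightarrow> f y = g y"
        by (rule reg_inducedE[OF f x]) (rule that)
      then show "\<exists>W g. openin (zar X) W \<and> x \<in> W \<and> g \<in> reg_fun X W \<and> (\<forall>y\<in>V \<inter> W. f y = g y)"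
        using VU by (intro exI[of _ W] exI[of _ g]) auto
    qed
  next
    fix U f
    assume U: "openin (zar (induced X Z)) U"
      and loc: "\<forall>x\<in>U. \<exists>W g. openin (zar (induced X Z)) W \<and> x \<in> W \<and> W \<subseteq> U \<and>
                 g \<in> reg_fun (induced X Z) W \<and> (\<forall>y\<in>W. f y = g y)"
    show "f \<in> reg_fun (induced X Z) U"
      unfolding reg_induced
    proof
      fix x assume x: "x \<in> U"
      obtain W g where "openin (zar (induced X Z)) W \<and> x \<in> W \<and> W \<subseteq> U \<and>
                 g \<in> reg_fun (induced X Z) W \<and> (\<forall>y\<in>W. f y = g y)"
        using bspec[OF loc x] by (elim exE)
      then have W: "openin (zar (induced X Z)) W" "x \<in> W" "g \<in> reg_fun (induced X Z) W" "\<forall>y\<in>W. f y = g y"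
        by auto
      obtain T where T: "openin (zar X) T" "W = T \<inter> Z" using W(1) unfolding openin_induced by blast
      obtain W1 g1 where W1: "openin (zar X) W1" "x \<in> W1" "g1 \<in> reg_fun X W1"
        "\<And>y. y \<in> W \<Longrightarrow> y \<in> W1 \<Longrightarrow> g y = g1 y"
        by (rule reg_inducedE[OF W(3,2)]) (rule that)
      have "U \<subseteq> Z" using U unfolding openin_induced by blast
      moreover have "g1 \<in> reg_fun X (T \<inter> W1)"
        using T(1) W1 by (intro reg_restrict[OF X W1(3)]) auto
      ultimately show "\<exists>W g. openin (zar X) W \<and> x \<in> W \<and> g \<in> reg_fun X W \<and> (\<forall>y\<in>U \<inter> W. f y = g y)"
        using T W W1 by (intro exI[of _ "T \<inter> W1"] exI[of _ g1]) auto
    qed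
  qed
  fix U f assume U: "openin (zar (induced X Z)) U" and f: "f \<in> reg_fun (induced X Z) U"
  obtain T where T: "openin (zar X) T" "U = T \<inter> Z" using U unfolding openin_induced by blast
  show "openin (zar (induced X Z)) {x \<in> U. f x \<noteq> 0}"
  proof (subst openin_subopen, intro ballI)
    fix x assume x: "x \<in> {x \<in> U. f x \<noteq> 0}"
    then have "x \<in> U" by simp
    then obtain W g where W: "openin (zar X) W" "x \<in> W" "g \<in> reg_fun X W"
      "\<And>y. y \<in> U \<Longrightarrow> y \<in> W \<Longrightarrow> f y = g y"
      by (rule reg_inducedE[OF f]) (rule that)
    have "openin (zar X) (T \<inter> {y \<in> W. g y \<noteq> 0})" using T open_nonzero[OF X W(1,3)] by blast
    then have "openin (zar (induced X Z)) ((T \<inter> {y \<in> W. g y \<noteq> 0}) \<inter> Z)"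
      unfolding openin_induced by blast
    then show "\<exists>T. openin (zar (induced X Z)) T \<and> x \<in> T \<and> T \<subseteq> {x \<in> U. f x \<noteq> 0}"
      using W x T by (intro exI[of _ "(T \<inter> {y \<in> W. g y \<noteq> 0}) \<inter> Z"]) auto
  qed
  show "(\<lambda>x. 1 / f x) \<in> reg_fun (induced X Z) {x \<in> U. f x \<noteq> 0}"
    unfolding reg_induced
  proof
    fix x assume x: "x \<in> {x \<in> U. f x \<noteq> 0}"
    then have "x \<in> U" by simp
    then obtain W g where W: "openin (zar X) W" "x \<in> W" "g \<in> reg_fun X W"
      "\<And>y. y \<in> U \<Longrightarrow> y \<in> W \<Longrightarrow> f y = g y"
      by (rule reg_inducedE[OF f]) (rule that)
    show "\<exists>W g. openin (zar X) W \<and> x \<in> W \<and> g \<in> reg_fun X W \<and>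
         (\<forall>y\<in>{x \<in> U. f x \<noteq> 0} \<inter> W. 1 / f y = g y)"
      using open_nonzero[OF X W(1,3)] reg_inverse[OF X W(1,3)] W x
      by (intro exI[of _ "{y \<in> W. g y \<noteq> 0}"] exI[of _ "\<lambda>y. 1 / g y"]) auto
  qed
qed

lemma reg_induced_open:
  assumes "openin (zar X) U" "f \<in> reg_fun X U"
  shows "f \<in> reg_fun (induced X Z) (U \<inter> Z)"
  using assms unfolding reg_induced by blast

text \<open>Functions on an open subspace are given locally by functions on the whole space, and these glue.\<close>

lemma reg_open_subspace:
  assumes X: "locally_ringed X" and V: "openin (zar X) V" and U: "openin (zar X) U" "V \<subseteq> U"
    and f: "f \<in> reg_fun (induced X U) V"
  shows "f \<in> reg_fun X V"
proof (rule reg_glue[OF X V])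
  fix x assume "x \<in> V"
  then obtain W g where W: "openin (zar X) W" "x \<in> W" "g \<in> reg_fun X W"
    "\<And>y. y \<in> V \<Longrightarrow> y \<in> W \<Longrightarrow> f y = g y"
    by (rule reg_inducedE[OF f]) (rule that)
  then show "\<exists>W g. openin (zar X) W \<and> x \<in> W \<and> W \<subseteq> V \<and> g \<in> reg_fun X W \<and> (\<forall>y\<in>W. f y = g y)"
    using V \<open>x \<in> V\<close> reg_restrict[OF X W(3,1), of "V \<inter> W"]
    by (intro exI[of _ "V \<inter> W"] exI[of _ g]) auto
qed

lemma morphism_from_induced:
  assumes X: "locally_ringed X" and "morphism X Y \<phi>"
  shows "morphism (induced X Z) Y \<phi>"
proof (rule morphismI)
  fix U assume U: "openin (zar Y) U"
  have eq: "{x \<in> points (induced X Z). \<phi> x \<in> U} = {x \<in> points X. \<phi> x \<in> U} \<inter> Z" by auto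
  show "openin (zar (induced X Z)) {x \<in> points (induced X Z). \<phi> x \<in> U}"
    unfolding eq openin_induced using morphism_open[OF assms(2) U] by blast
  fix g assume g: "g \<in> reg_fun Y U"
  show "(\<lambda>x. g (\<phi> x)) \<in> reg_fun (induced X Z) {x \<in> points (induced X Z). \<phi> x \<in> U}"
    unfolding eq using morphism_open[OF assms(2) U] morphism_reg[OF assms(2) U g]
    by (rule reg_induced_open)
qed (use assms(2) morphism_points in fastforce)

text \<open>The universal property of a subspace: regular functions on it extend locally to the whole space, and
  it is the extensions that are pulled back.\<close>

lemma morphism_to_induced:
  assumes X: "locally_ringed X" and \<phi>: "morphism X Y \<phi>" and Z: "\<And>x. x \<in> points X \<Longrightarrow> \<phi> x \<in> Z"
  shows "morphism X (induced Y Z) \<phi>"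
proof (rule morphismI)
  fix U assume U: "openin (zar (induced Y Z)) U"
  then obtain T where T: "openin (zar Y) T" "U = T \<inter> Z" unfolding openin_induced by blast
  have eq: "{x \<in> points X. \<phi> x \<in> U} = {x \<in> points X. \<phi> x \<in> T}" using T Z by auto
  show op: "openin (zar X) {x \<in> points X. \<phi> x \<in> U}"
    unfolding eq using morphism_open[OF \<phi> T(1)] .
  fix g assume g: "g \<in> reg_fun (induced Y Z) U"
  show "(\<lambda>x. g (\<phi> x)) \<in> reg_fun X {x \<in> points X. \<phi> x \<in> U}"
  proof (rule reg_glue[OF X op])
    fix x assume x: "x \<in> {x \<in> points X. \<phi> x \<in> U}"
    then have "\<phi> x \<in> U" by simp
    then obtain W h where W: "openin (zar Y) W" "\<phi> x \<in> W" "h \<in> reg_fun Y W"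
      "\<And>y. y \<in> U \<Longrightarrow> y \<in> W \<Longrightarrow> g y = h y"
      by (rule reg_inducedE[OF g]) (rule that)
    have op2: "openin (zar X) ({x \<in> points X. \<phi> x \<in> U} \<inter> {x \<in> points X. \<phi> x \<in> W})"
      using op morphism_open[OF \<phi> W(1)] by blast
    show "\<exists>W h. openin (zar X) W \<and> x \<in> W \<and> W \<subseteq> {x \<in> points X. \<phi> x \<in> U} \<and> h \<in> reg_fun X W \<and>
        (\<forall>y\<in>W. g (\<phi> y) = h y)"
      using x W op2
      by (intro exI[of _ "{x \<in> points X. \<phi> x \<in> U} \<inter> {x \<in> points X. \<phi> x \<in> W}"] exI[of _ "\<lambda>x. h (\<phi> x)"])
        (auto intro!: morphism_reg_open[OF X \<phi> W(1,3)])
  qed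
qed (use morphism_points[OF \<phi>] Z in auto)

lemma morphism_inclusion: "locally_ringed X \<Longrightarrow> morphism (induced X Z) X (\<lambda>x. x)"
  by (intro morphism_from_induced morphism_id)

lemma morphism_local:
  assumes X: "locally_ringed X"
    and loc: "\<And>x. x \<in> points X \<Longrightarrow> \<exists>W. openin (zar X) W \<and> x \<in> W \<and> morphism (induced X W) Y \<phi>"
  shows "morphism X Y \<phi>"
proof (rule morphismI)
  show "\<phi> x \<in> points Y" if "x \<in> points X" for x
    using loc[OF that] that morphism_points by fastforce
  fix U assume U: "openin (zar Y) U"
  have piece: "openin (zar X) ({x \<in> points X. \<phi> x \<in> U} \<inter> W) \<and>
      openin (zar (induced X W)) {x \<in> points (induced X W). \<phi> x \<in> U} \<and>
      {x \<in> points (induced X W). \<phi> x \<in> U} = {x \<in> points X. \<phi> x \<in> U} \<inter> W"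
    if W: "openin (zar X) W" "morphism (induced X W) Y \<phi>" for W
  proof -
    have eq: "{x \<in> points (induced X W). \<phi> x \<in> U} = {x \<in> points X. \<phi> x \<in> U} \<inter> W" by auto
    have op: "openin (zar (induced X W)) {x \<in> points (induced X W). \<phi> x \<in> U}"
      by (rule morphism_open[OF W(2) U])
    then obtain T where "openin (zar X) T" "{x \<in> points (induced X W). \<phi> x \<in> U} = T \<inter> W"
      unfolding openin_induced by blast
    then show ?thesis using op W(1) eq openin_Int by metis
  qed
  show op: "openin (zar X) {x \<in> points X. \<phi> x \<in> U}"
  proof (subst openin_subopen, intro ballI)
    fix x assume x: "x \<in> {x \<in> points X. \<phi> x \<in> U}"
    then obtain W where "openin (zar X) W" "x \<in> W" "morphism (induced X W) Y \<phi>" using loc by auto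
    then show "\<exists>T. openin (zar X) T \<and> x \<in> T \<and> T \<subseteq> {x \<in> points X. \<phi> x \<in> U}"
      using piece x by (intro exI[of _ "{x \<in> points X. \<phi> x \<in> U} \<inter> W"]) auto
  qed
  fix g assume g: "g \<in> reg_fun Y U"
  show "(\<lambda>x. g (\<phi> x)) \<in> reg_fun X {x \<in> points X. \<phi> x \<in> U}"
  proof (rule reg_glue[OF X op])
    fix x assume x: "x \<in> {x \<in> points X. \<phi> x \<in> U}"
    then obtain W where W: "openin (zar X) W" "x \<in> W" "morphism (induced X W) Y \<phi>" using loc by auto
    have "(\<lambda>x. g (\<phi> x)) \<in> reg_fun (induced X W) ({x \<in> points X. \<phi> x \<in> U} \<inter> W)"
      using morphism_reg[OF W(3) U g] piece[OF W(1,3)] by simp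
    then have "(\<lambda>x. g (\<phi> x)) \<in> reg_fun X ({x \<in> points X. \<phi> x \<in> U} \<inter> W)"
      using piece[OF W(1,3)] W(1) by (intro reg_open_subspace[OF X _ W(1)]) auto
    then show "\<exists>W h. openin (zar X) W \<and> x \<in> W \<and> W \<subseteq> {x \<in> points X. \<phi> x \<in> U} \<and> h \<in> reg_fun X W \<and>
        (\<forall>y\<in>W. g (\<phi> y) = h y)"
      using x W piece[OF W(1,3)]
      by (intro exI[of _ "{x \<in> points X. \<phi> x \<in> U} \<inter> W"] exI[of _ "\<lambda>x. g (\<phi> x)"]) auto
  qed
qed

subsection \<open>Spaces of fractions\<close>

text \<open>The second condition says that the family is directed: two fractions can be brought to a common
  domain and a common algebra, on which they can be added and multiplied.\<close>

definition fraction_family :: "('a set \<times> ('a \<Rightarrow> complex) set) set \<Rightarrow> bool" where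
  "fraction_family \<B> \<longleftrightarrow>
     (\<forall>B A. (B, A) \<in> \<B> \<longrightarrow> (\<forall>c. (\<lambda>_. c) \<in> A) \<and>
        (\<forall>p\<in>A. \<forall>q\<in>A. (\<lambda>x. p x + q x) \<in> A \<and> (\<lambda>x. p x * q x) \<in> A)) \<and>
     (\<forall>B A B' A'. (B, A) \<in> \<B> \<longrightarrow> (B', A') \<in> \<B> \<longrightarrow>
        (\<exists>A''. (B \<inter> B', A'') \<in> \<B> \<and> A \<subseteq> A'' \<and> A' \<subseteq> A''))"

lemma fraction_family_const: "fraction_family \<B> \<Longrightarrow> (B, A) \<in> \<B> \<Longrightarrow> (\<lambda>_. c) \<in> A"
  and fraction_family_add:
    "fraction_family \<B> \<Longrightarrow> (B, A) \<in> \<B> \<Longrightarrow> p \<in> A \<Longrightarrow> q \<in> A \<Longrightarrow> (\<lambda>x. p x + q x) \<in> A"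
  and fraction_family_mult:
    "fraction_family \<B> \<Longrightarrow> (B, A) \<in> \<B> \<Longrightarrow> p \<in> A \<Longrightarrow> q \<in> A \<Longrightarrow> (\<lambda>x. p x * q x) \<in> A"
  and fraction_family_directed:
    "fraction_family \<B> \<Longrightarrow> (B, A) \<in> \<B> \<Longrightarrow> (B', A') \<in> \<B> \<Longrightarrow>
       \<exists>A''. (B \<inter> B', A'') \<in> \<B> \<and> A \<subseteq> A'' \<and> A' \<subseteq> A''"
  unfolding fraction_family_def by simp_all

lemma points_fraction_space:
  assumes "fraction_family \<B>"
  shows "points (fraction_space \<B>) = \<Union>(fst ` \<B>)"
proof (intro equalityI subsetI)
  fix x assume "x \<in> points (fraction_space \<B>)"
  then show "x \<in> \<Union>(fst ` \<B>)" unfolding fraction_space_def by force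
next
  fix x assume "x \<in> \<Union>(fst ` \<B>)"
  then obtain B A where 1: "(B, A) \<in> \<B>" "x \<in> B" by force
  have "{y \<in> B. (1::complex) \<noteq> 0} \<in> {{x \<in> B. q x \<noteq> 0} | B A q. (B, A) \<in> \<B> \<and> q \<in> A}"
    using 1 fraction_family_const[OF assms 1(1), of 1] by (intro CollectI exI conjI) auto
  then show "x \<in> points (fraction_space \<B>)"
    unfolding fraction_space_def using 1(2) by auto
qed

lemma reg_fraction_space:
  "f \<in> reg_fun (fraction_space \<B>) U \<longleftrightarrow>
     (\<forall>x\<in>U. \<exists>B A p q. (B, A) \<in> \<B> \<and> p \<in> A \<and> q \<in> A \<and> x \<in> B \<and> q x \<noteq> 0 \<and>
                                   (\<forall>y\<in>U \<inter> B. q y \<noteq> 0 \<longrightarrow> f y = p y / q y))"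
  by (simp add: fraction_space_def)

lemma reg_fraction_spaceI:
  assumes "\<And>x. x \<in> U \<Longrightarrow> \<exists>B A p q. (B, A) \<in> \<B> \<and> p \<in> A \<and> q \<in> A \<and> x \<in> B \<and> q x \<noteq> 0 \<and>
                                   (\<forall>y\<in>U \<inter> B. q y \<noteq> 0 \<longrightarrow> f y = p y / q y)"
  shows "f \<in> reg_fun (fraction_space \<B>) U"
  using assms unfolding reg_fraction_space by (intro ballI)

lemma reg_fraction_spaceE:
  assumes "f \<in> reg_fun (fraction_space \<B>) U" "x \<in> U"
  obtains B A p q where "(B, A) \<in> \<B>" "p \<in> A" "q \<in> A" "x \<in> B" "q x \<noteq> 0"
    "\<And>y. y \<in> U \<Longrightarrow> y \<in> B \<Longrightarrow> q y \<noteq> 0 \<Longrightarrow> f y = p y / q y"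
proof -
  obtain B A p q where "(B, A) \<in> \<B> \<and> p \<in> A \<and> q \<in> A \<and> x \<in> B \<and> q x \<noteq> 0 \<and>
      (\<forall>y\<in>U \<inter> B. q y \<noteq> 0 \<longrightarrow> f y = p y / q y)"
    using bspec[OF assms(1)[unfolded reg_fraction_space] assms(2)] by (elim exE)
  then show thesis by (intro that[of B A p q]) auto
qed

lemma open_fraction_generator:
  "(B, A) \<in> \<B> \<Longrightarrow> q \<in> A \<Longrightarrow> openin (zar (fraction_space \<B>)) {x \<in> B. q x \<noteq> 0}"
  unfolding fraction_space_def by (auto intro!: topology_generated_by_Basis)

lemma open_fraction_set:
  assumes "fraction_family \<B>" "(B, A) \<in> \<B>"
  shows "openin (zar (fraction_space \<B>)) B"
proof -
  have "(\<lambda>_. 1) \<in> A" using assms unfolding fraction_family_def by blast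
  from open_fraction_generator[OF assms(2) this] show ?thesis by simp
qed

text \<open>The intersection of two generating open sets is again a generating one, because
  the family is directed and \<open>q q'\<close> vanishes where \<open>q\<close> or \<open>q'\<close> does; so these sets form a basis.\<close>

lemma fraction_space_basis:
  assumes F: "fraction_family \<B>" and "openin (zar (fraction_space \<B>)) W" "x \<in> W"
  obtains B A q where "(B, A) \<in> \<B>" "q \<in> A" "x \<in> B" "q x \<noteq> 0" "{y \<in> B. q y \<noteq> 0} \<subseteq> W"
proof -
  have "generate_topology_on {{x \<in> B. q x \<noteq> 0} | B A q. (B, A) \<in> \<B> \<and> q \<in> A} W"
    using assms(2) unfolding fraction_space_def by (simp add: openin_topology_generated_by_iff)
  then have "\<forall>x\<in>W. \<exists>B A q. (B, A) \<in> \<B> \<and> q \<in> A \<and> x \<in> B \<and> q x \<noteq> 0 \<and> {y \<in> B. q y \<noteq> 0} \<subseteq> W"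
  proof induction
    case (Int a b)
    show ?case
    proof
      fix x assume "x \<in> a \<inter> b"
      then have x: "x \<in> a" "x \<in> b" by auto
      obtain B A q where 1: "(B, A) \<in> \<B> \<and> q \<in> A \<and> x \<in> B \<and> q x \<noteq> 0 \<and> {y \<in> B. q y \<noteq> 0} \<subseteq> a"
        using bspec[OF Int.IH(1) x(1)] by (elim exE)
      obtain B' A' q' where 2: "(B', A') \<in> \<B> \<and> q' \<in> A' \<and> x \<in> B' \<and> q' x \<noteq> 0 \<and> {y \<in> B'. q' y \<noteq> 0} \<subseteq> b"
        using bspec[OF Int.IH(2) x(2)] by (elim exE)
      obtain A'' where A: "(B \<inter> B', A'') \<in> \<B>" "A \<subseteq> A''" "A' \<subseteq> A''"
        using fraction_family_directed[OF F] 1 2 by meson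
      then have "(\<lambda>x. q x * q' x) \<in> A''"
        using 1 2 by (intro fraction_family_mult[OF F A(1)]) auto
      then show "\<exists>B A q. (B, A) \<in> \<B> \<and> q \<in> A \<and> x \<in> B \<and> q x \<noteq> 0 \<and> {y \<in> B. q y \<noteq> 0} \<subseteq> a \<inter> b"
        using A 1 2 by (intro exI[of _ "B \<inter> B'"] exI[of _ A''] exI[of _ "\<lambda>x. q x * q' x"]) auto
    qed
  next
    case (UN K)
    show ?case
    proof
      fix x assume "x \<in> \<Union>K"
      then obtain k where "k \<in> K" "x \<in> k" by blast
      then show "\<exists>B A q. (B, A) \<in> \<B> \<and> q \<in> A \<and> x \<in> B \<and> q x \<noteq> 0 \<and> {y \<in> B. q y \<noteq> 0} \<subseteq> \<Union>K"
        using UN.IH[of k] by (meson Union_upper subset_trans)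
    qed
  next
    case (Basis s)
    then show ?case by blast
  qed auto
  then show thesis using assms(3) that by blast
qed

text \<open>Fractions are closed under the operations of a field. Where necessary the representing
  fraction is extended by a further denominator, so that its own denominator is nonzero only at points
  where the fractions that it comes from are known to represent the given functions.\<close>

lemma locally_ringed_fraction_space:
  assumes F: "fraction_family \<B>"
  shows "locally_ringed (fraction_space \<B>)"
proof -
  let ?X = "fraction_space \<B>"
  note const = fraction_family_const[OF F] and add = fraction_family_add[OF F]
    and mult = fraction_family_mult[OF F] and dir = fraction_family_directed[OF F]
  have common: "\<exists>B A p q p'. (B, A) \<in> \<B> \<and> p \<in> A \<and> p' \<in> A \<and> q \<in> A \<and> x \<in> B \<and> q x \<noteq> 0 \<and>
      (\<forall>y\<in>U \<inter> B. q y \<noteq> 0 \<longrightarrow> f y = p y / q y \<and> g y = p' y / q y)"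
    if fg: "f \<in> reg_fun ?X U" "g \<in> reg_fun ?X U" and x: "x \<in> U" for f g U x
  proof -
    obtain B A p q where 1: "(B, A) \<in> \<B>" "p \<in> A" "q \<in> A" "x \<in> B" "q x \<noteq> 0"
      "\<And>y. y \<in> U \<Longrightarrow> y \<in> B \<Longrightarrow> q y \<noteq> 0 \<Longrightarrow> f y = p y / q y"
      by (rule reg_fraction_spaceE[OF fg(1) x]) (rule that)
    obtain B' A' p' q' where 2: "(B', A') \<in> \<B>" "p' \<in> A'" "q' \<in> A'" "x \<in> B'" "q' x \<noteq> 0"
      "\<And>y. y \<in> U \<Longrightarrow> y \<in> B' \<Longrightarrow> q' y \<noteq> 0 \<Longrightarrow> g y = p' y / q' y"
      by (rule reg_fraction_spaceE[OF fg(2) x]) (rule that)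
    obtain A'' where A: "(B \<inter> B', A'') \<in> \<B>" "A \<subseteq> A''" "A' \<subseteq> A''"
      using dir[OF 1(1) 2(1)] by blast
    have in_A'': "(\<lambda>x. p x * q' x) \<in> A''" "(\<lambda>x. q x * q' x) \<in> A''" "(\<lambda>x. p' x * q x) \<in> A''"
      using A(2,3) 1(2,3) 2(2,3) by (auto intro!: mult[OF A(1)])
    show ?thesis
      using A(1) 1(4-) 2(4-) in_A''
      by (intro exI[of _ "B \<inter> B'"] exI[of _ A''] exI[of _ "\<lambda>x. p x * q' x"] exI[of _ "\<lambda>x. q x * q' x"]
          exI[of _ "\<lambda>x. p' x * q x"]) auto
  qed
  have sheaf: "fun_sheaf ?X"
    unfolding fun_sheaf_def
  proof (intro conjI allI impI)
    fix U V f assume VU: "V \<subseteq> U" and f: "f \<in> reg_fun ?X U"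
    show "f \<in> reg_fun ?X V"
    proof (rule reg_fraction_spaceI)
      fix x assume "x \<in> V"
      then have x: "x \<in> U" using VU by blast
      obtain B A p q where "(B, A) \<in> \<B>" "p \<in> A" "q \<in> A" "x \<in> B" "q x \<noteq> 0"
        "\<And>y. y \<in> U \<Longrightarrow> y \<in> B \<Longrightarrow> q y \<noteq> 0 \<Longrightarrow> f y = p y / q y"
        by (rule reg_fraction_spaceE[OF f x]) (rule that)
      then show "\<exists>B A p q. (B, A) \<in> \<B> \<and> p \<in> A \<and> q \<in> A \<and> x \<in> B \<and> q x \<noteq> 0 \<and>
          (\<forall>y\<in>V \<inter> B. q y \<noteq> 0 \<longrightarrow> f y = p y / q y)"
        using VU by (intro exI[of _ B] exI[of _ A] exI[of _ p] exI[of _ q]) auto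
    qed
  next
    fix U f
    assume loc: "\<forall>x\<in>U. \<exists>W g. openin (zar ?X) W \<and> x \<in> W \<and> W \<subseteq> U \<and> g \<in> reg_fun ?X W \<and> (\<forall>y\<in>W. f y = g y)"
    show "f \<in> reg_fun ?X U"
    proof (rule reg_fraction_spaceI)
      fix x assume x: "x \<in> U"
      obtain W g where "openin (zar ?X) W \<and> x \<in> W \<and> W \<subseteq> U \<and> g \<in> reg_fun ?X W \<and> (\<forall>y\<in>W. f y = g y)"
        using bspec[OF loc x] by (elim exE)
      then have W: "openin (zar ?X) W" "x \<in> W" "g \<in> reg_fun ?X W" "\<forall>y\<in>W. f y = g y" by auto
      obtain B A p q where 1: "(B, A) \<in> \<B>" "p \<in> A" "q \<in> A" "x \<in> B" "q x \<noteq> 0"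
        "\<And>y. y \<in> W \<Longrightarrow> y \<in> B \<Longrightarrow> q y \<noteq> 0 \<Longrightarrow> g y = p y / q y"
        by (rule reg_fraction_spaceE[OF W(3,2)]) (rule that)
      obtain B' A' q' where 2: "(B', A') \<in> \<B>" "q' \<in> A'" "x \<in> B'" "q' x \<noteq> 0" "{y \<in> B'. q' y \<noteq> 0} \<subseteq> W"
        using fraction_space_basis[OF F W(1,2)] by blast
      obtain A'' where A: "(B \<inter> B', A'') \<in> \<B>" "A \<subseteq> A''" "A' \<subseteq> A''"
        using dir[OF 1(1) 2(1)] by blast
      have in_A'': "(\<lambda>x. p x * q' x) \<in> A''" "(\<lambda>x. q x * q' x) \<in> A''"
        using A(2,3) 1(2,3) 2(2) by (auto intro!: mult[OF A(1)])
      show "\<exists>B A p q. (B, A) \<in> \<B> \<and> p \<in> A \<and> q \<in> A \<and> x \<in> B \<and> q x \<noteq> 0 \<and>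
                                   (\<forall>y\<in>U \<inter> B. q y \<noteq> 0 \<longrightarrow> f y = p y / q y)"
        using A(1) 1(4-) 2(3-) in_A'' W(4)
        by (intro exI[of _ "B \<inter> B'"] exI[of _ A''] exI[of _ "\<lambda>x. p x * q' x"] exI[of _ "\<lambda>x. q x * q' x"])
          (auto simp: subset_iff)
    qed
  qed
  show ?thesis
    unfolding locally_ringed_def
  proof (intro conjI allI impI)
    fix U c assume U: "openin (zar ?X) U"
    show "(\<lambda>_. c) \<in> reg_fun ?X U"
    proof (rule reg_fraction_spaceI)
      fix x assume "x \<in> U"
      then have "x \<in> \<Union>(fst ` \<B>)" using openin_subset[OF U] points_fraction_space[OF F] by blast
      then obtain B A where "(B, A) \<in> \<B>" "x \<in> B" by force
      then show "\<exists>B A p q. (B, A) \<in> \<B> \<and> p \<in> A \<and> q \<in> A \<and> x \<in> B \<and> q x \<noteq> 0 \<and>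
          (\<forall>y\<in>U \<inter> B. q y \<noteq> 0 \<longrightarrow> c = p y / q y)"
        using const by (intro exI[of _ B] exI[of _ A] exI[of _ "\<lambda>_. c"] exI[of _ "\<lambda>_. 1"]) auto
    qed
  next
    fix U f g assume fg: "f \<in> reg_fun ?X U" "g \<in> reg_fun ?X U"
    show "(\<lambda>x. f x + g x) \<in> reg_fun ?X U"
    proof (rule reg_fraction_spaceI)
      fix x assume "x \<in> U"
      from common[OF fg this] obtain B A p q p' where "(B, A) \<in> \<B>" "p \<in> A" "p' \<in> A" "q \<in> A" "x \<in> B" "q x \<noteq> 0"
        "\<forall>y\<in>U \<inter> B. q y \<noteq> 0 \<longrightarrow> f y = p y / q y \<and> g y = p' y / q y" by blast
      then show "\<exists>B A p q. (B, A) \<in> \<B> \<and> p \<in> A \<and> q \<in> A \<and> x \<in> B \<and> q x \<noteq> 0 \<and>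
          (\<forall>y\<in>U \<inter> B. q y \<noteq> 0 \<longrightarrow> f y + g y = p y / q y)"
        using add by (intro exI[of _ B] exI[of _ A] exI[of _ "\<lambda>x. p x + p' x"] exI[of _ q])
          (auto simp: add_divide_distrib)
    qed
    show "(\<lambda>x. f x * g x) \<in> reg_fun ?X U"
    proof (rule reg_fraction_spaceI)
      fix x assume "x \<in> U"
      from common[OF fg this] obtain B A p q p' where "(B, A) \<in> \<B>" "p \<in> A" "p' \<in> A" "q \<in> A" "x \<in> B" "q x \<noteq> 0"
        "\<forall>y\<in>U \<inter> B. q y \<noteq> 0 \<longrightarrow> f y = p y / q y \<and> g y = p' y / q y" by blast
      then show "\<exists>B A p q. (B, A) \<in> \<B> \<and> p \<in> A \<and> q \<in> A \<and> x \<in> B \<and> q x \<noteq> 0 \<and>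
          (\<forall>y\<in>U \<inter> B. q y \<noteq> 0 \<longrightarrow> f y * g y = p y / q y)"
        using mult by (intro exI[of _ B] exI[of _ A] exI[of _ "\<lambda>x. p x * p' x"] exI[of _ "\<lambda>x. q x * q x"]) auto
    qed
  next
    fix U f assume U: "openin (zar ?X) U" and f: "f \<in> reg_fun ?X U"
    have loc: "\<exists>B A p q. (B, A) \<in> \<B> \<and> p \<in> A \<and> q \<in> A \<and> x \<in> B \<and> q x \<noteq> 0 \<and> p x \<noteq> 0 \<and>
        (\<forall>y\<in>U \<inter> B. q y \<noteq> 0 \<longrightarrow> f y = p y / q y)" if x: "x \<in> U" "f x \<noteq> 0" for x
    proof -
      obtain B A p q where 1: "(B, A) \<in> \<B>" "p \<in> A" "q \<in> A" "x \<in> B" "q x \<noteq> 0"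
        "\<And>y. y \<in> U \<Longrightarrow> y \<in> B \<Longrightarrow> q y \<noteq> 0 \<Longrightarrow> f y = p y / q y"
        by (rule reg_fraction_spaceE[OF f x(1)]) (rule that)
      then have "p x \<noteq> 0" using x by auto
      then show ?thesis using 1 by (intro exI[of _ B] exI[of _ A] exI[of _ p] exI[of _ q]) auto
    qed
    show "openin (zar ?X) {x \<in> U. f x \<noteq> 0}"
    proof (subst openin_subopen, intro ballI)
      fix x assume x: "x \<in> {x \<in> U. f x \<noteq> 0}"
      then obtain B A p q where 1: "(B, A) \<in> \<B>" "p \<in> A" "q \<in> A" "x \<in> B" "q x \<noteq> 0" "p x \<noteq> 0"
        "\<forall>y\<in>U \<inter> B. q y \<noteq> 0 \<longrightarrow> f y = p y / q y"
        using loc[of x] by auto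
      have "openin (zar ?X) (U \<inter> {y \<in> B. p y * q y \<noteq> 0})"
        by (intro openin_Int U open_fraction_generator[OF 1(1) mult[OF 1(1-3)]])
      then show "\<exists>T. openin (zar ?X) T \<and> x \<in> T \<and> T \<subseteq> {x \<in> U. f x \<noteq> 0}"
        using 1 x by (intro exI[of _ "U \<inter> {y \<in> B. p y * q y \<noteq> 0}"]) auto
    qed
    show "(\<lambda>x. 1 / f x) \<in> reg_fun ?X {x \<in> U. f x \<noteq> 0}"
    proof (rule reg_fraction_spaceI)
      fix x assume x: "x \<in> {x \<in> U. f x \<noteq> 0}"
      then obtain B A p q where 1: "(B, A) \<in> \<B>" "p \<in> A" "q \<in> A" "x \<in> B" "q x \<noteq> 0" "p x \<noteq> 0"
        "\<forall>y\<in>U \<inter> B. q y \<noteq> 0 \<longrightarrow> f y = p y / q y"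
        using loc[of x] by auto
      then show "\<exists>B A p q. (B, A) \<in> \<B> \<and> p \<in> A \<and> q \<in> A \<and> x \<in> B \<and> q x \<noteq> 0 \<and>
         (\<forall>y\<in>{x \<in> U. f x \<noteq> 0} \<inter> B. q y \<noteq> 0 \<longrightarrow> 1 / f y = p y / q y)"
        using mult[OF 1(1)]
        \<comment> \<open>\<open>q / p\<close> extended by \<open>q\<close>: where \<open>p q\<close> is nonzero, \<open>f\<close> is indeed \<open>p / q\<close>\<close>
        by (intro exI[of _ B] exI[of _ A] exI[of _ "\<lambda>x. q x * q x"] exI[of _ "\<lambda>x. p x * q x"]) auto
    qed
  qed (rule sheaf)
qed

lemma reg_of_algebra:
  assumes F: "fraction_family \<B>" and "(B, A) \<in> \<B>" "p \<in> A"
  shows "p \<in> reg_fun (fraction_space \<B>) B"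
proof (rule reg_fraction_spaceI)
  fix x assume "x \<in> B"
  moreover have "(\<lambda>_. 1) \<in> A" using assms unfolding fraction_family_def by blast
  ultimately show "\<exists>B' A p' q. (B', A) \<in> \<B> \<and> p' \<in> A \<and> q \<in> A \<and> x \<in> B' \<and> q x \<noteq> 0 \<and>
    (\<forall>y\<in>B \<inter> B'. q y \<noteq> 0 \<longrightarrow> p y = p' y / q y)"
    using assms by (intro exI[of _ B] exI[of _ A] exI[of _ p] exI[of _ "\<lambda>_. 1"]) auto
qed

text \<open>Pulling back a fraction gives a fraction, and the basic open sets are nonvanishing loci, so only the
  generating algebras have to be tested.\<close>

lemma morphism_to_fraction_space:
  assumes Z: "locally_ringed Z" and F: "fraction_family \<B>"
    and points: "\<And>z. z \<in> points Z \<Longrightarrow> \<exists>B A. (B, A) \<in> \<B> \<and> \<phi> z \<in> B"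
    and op: "\<And>B A. (B, A) \<in> \<B> \<Longrightarrow> openin (zar Z) {z \<in> points Z. \<phi> z \<in> B}"
    and reg: "\<And>B A q. (B, A) \<in> \<B> \<Longrightarrow> q \<in> A \<Longrightarrow> (\<lambda>z. q (\<phi> z)) \<in> reg_fun Z {z \<in> points Z. \<phi> z \<in> B}"
  shows "morphism Z (fraction_space \<B>) \<phi>"
proof -
  let ?X = "fraction_space \<B>"
  have gen: "openin (zar Z) {z \<in> points Z. \<phi> z \<in> B \<and> q (\<phi> z) \<noteq> 0}" if "(B, A) \<in> \<B>" "q \<in> A" for B A q
  proof -
    have "{z \<in> points Z. \<phi> z \<in> B \<and> q (\<phi> z) \<noteq> 0} = {z \<in> {z \<in> points Z. \<phi> z \<in> B}. q (\<phi> z) \<noteq> 0}" by auto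
    then show ?thesis using open_nonzero[OF Z op[OF that(1)] reg[OF that]] by simp
  qed
  show ?thesis
  proof (rule morphismI)
    show "\<phi> z \<in> points ?X" if "z \<in> points Z" for z
      using points[OF that] unfolding points_fraction_space[OF F] by force
    fix U assume U: "openin (zar ?X) U"
    show opU: "openin (zar Z) {z \<in> points Z. \<phi> z \<in> U}"
    proof (subst openin_subopen, intro ballI)
      fix z assume z: "z \<in> {z \<in> points Z. \<phi> z \<in> U}"
      then obtain B A q where 1: "(B, A) \<in> \<B>" "q \<in> A" "\<phi> z \<in> B" "q (\<phi> z) \<noteq> 0" "{y \<in> B. q y \<noteq> 0} \<subseteq> U"
        using fraction_space_basis[OF F U] by blast
      then show "\<exists>T. openin (zar Z) T \<and> z \<in> T \<and> T \<subseteq> {z \<in> points Z. \<phi> z \<in> U}"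
        using gen[OF 1(1,2)] z by (intro exI[of _ "{z \<in> points Z. \<phi> z \<in> B \<and> q (\<phi> z) \<noteq> 0}"]) auto
    qed
    fix g assume g: "g \<in> reg_fun ?X U"
    show "(\<lambda>z. g (\<phi> z)) \<in> reg_fun Z {z \<in> points Z. \<phi> z \<in> U}"
    proof (rule reg_glue[OF Z opU])
      fix z assume z: "z \<in> {z \<in> points Z. \<phi> z \<in> U}"
      then have "\<phi> z \<in> U" by simp
      then obtain B A p q where 1: "(B, A) \<in> \<B>" "p \<in> A" "q \<in> A" "\<phi> z \<in> B" "q (\<phi> z) \<noteq> 0"
        "\<And>y. y \<in> U \<Longrightarrow> y \<in> B \<Longrightarrow> q y \<noteq> 0 \<Longrightarrow> g y = p y / q y"
        by (rule reg_fraction_spaceE[OF g]) (rule that)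
      let ?W = "{z \<in> points Z. \<phi> z \<in> U} \<inter> {z \<in> points Z. \<phi> z \<in> B \<and> q (\<phi> z) \<noteq> 0}"
      have W: "openin (zar Z) ?W" using opU gen[OF 1(1,3)] by blast
      have "(\<lambda>z. p (\<phi> z) / q (\<phi> z)) \<in> reg_fun Z ?W"
        by (rule reg_divide[OF Z W]; (rule reg_restrict[OF Z reg[OF 1(1)] op[OF 1(1)] W])?)
          (use 1 in auto)
      then show "\<exists>W h. openin (zar Z) W \<and> z \<in> W \<and> W \<subseteq> {z \<in> points Z. \<phi> z \<in> U} \<and> h \<in> reg_fun Z W \<and>
          (\<forall>y\<in>W. g (\<phi> y) = h y)"
        using W z 1 by (intro exI[of _ ?W] exI[of _ "\<lambda>z. p (\<phi> z) / q (\<phi> z)"]) auto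
    qed
  qed
qed

lemma gen_algebra_mono: "G \<subseteq> H \<Longrightarrow> gen_algebra G \<subseteq> gen_algebra H"
proof
  fix f assume "f \<in> gen_algebra G" "G \<subseteq> H"
  then show "f \<in> gen_algebra H" by induction (auto intro: gen_algebra.intros)
qed

lemma reg_gen_algebra:
  assumes Z: "locally_ringed Z" "openin (zar Z) W" and "q \<in> gen_algebra G"
    and "\<And>g. g \<in> G \<Longrightarrow> (\<lambda>z. g (\<phi> z)) \<in> reg_fun Z W"
  shows "(\<lambda>z. q (\<phi> z)) \<in> reg_fun Z W"
  using assms(3)
  by induction (use assms(4) reg_const[OF Z] reg_add[OF Z] reg_mult[OF Z] in auto)

lemma fraction_family_single: "fraction_family {(B, gen_algebra G)}"
  unfolding fraction_family_def by (auto intro: gen_algebra.intros)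

lemma morphism_to_fraction_space_single:
  assumes Z: "locally_ringed Z"
    and B: "\<And>z. z \<in> points Z \<Longrightarrow> \<phi> z \<in> B"
    and G: "\<And>g. g \<in> G \<Longrightarrow> (\<lambda>z. g (\<phi> z)) \<in> reg_fun Z (points Z)"
  shows "morphism Z (fraction_space {(B, gen_algebra G)}) \<phi>"
proof -
  have "{z \<in> points Z. \<phi> z \<in> B} = points Z" using B by auto
  then show ?thesis
    by (intro morphism_to_fraction_space[OF Z fraction_family_single])
      (use B reg_gen_algebra[OF Z _ _ G] in auto)
qed

subsection \<open>Affine space\<close>

lemma locally_ringed_affine_space: "locally_ringed (affine_space d)"
  unfolding affine_space_def by (intro locally_ringed_fraction_space fraction_family_single)

lemma points_affine_space [simp]: "points (affine_space d) = coord_space d"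
  unfolding affine_space_def by (simp add: points_fraction_space fraction_family_single)

lemma reg_coordinate:
  assumes "i < d"
  shows "(\<lambda>x. x i) \<in> reg_fun (affine_space d) (coord_space d)"
  unfolding affine_space_def
  by (rule reg_of_algebra[OF fraction_family_single singletonI]) (use assms in \<open>auto intro!: gen_algebra.gen\<close>)

lemma morphism_to_affine_space:
  assumes "locally_ringed Z" "\<And>z. z \<in> points Z \<Longrightarrow> \<phi> z \<in> coord_space d"
    and "\<And>i. i < d \<Longrightarrow> (\<lambda>z. \<phi> z i) \<in> reg_fun Z (points Z)"
  shows "morphism Z (affine_space d) \<phi>"
  unfolding affine_space_def by (rule morphism_to_fraction_space_single) (use assms in auto)

subsection \<open>Products\<close>

lemma fraction_family_prod:
  assumes X: "locally_ringed X" and Y: "locally_ringed Y"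
  shows "fraction_family
     {(U \<times> V, gen_algebra ({\<lambda>z. g (fst z) | g. g \<in> reg_fun X U} \<union> {\<lambda>z. h (snd z) | h. h \<in> reg_fun Y V}))
        | U V. openin (zar X) U \<and> openin (zar Y) V}" (is "fraction_family ?F")
proof -
  let ?G = "\<lambda>U V. {\<lambda>z. g (fst z) | g. g \<in> reg_fun X U} \<union> {\<lambda>z. h (snd z) | h. h \<in> reg_fun Y V}"
  have "\<exists>A''. ((U \<times> V) \<inter> (U' \<times> V'), A'') \<in> ?F \<and> gen_algebra (?G U V) \<subseteq> A'' \<and> gen_algebra (?G U' V') \<subseteq> A''"
    if op: "openin (zar X) U" "openin (zar Y) V" "openin (zar X) U'" "openin (zar Y) V'" for U V U' V'
  proof -
    have eq: "(U \<times> V) \<inter> (U' \<times> V') = (U \<inter> U') \<times> (V \<inter> V')" by auto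
    have "reg_fun X U \<subseteq> reg_fun X (U \<inter> U')" "reg_fun X U' \<subseteq> reg_fun X (U \<inter> U')"
      "reg_fun Y V \<subseteq> reg_fun Y (V \<inter> V')" "reg_fun Y V' \<subseteq> reg_fun Y (V \<inter> V')"
      using op by (auto intro: reg_restrict[OF X] reg_restrict[OF Y])
    then have "?G U V \<subseteq> ?G (U \<inter> U') (V \<inter> V')" "?G U' V' \<subseteq> ?G (U \<inter> U') (V \<inter> V')" by blast+
    note sub = this[THEN gen_algebra_mono]
    show ?thesis unfolding eq
      by (rule exI[of _ "gen_algebra (?G (U \<inter> U') (V \<inter> V'))"])
        (use sub op openin_Int in blast)
  qed
  then show ?thesis
    unfolding fraction_family_def by (auto intro: gen_algebra.intros)
qed

lemma locally_ringed_prod: "locally_ringed X \<Longrightarrow> locally_ringed Y \<Longrightarrow> locally_ringed (prod_fspace X Y)"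
  unfolding prod_fspace_def by (intro locally_ringed_fraction_space fraction_family_prod)

lemma points_prod [simp]:
  assumes X: "locally_ringed X" and Y: "locally_ringed Y"
  shows "points (prod_fspace X Y) = points X \<times> points Y"
  unfolding prod_fspace_def points_fraction_space[OF fraction_family_prod[OF X Y]]
proof (intro equalityI subsetI)
  fix z assume "z \<in> points X \<times> points Y"
  then show "z \<in> \<Union> (fst ` {(U \<times> V, gen_algebra ({\<lambda>z. g (fst z) | g. g \<in> reg_fun X U} \<union>
       {\<lambda>z. h (snd z) | h. h \<in> reg_fun Y V})) | U V. openin (zar X) U \<and> openin (zar Y) V})"
    by (intro UN_I[of "(points X \<times> points Y, _)"]) auto
next
  fix z assume "z \<in> \<Union> (fst ` {(U \<times> V, gen_algebra ({\<lambda>z. g (fst z) | g. g \<in> reg_fun X U} \<union>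
       {\<lambda>z. h (snd z) | h. h \<in> reg_fun Y V})) | U V. openin (zar X) U \<and> openin (zar Y) V})"
  then show "z \<in> points X \<times> points Y" by (auto dest: openin_subset[THEN subsetD])
qed

lemma morphism_fst:
  assumes X: "locally_ringed X" and Y: "locally_ringed Y"
  shows "morphism (prod_fspace X Y) X fst"
proof (rule morphismI)
  fix U assume U: "openin (zar X) U"
  have eq: "{z \<in> points (prod_fspace X Y). fst z \<in> U} = U \<times> points Y"
    using openin_subset[OF U] X Y by auto
  note [simp] = eq
  show "openin (zar (prod_fspace X Y)) {z \<in> points (prod_fspace X Y). fst z \<in> U}"
    unfolding eq unfolding prod_fspace_def
    by (rule open_fraction_set[OF fraction_family_prod[OF X Y]]) (use U in blast)
  fix g assume "g \<in> reg_fun X U"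
  then show "(\<lambda>z. g (fst z)) \<in> reg_fun (prod_fspace X Y) {z \<in> points (prod_fspace X Y). fst z \<in> U}"
    unfolding eq unfolding prod_fspace_def
    by (intro reg_of_algebra[OF fraction_family_prod[OF X Y]], use U in blast) (auto intro!: gen_algebra.gen)
qed (use X Y in auto)

lemma morphism_snd:
  assumes X: "locally_ringed X" and Y: "locally_ringed Y"
  shows "morphism (prod_fspace X Y) Y snd"
proof (rule morphismI)
  fix U assume U: "openin (zar Y) U"
  have eq: "{z \<in> points (prod_fspace X Y). snd z \<in> U} = points X \<times> U"
    using openin_subset[OF U] X Y by auto
  show "openin (zar (prod_fspace X Y)) {z \<in> points (prod_fspace X Y). snd z \<in> U}"
    unfolding eq unfolding prod_fspace_def
    by (rule open_fraction_set[OF fraction_family_prod[OF X Y]]) (use U in blast)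
  fix g assume "g \<in> reg_fun Y U"
  then show "(\<lambda>z. g (snd z)) \<in> reg_fun (prod_fspace X Y) {z \<in> points (prod_fspace X Y). snd z \<in> U}"
    unfolding eq unfolding prod_fspace_def
    by (intro reg_of_algebra[OF fraction_family_prod[OF X Y]], use U in blast) (auto intro!: gen_algebra.gen)
qed (use X Y in auto)

text \<open>The universal property of a product: the algebra on \<open>U \<times> V\<close> is generated by functions of one factor,
  and these pull back to regular functions along the components.\<close>

lemma morphism_to_prod:
  assumes Z: "locally_ringed Z" and X: "locally_ringed X" and Y: "locally_ringed Y"
    and \<phi>: "morphism Z X \<phi>" and \<psi>: "morphism Z Y \<psi>"
  shows "morphism Z (prod_fspace X Y) (\<lambda>z. (\<phi> z, \<psi> z))"
  unfolding prod_fspace_def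
proof (rule morphism_to_fraction_space[OF Z fraction_family_prod[OF X Y]], goal_cases)
  case (1 z)
  then show ?case using morphism_points[OF \<phi>] morphism_points[OF \<psi>] by blast
next
  case (2 B A)
  then obtain U V where UV: "openin (zar X) U" "openin (zar Y) V" "B = U \<times> V" by auto
  have "{z \<in> points Z. (\<phi> z, \<psi> z) \<in> B} = {z \<in> points Z. \<phi> z \<in> U} \<inter> {z \<in> points Z. \<psi> z \<in> V}"
    using UV by auto
  then show ?case using morphism_open[OF \<phi> UV(1)] morphism_open[OF \<psi> UV(2)] by auto
next
  case (3 B A q)
  then obtain U V where UV: "openin (zar X) U" "openin (zar Y) V" "B = U \<times> V"
    "A = gen_algebra ({\<lambda>z. g (fst z) | g. g \<in> reg_fun X U} \<union> {\<lambda>z. h (snd z) | h. h \<in> reg_fun Y V})" by auto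
  have "{z \<in> points Z. (\<phi> z, \<psi> z) \<in> B} = {z \<in> points Z. \<phi> z \<in> U} \<inter> {z \<in> points Z. \<psi> z \<in> V}"
    using UV by auto
  then have op: "openin (zar Z) {z \<in> points Z. (\<phi> z, \<psi> z) \<in> B}"
    using morphism_open[OF \<phi> UV(1)] morphism_open[OF \<psi> UV(2)] by auto
  show ?case
    by (rule reg_gen_algebra[OF Z op 3(2)[unfolded UV(4)]])
      (use op UV in \<open>auto intro: morphism_reg_open[OF Z \<phi> UV(1)] morphism_reg_open[OF Z \<psi> UV(2)]\<close>)
qed

lemma fraction_family_Prod:
  assumes X: "\<forall>i\<in>I. locally_ringed (X i)"
  shows "fraction_family
     {(PiE I U, gen_algebra {\<lambda>z. g (z i) | i g. i \<in> I \<and> g \<in> reg_fun (X i) (U i)})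
        | U. \<forall>i\<in>I. openin (zar (X i)) (U i)}" (is "fraction_family ?F")
proof -
  let ?G = "\<lambda>U. {\<lambda>z. g (z i) | i g. i \<in> I \<and> g \<in> reg_fun (X i) (U i)}"
  have "\<exists>A''. (PiE I U \<inter> PiE I U', A'') \<in> ?F \<and> gen_algebra (?G U) \<subseteq> A'' \<and> gen_algebra (?G U') \<subseteq> A''"
    if op: "\<forall>i\<in>I. openin (zar (X i)) (U i)" "\<forall>i\<in>I. openin (zar (X i)) (U' i)" for U U'
  proof -
    let ?V = "\<lambda>i. U i \<inter> U' i"
    have opV: "\<forall>i\<in>I. openin (zar (X i)) (?V i)" using op by blast
    have eq: "PiE I U \<inter> PiE I U' = PiE I ?V" by (simp add: PiE_Int)
    have "reg_fun (X i) (U i) \<subseteq> reg_fun (X i) (?V i)" "reg_fun (X i) (U' i) \<subseteq> reg_fun (X i) (?V i)"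
      if "i \<in> I" for i
      using op opV that reg_restrict[OF X[rule_format, OF that]] by auto
    then have "?G U \<subseteq> ?G ?V" "?G U' \<subseteq> ?G ?V" by blast+
    note sub = this[THEN gen_algebra_mono]
    show ?thesis unfolding eq
      by (rule exI[of _ "gen_algebra (?G ?V)"]) (use sub opV in blast)
  qed
  then show ?thesis
    unfolding fraction_family_def by (auto intro: gen_algebra.intros)
qed

lemma locally_ringed_Prod: "\<forall>i\<in>I. locally_ringed (X i) \<Longrightarrow> locally_ringed (Prod_fspace I X)"
  unfolding Prod_fspace_def by (intro locally_ringed_fraction_space fraction_family_Prod)

lemma points_Prod:
  assumes X: "\<forall>i\<in>I. locally_ringed (X i)"
  shows "points (Prod_fspace I X) = PiE I (\<lambda>i. points (X i))"
proof -
  have "points (Prod_fspace I X) = \<Union>{PiE I U | U. \<forall>i\<in>I. openin (zar (X i)) (U i)}"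
    unfolding Prod_fspace_def points_fraction_space[OF fraction_family_Prod[OF X]] by (simp add: setcompr_eq_image image_image)
  also have "\<dots> = PiE I (\<lambda>i. points (X i))"
  proof (intro equalityI subsetI)
    fix z assume "z \<in> PiE I (\<lambda>i. points (X i))"
    then show "z \<in> \<Union>{PiE I U | U. \<forall>i\<in>I. openin (zar (X i)) (U i)}"
      by (intro UnionI[of "PiE I (\<lambda>i. points (X i))"]) auto
  next
    fix z assume "z \<in> \<Union>{PiE I U | U. \<forall>i\<in>I. openin (zar (X i)) (U i)}"
    then obtain U where "\<forall>i\<in>I. openin (zar (X i)) (U i)" "z \<in> PiE I U" by blast
    then show "z \<in> PiE I (\<lambda>i. points (X i))" using openin_subset by (simp add: PiE_iff) blast
  qed
  finally show ?thesis .
qed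

lemma morphism_component:
  assumes X: "\<forall>i\<in>I. locally_ringed (X i)" and i: "i \<in> I"
  shows "morphism (Prod_fspace I X) (X i) (\<lambda>z. z i)"
proof (rule morphismI)
  fix U assume U: "openin (zar (X i)) U"
  let ?V = "\<lambda>j. if j = i then U else points (X j)"
  have eq: "{z \<in> points (Prod_fspace I X). z i \<in> U} = PiE I ?V"
    using openin_subset[OF U] i unfolding points_Prod[OF X]
    by (intro equalityI subsetI) (auto simp: PiE_iff extensional_def split: if_splits)
  have V: "\<forall>j\<in>I. openin (zar (X j)) (?V j)" using U by auto
  show "openin (zar (Prod_fspace I X)) {z \<in> points (Prod_fspace I X). z i \<in> U}"
    unfolding eq unfolding Prod_fspace_def
    by (rule open_fraction_set[OF fraction_family_Prod[OF X]]) (use V in blast)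
  fix g assume g: "g \<in> reg_fun (X i) U"
  show "(\<lambda>z. g (z i)) \<in> reg_fun (Prod_fspace I X) {z \<in> points (Prod_fspace I X). z i \<in> U}"
    unfolding eq unfolding Prod_fspace_def
    by (rule reg_of_algebra[OF fraction_family_Prod[OF X]], use V in blast)
      (use g i in \<open>auto intro!: gen_algebra.gen exI[of _ i]\<close>)
next
  show "z i \<in> points (X i)" if "z \<in> points (Prod_fspace I X)" for z
    using that points_Prod[OF X] i by auto
qed

lemma morphism_to_Prod:
  assumes Z: "locally_ringed Z" and I: "finite I" and X: "\<forall>i\<in>I. locally_ringed (X i)"
    and \<phi>: "\<And>i. i \<in> I \<Longrightarrow> morphism Z (X i) (\<lambda>z. \<phi> z i)"
    and ext: "\<And>z. z \<in> points Z \<Longrightarrow> \<phi> z \<in> extensional I"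
  shows "morphism Z (Prod_fspace I X) \<phi>"
proof -
  have op: "openin (zar Z) {z \<in> points Z. \<phi> z \<in> PiE I U}" if "\<forall>i\<in>I. openin (zar (X i)) (U i)" for U
  proof -
    have "{z \<in> points Z. \<phi> z \<in> PiE I U} = points Z \<inter> (\<Inter>i\<in>I. {z \<in> points Z. \<phi> z i \<in> U i})"
      using ext by (auto simp: PiE_iff)
    moreover have "openin (zar Z) (points Z \<inter> (\<Inter>i\<in>I. {z \<in> points Z. \<phi> z i \<in> U i}))"
      using I that morphism_open[OF \<phi>]
      by (cases "I = {}") (auto intro!: openin_Int openin_INT2)
    ultimately show ?thesis by simp
  qed
  show ?thesis
    unfolding Prod_fspace_def
  proof (rule morphism_to_fraction_space[OF Z fraction_family_Prod[OF X]], goal_cases)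
    case (1 z)
    then have "\<phi> z \<in> PiE I (\<lambda>i. points (X i))" using ext morphism_points[OF \<phi>] by (auto simp: PiE_iff)
    then show ?case by (intro exI[of _ "PiE I (\<lambda>i. points (X i))"]) auto
  next
    case (2 B A)
    then show ?case using op by auto
  next
    case (3 B A q)
    then obtain U where U: "\<forall>i\<in>I. openin (zar (X i)) (U i)" "B = PiE I U"
      "A = gen_algebra {\<lambda>z. g (z i) | i g. i \<in> I \<and> g \<in> reg_fun (X i) (U i)}" by auto
    note opU = op[OF U(1)]
    show ?case unfolding U(2)
    proof (rule reg_gen_algebra[OF Z opU 3(2)[unfolded U(3)]])
      fix h assume "h \<in> {\<lambda>z. g (z i) | i g. i \<in> I \<and> g \<in> reg_fun (X i) (U i)}"
      then obtain i g where i: "i \<in> I" "g \<in> reg_fun (X i) (U i)" "h = (\<lambda>z. g (z i))" by blast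
      show "(\<lambda>z. h (\<phi> z)) \<in> reg_fun Z {z \<in> points Z. \<phi> z \<in> PiE I U}"
        unfolding i(3) by (rule morphism_reg_open[OF Z \<phi>[OF i(1)] _ i(2) opU]) (use U i in auto)
    qed
  qed
qed

section \<open>Tuples of vectors\<close>

global_interpretation complex_pair: vector_space_pair
  "scaleC :: complex \<Rightarrow> 'a \<Rightarrow> 'a::complex_vector" "scaleC :: complex \<Rightarrow> 'b \<Rightarrow> 'b::complex_vector"
  by unfold_locales

abbreviation clinear :: "('a::complex_vector \<Rightarrow> 'b::complex_vector) \<Rightarrow> bool" where
  "clinear \<equiv> Vector_Spaces.linear scaleC scaleC"

lemma clinearI:
  assumes "\<And>x y. f (x + y) = f x + f y" "\<And>c x. f (scaleC c x) = scaleC c (f x)"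
  shows "clinear f"
  using assms by unfold_locales

lemmas clinear_add = complex_pair.linear_add
lemmas clinear_scale = complex_pair.linear_scale
lemmas clinear_0 = complex_pair.linear_0
lemmas clinear_diff = complex_pair.linear_diff
lemmas clinear_sum = complex_pair.linear_sum

lemma clinear_combination:
  assumes "clinear f"
  shows "f (\<Sum>j\<in>J. scaleC (c j) (s j)) = (\<Sum>j\<in>J. scaleC (c j) (f (s j)))"
  by (simp only: clinear_sum[OF assms] clinear_scale[OF assms])

lemma scaleC_complex [simp]: "scaleC c (z::complex) = c * z"
  by (simp add: scaleC_complex_def)

lemma sum_fun_apply: "(\<Sum>j\<in>J. f j) x = (\<Sum>j\<in>J. (f j x :: 'a::comm_monoid_add))"
  by (induction J rule: infinite_finite_induct) auto

lemma complex_subspaceI: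
  assumes "0 \<in> S" "\<And>x y. x \<in> S \<Longrightarrow> y \<in> S \<Longrightarrow> x + y \<in> S" "\<And>c x. x \<in> S \<Longrightarrow> scaleC c x \<in> S"
  shows "complex_vector.subspace S"
  using assms by (rule complex_vector.subspaceI)

lemma subspace_combination:
  assumes "complex_vector.subspace S" "\<And>j. j \<in> J \<Longrightarrow> s j \<in> S"
  shows "(\<Sum>j\<in>J. scaleC (c j) (s j)) \<in> S"
  using assms by (intro complex_vector.subspace_sum complex_vector.subspace_scale)

definition indep_tuple :: "nat \<Rightarrow> (nat \<Rightarrow> 'v::complex_vector) \<Rightarrow> bool" where
  "indep_tuple a s \<longleftrightarrow> inj_on s {..<a} \<and> complex_vector.independent (s ` {..<a})"

lemma indep_tuple_iff:
  "indep_tuple a s \<longleftrightarrow> (\<forall>c. (\<Sum>j<a. scaleC (c j) (s j)) = 0 \<longrightarrow> (\<forall>j<a. c j = 0))"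
proof
  assume s: "indep_tuple a s"
  then have inj: "inj_on s {..<a}" and ind: "complex_vector.independent (s ` {..<a})"
    by (auto simp: indep_tuple_def)
  show "\<forall>c. (\<Sum>j<a. scaleC (c j) (s j)) = 0 \<longrightarrow> (\<forall>j<a. c j = 0)"
  proof (intro allI impI)
    fix c j assume c: "(\<Sum>j<a. scaleC (c j) (s j)) = 0" and j: "j < a"
    let ?u = "\<lambda>v. c (inv_into {..<a} s v)"
    have "(\<Sum>v\<in>s ` {..<a}. scaleC (?u v) v) = (\<Sum>j<a. scaleC (c j) (s j))"
      by (subst sum.reindex[OF inj]) (auto intro!: sum.cong simp: inv_into_f_f[OF inj])
    then have "?u (s j) = 0"
      using c j by (intro complex_vector.independentD[OF ind _ subset_refl]) auto
    then show "c j = 0" using inv_into_f_f[OF inj, of j] j by simp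
  qed
next
  assume R: "\<forall>c. (\<Sum>j<a. scaleC (c j) (s j)) = 0 \<longrightarrow> (\<forall>j<a. c j = 0)"
  have inj: "inj_on s {..<a}"
  proof (rule inj_onI, rule ccontr)
    fix i j assume ij: "i \<in> {..<a}" "j \<in> {..<a}" "s i = s j" "i \<noteq> j"
    let ?c = "\<lambda>k. (if k = i then 1 else 0) + (if k = j then -1 else (0::complex))"
    have "(\<Sum>k<a. scaleC (?c k) (s k)) =
        (\<Sum>k<a. if k = i then s k else 0) + (\<Sum>k<a. if k = j then - s k else 0)"
      unfolding sum.distrib[symmetric]
      by (rule sum.cong) (auto simp: scaleC_add_left)
    also have "\<dots> = 0" using ij by simp
    finally have "?c i = 0" using ij(1) R[THEN spec[where x = ?c]] by blast
    then show False using ij(4) by simp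
  qed
  have "complex_vector.independent (s ` {..<a})"
  proof (rule complex_vector.independent_if_scalars_zero)
    fix u v assume u: "(\<Sum>v\<in>s ` {..<a}. scaleC (u v) v) = 0" and v: "v \<in> s ` {..<a}"
    have "(\<Sum>j<a. scaleC (u (s j)) (s j)) = 0" using u by (simp add: sum.reindex[OF inj])
    from R[rule_format, OF this] show "u v = 0" using v by auto
  qed simp
  then show "indep_tuple a s" using inj by (simp add: indep_tuple_def)
qed

lemma subspace_frame_span: "complex_vector.subspace (frame_span a s)"
  by (simp add: frame_span_def)

lemma frame_span_superset: "j < a \<Longrightarrow> s j \<in> frame_span a s"
  by (auto simp: frame_span_def intro: complex_vector.span_base)

lemma frame_span_iff: "x \<in> frame_span a s \<longleftrightarrow> (\<exists>c. x = (\<Sum>j<a. scaleC (c j) (s j)))"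
proof
  assume "x \<in> frame_span a s"
  moreover have "frame_span a s \<subseteq> {x. \<exists>c. x = (\<Sum>j<a. scaleC (c j) (s j))}"
    unfolding frame_span_def
  proof (rule complex_vector.span_minimal)
    show "s ` {..<a} \<subseteq> {x. \<exists>c. x = (\<Sum>j<a. scaleC (c j) (s j))}"
    proof (intro image_subsetI CollectI)
      fix i assume i: "i \<in> {..<a}"
      have "(\<Sum>j<a. scaleC (if j = i then 1 else 0) (s j)) = (\<Sum>j<a. if j = i then s j else 0)"
        by (intro sum.cong) (auto simp: scaleC_one)
      then show "\<exists>c. s i = (\<Sum>j<a. scaleC (c j) (s j))"
        using i by (intro exI[of _ "\<lambda>j. if j = i then 1 else 0"]) simp
    qed
    show "complex_vector.subspace {x. \<exists>c. x = (\<Sum>j<a. scaleC (c j) (s j))}"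
    proof (rule complex_subspaceI)
      show "0 \<in> {x. \<exists>c. x = (\<Sum>j<a. scaleC (c j) (s j))}" by (auto intro!: exI[of _ "\<lambda>_. 0"])
    next
      fix x y assume "x \<in> {x. \<exists>c. x = (\<Sum>j<a. scaleC (c j) (s j))}" "y \<in> {x. \<exists>c. x = (\<Sum>j<a. scaleC (c j) (s j))}"
      then obtain c d where "x = (\<Sum>j<a. scaleC (c j) (s j))" "y = (\<Sum>j<a. scaleC (d j) (s j))" by auto
      then show "x + y \<in> {x. \<exists>c. x = (\<Sum>j<a. scaleC (c j) (s j))}"
        by (auto intro!: exI[of _ "\<lambda>j. c j + d j"] simp: scaleC_add_left sum.distrib)
    next
      fix k x assume "x \<in> {x. \<exists>c. x = (\<Sum>j<a. scaleC (c j) (s j))}"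
      then obtain c where "x = (\<Sum>j<a. scaleC (c j) (s j))" by auto
      then show "scaleC k x \<in> {x. \<exists>c. x = (\<Sum>j<a. scaleC (c j) (s j))}"
        by (auto intro!: exI[of _ "\<lambda>j. k * c j"] simp: complex_vector.scale_sum_right scaleC_scaleC)
    qed
  qed
  ultimately show "\<exists>c. x = (\<Sum>j<a. scaleC (c j) (s j))" by blast
next
  assume "\<exists>c. x = (\<Sum>j<a. scaleC (c j) (s j))"
  then show "x \<in> frame_span a s"
    using frame_span_superset by (auto intro!: subspace_combination subspace_frame_span)
qed

lemma frame_span_minimal:
  "complex_vector.subspace U \<Longrightarrow> (\<And>j. j < a \<Longrightarrow> s j \<in> U) \<Longrightarrow> frame_span a s \<subseteq> U"
  unfolding frame_span_def by (rule complex_vector.span_minimal) auto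

lemma frame_span_cong: "(\<And>j. j < a \<Longrightarrow> s j = t j) \<Longrightarrow> frame_span a s = frame_span a t"
  unfolding frame_span_def by (metis (no_types, lifting) image_cong lessThan_iff)

lemma indep_tuple_cong: "(\<And>j. j < a \<Longrightarrow> s j = t j) \<Longrightarrow> indep_tuple a s = indep_tuple a t"
  unfolding indep_tuple_def inj_on_def by (simp cong: image_cong_simp)

lemma clinear_image_frame_span:
  assumes "clinear h"
  shows "h ` frame_span a s = frame_span a (\<lambda>j. h (s j))"
  unfolding frame_span_def complex_pair.linear_span_image[OF assms, symmetric] image_image ..

text \<open>The dual functionals are defined on the whole ambient space, which may have infinite dimension. This
  makes it possible to apply them to vectors of other members of a family of subspaces.\<close>

lemma indep_tuple_dual:
  assumes "indep_tuple a s"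
  shows "\<exists>\<phi>. (\<forall>i. clinear (\<phi> i)) \<and> (\<forall>i<a. \<forall>j<a. \<phi> i (s j) = (if i = j then 1 else (0::complex)))"
proof -
  have inj: "inj_on s {..<a}" and ind: "complex_vector.independent (s ` {..<a})"
    using assms by (auto simp: indep_tuple_def)
  have ex: "\<forall>i. \<exists>g. clinear g \<and> (\<forall>v\<in>s ` {..<a}. g v = (if inv_into {..<a} s v = i then 1 else (0::complex)))"
    by (intro allI complex_pair.linear_independent_extend[OF ind])
  then obtain \<phi> where \<phi>: "\<And>i. clinear (\<phi> i)"
    "\<And>i v. v \<in> s ` {..<a} \<Longrightarrow> \<phi> i v = (if inv_into {..<a} s v = i then 1 else (0::complex))"
    using choice[OF ex] by blast
  show ?thesis
    by (rule exI[of _ \<phi>]) (use \<phi> inv_into_f_f[OF inj] in auto)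
qed

lemma clinear_separates:
  fixes x :: "'v::complex_vector"
  assumes "x \<noteq> 0"
  shows "\<exists>l :: 'v \<Rightarrow> complex. clinear l \<and> l x \<noteq> 0"
proof -
  have "indep_tuple 1 (\<lambda>_. x)" using assms by (simp add: indep_tuple_def lessThan_Suc)
  from indep_tuple_dual[OF this] obtain \<phi> :: "nat \<Rightarrow> 'v \<Rightarrow> complex" where
    "\<forall>i. clinear (\<phi> i)" "\<forall>i<1. \<forall>j<1::nat. \<phi> i x = (if i = j then 1 else 0)" by blast
  then show ?thesis by (intro exI[of _ "\<phi> 0"]) auto
qed

lemma indep_tuple_if_dual:
  assumes "\<And>i. i < a \<Longrightarrow> clinear (\<phi> i)"
    and "\<And>i j. i < a \<Longrightarrow> j < a \<Longrightarrow> \<phi> i (s j) = (if i = j then 1 else (0::complex))"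
  shows "indep_tuple a s"
  unfolding indep_tuple_iff
proof (intro allI impI)
  fix c i assume c: "(\<Sum>j<a. scaleC (c j) (s j)) = 0" and i: "i < a"
  have "0 = \<phi> i (\<Sum>j<a. scaleC (c j) (s j))" using c clinear_0[OF assms(1)[OF i]] by simp
  also have "\<dots> = (\<Sum>j<a. if i = j then c j else 0)"
    unfolding clinear_combination[OF assms(1)[OF i]] using assms(2)[OF i] by (intro sum.cong) auto
  finally show "c i = 0" using i by simp
qed

lemma dual_coordinates:
  assumes "\<And>i. i < a \<Longrightarrow> clinear (\<phi> i)"
    and "\<And>i j. i < a \<Longrightarrow> j < a \<Longrightarrow> \<phi> i (s j) = (if i = j then 1 else (0::complex))"
    and "x \<in> frame_span a s"
  shows "x = (\<Sum>j<a. scaleC (\<phi> j x) (s j))"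
proof -
  obtain c where c: "x = (\<Sum>j<a. scaleC (c j) (s j))" using assms(3) by (auto simp: frame_span_iff)
  have "\<phi> i x = c i" if i: "i < a" for i
  proof -
    have "\<phi> i x = (\<Sum>j<a. if i = j then c j else 0)"
      unfolding c clinear_combination[OF assms(1)[OF i]] using assms(2)[OF i] by (intro sum.cong) auto
    then show ?thesis using i by simp
  qed
  then show ?thesis using c by simp
qed

subsection \<open>Finite dimensional subspaces\<close>

lemma fin_dim_subspace_subspace: "fin_dim_subspace U \<Longrightarrow> complex_vector.subspace U"
  by (simp add: fin_dim_subspace_def)

lemma fin_dim_subset: "fin_dim_subspace V \<Longrightarrow> complex_vector.subspace U \<Longrightarrow> U \<subseteq> V \<Longrightarrow> fin_dim_subspace U"
  unfolding fin_dim_subspace_def by blast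

lemma fin_dim_frame_span: "fin_dim_subspace (frame_span a s)"
  unfolding fin_dim_subspace_def frame_span_def by (auto intro!: exI[of _ "s ` {..<a}"])

lemma gr_points_fin_dim: "fin_dim_subspace V \<Longrightarrow> U \<in> gr_points a V \<Longrightarrow> fin_dim_subspace U"
  unfolding gr_points_def by (auto intro: fin_dim_subset)

lemma finite_independent_in_fin_dim:
  assumes "fin_dim_subspace U" "B \<subseteq> U" "complex_vector.independent B"
  shows "finite B"
  using assms complex_vector.independent_span_bound unfolding fin_dim_subspace_def by blast

lemma dim_frame_span: "indep_tuple a s \<Longrightarrow> complex_vector.dim (frame_span a s) = a"
  by (simp add: indep_tuple_def frame_span_def complex_vector.dim_span_eq_card_independent card_image
      del: complex_vector.dim_span)

lemma indep_tuple_le_dim: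
  assumes U: "fin_dim_subspace U" and s: "indep_tuple a s" "\<And>j. j < a \<Longrightarrow> s j \<in> U"
  shows "a \<le> complex_vector.dim U"
proof -
  obtain B where B: "B \<subseteq> U" "complex_vector.independent B" "U \<subseteq> complex_vector.span B"
    "card B = complex_vector.dim U"
    using complex_vector.basis_exists by blast
  have "finite B" using finite_independent_in_fin_dim[OF U B(1,2)] .
  moreover have "s ` {..<a} \<subseteq> complex_vector.span B" using s(2) B(3) by blast
  ultimately have "card (s ` {..<a}) \<le> card B"
    using s(1) complex_vector.independent_span_bound unfolding indep_tuple_def by blast
  then show ?thesis using s(1) B(4) by (simp add: indep_tuple_def card_image)
qed

text \<open>The exchange lemma of Steinitz. The added vectors are recorded by their indices \<open>f\<close>: when \<open>s\<close> and
  \<open>t\<close> vary in a family, the choice made at one point can be used at the nearby ones.\<close>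

lemma extend_to_basis:
  assumes U: "fin_dim_subspace U" and s: "indep_tuple p s" "\<And>j. j < p \<Longrightarrow> s j \<in> U"
    and T: "\<And>k. k \<in> T \<Longrightarrow> t k \<in> U" "U \<subseteq> complex_vector.span (t ` T)"
  shows "\<exists>f. (\<forall>j. p \<le> j \<and> j < complex_vector.dim U \<longrightarrow> f j \<in> T) \<and>
     indep_tuple (complex_vector.dim U) (\<lambda>j. if j < p then s j else t (f j)) \<and>
     frame_span (complex_vector.dim U) (\<lambda>j. if j < p then s j else t (f j)) = U"
proof -
  have inj: "inj_on s {..<p}" and ind: "complex_vector.independent (s ` {..<p})"
    using s(1) by (auto simp: indep_tuple_def)
  obtain B where B: "s ` {..<p} \<subseteq> B" "B \<subseteq> s ` {..<p} \<union> t ` T" "complex_vector.independent B"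
    "s ` {..<p} \<union> t ` T \<subseteq> complex_vector.span B"
    using complex_vector.maximal_independent_subset_extend[of "s ` {..<p}" "s ` {..<p} \<union> t ` T"] ind
    by blast
  have BU: "B \<subseteq> U" using B(2) s(2) T(1) by blast
  have "complex_vector.span (t ` T) \<subseteq> complex_vector.span B"
    using B(4) by (intro complex_vector.span_minimal) auto
  then have UB: "U \<subseteq> complex_vector.span B" using T(2) by blast
  have fin: "finite B" using finite_independent_in_fin_dim[OF U BU B(3)] .
  have card: "card B = complex_vector.dim U" using complex_vector.basis_card_eq_dim[OF BU UB B(3)] .
  have pU: "p \<le> complex_vector.dim U" by (rule indep_tuple_le_dim[OF U s])
  let ?d = "complex_vector.dim U"
  have "card (B - s ` {..<p}) = ?d - p"
    using B(1) fin card by (simp add: card_Diff_subset card_image[OF inj])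
  then obtain g where g: "bij_betw g {p..<?d} (B - s ` {..<p})"
    using fin finite_same_card_bij[of "{p..<?d}" "B - s ` {..<p}"] by auto
  have "\<forall>j\<in>{p..<?d}. \<exists>k\<in>T. t k = g j"
  proof
    fix j assume "j \<in> {p..<?d}"
    then have "g j \<in> B - s ` {..<p}" using g unfolding bij_betw_def by blast
    then have "g j \<in> t ` T" using B(2) by blast
    then show "\<exists>k\<in>T. t k = g j" by (auto simp: image_iff eq_commute)
  qed
  from bchoice[OF this[unfolded Bex_def]]
  obtain f where f: "\<And>j. j \<in> {p..<?d} \<Longrightarrow> f j \<in> T \<and> t (f j) = g j" by blast
  let ?v = "\<lambda>j. if j < p then s j else t (f j)"
  have v: "?v ` {..<?d} = B" "inj_on ?v {..<?d}"
  proof -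
    have split: "{..<?d} = {..<p} \<union> {p..<?d}" using pU by auto
    have im2: "?v ` {p..<?d} = B - s ` {..<p}"
    proof -
      have "?v ` {p..<?d} = g ` {p..<?d}" using f by (intro image_cong) auto
      then show ?thesis using g by (simp add: bij_betw_def)
    qed
    have im1: "?v ` {..<p} = s ` {..<p}" by auto
    show "?v ` {..<?d} = B" unfolding split image_Un im1 im2 using B(1) by blast
    have "card (?v ` {..<?d}) = card {..<?d}" using \<open>?v ` {..<?d} = B\<close> card by simp
    then show "inj_on ?v {..<?d}" by (rule eq_card_imp_inj_on[rotated]) simp
  qed
  have "complex_vector.span B = U"
    using UB BU U by (simp add: complex_vector.span_minimal fin_dim_subspace_subspace subset_antisym)
  then have "indep_tuple ?d ?v" "frame_span ?d ?v = U"
    using v B(3) by (simp_all add: indep_tuple_def frame_span_def)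
  then show ?thesis using f by (intro exI[of _ f]) auto
qed

lemma frame_exists:
  assumes "fin_dim_subspace U"
  shows "\<exists>s. indep_tuple (complex_vector.dim U) s \<and> frame_span (complex_vector.dim U) s = U"
proof -
  have "indep_tuple 0 s" for s :: "nat \<Rightarrow> 'a" by (simp add: indep_tuple_iff)
  from extend_to_basis[OF assms this, where T = U and t = "\<lambda>x. x"] show ?thesis
    by (auto simp: complex_vector.span_superset)
qed

text \<open>If \<open>dim U\<close> independent vectors of \<open>U\<close> are completed to a basis, no vector is added.\<close>

lemma frame_span_eq:
  assumes U: "fin_dim_subspace U" and "indep_tuple (complex_vector.dim U) s"
    and "\<And>j. j < complex_vector.dim U \<Longrightarrow> s j \<in> U"
  shows "frame_span (complex_vector.dim U) s = U"
proof -
  let ?d = "complex_vector.dim U"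
  obtain f where "frame_span ?d (\<lambda>j. if j < ?d then s j else f j) = U"
    using extend_to_basis[OF U assms(2,3), where T = U and t = "\<lambda>x. x"] by (auto intro: complex_vector.span_base)
  then show ?thesis using frame_span_cong[of ?d s "\<lambda>j. if j < ?d then s j else f j"] by simp
qed

lemma dim_mono_fin_dim:
  assumes V: "fin_dim_subspace V" and "complex_vector.subspace U" "U \<subseteq> V"
  shows "complex_vector.dim U \<le> complex_vector.dim V"
proof -
  have U: "fin_dim_subspace U" using fin_dim_subset[OF assms] .
  obtain s where "indep_tuple (complex_vector.dim U) s" "frame_span (complex_vector.dim U) s = U"
    using frame_exists[OF U] by blast
  then show ?thesis using indep_tuple_le_dim[OF V] frame_span_superset assms(3) by blast
qed

lemma subspace_eq_if_dim_eq:
  assumes V: "fin_dim_subspace V" and U: "complex_vector.subspace U" "U \<subseteq> V"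
    and "complex_vector.dim U = complex_vector.dim V"
  shows "U = V"
proof -
  obtain s where s: "indep_tuple (complex_vector.dim U) s" "frame_span (complex_vector.dim U) s = U"
    using frame_exists[OF fin_dim_subset[OF V U]] by blast
  have "frame_span (complex_vector.dim V) s = V"
    using s assms(4) U(2) frame_span_superset[of _ "complex_vector.dim U" s] by (intro frame_span_eq[OF V]) auto
  then show ?thesis using s assms(4) by simp
qed

lemma frame_span_in_gr_points:
  assumes "complex_vector.subspace V" "indep_tuple a s" "\<And>j. j < a \<Longrightarrow> s j \<in> V"
  shows "frame_span a s \<in> gr_points a V"
  using assms dim_frame_span subspace_frame_span frame_span_minimal unfolding gr_points_def by blast

lemma indep_tuple_image:
  assumes "clinear h" "indep_tuple a s" "inj_on h (frame_span a s)"
  shows "indep_tuple a (\<lambda>j. h (s j))"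
  unfolding indep_tuple_iff
proof (intro allI impI)
  fix c j assume c: "(\<Sum>j<a. scaleC (c j) (h (s j))) = 0" and j: "j < a"
  have "h (\<Sum>j<a. scaleC (c j) (s j)) = h 0"
    using c clinear_0[OF assms(1)] by (simp add: clinear_combination[OF assms(1)])
  moreover have "(\<Sum>j<a. scaleC (c j) (s j)) \<in> frame_span a s" "0 \<in> frame_span a s"
    using complex_vector.subspace_0[OF subspace_frame_span] frame_span_iff by blast+
  ultimately have "(\<Sum>j<a. scaleC (c j) (s j)) = 0" using assms(3) by (meson inj_onD)
  then show "c j = 0" using assms(2) j unfolding indep_tuple_iff by blast
qed

lemma fin_dim_image:
  assumes "clinear h" "fin_dim_subspace U"
  shows "fin_dim_subspace (h ` U)"
proof -
  obtain s where "frame_span (complex_vector.dim U) s = U" using frame_exists[OF assms(2)] by blast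
  then show ?thesis using clinear_image_frame_span[OF assms(1)] fin_dim_frame_span by metis
qed

lemma dim_image_injective:
  assumes "clinear h" "fin_dim_subspace U" "inj_on h U"
  shows "complex_vector.dim (h ` U) = complex_vector.dim U"
proof -
  obtain s where s: "indep_tuple (complex_vector.dim U) s" "frame_span (complex_vector.dim U) s = U"
    using frame_exists[OF assms(2)] by blast
  then show ?thesis
    using dim_frame_span[OF indep_tuple_image[OF assms(1) s(1)]] clinear_image_frame_span[OF assms(1)] assms(3)
    by metis
qed

lemma sum_split_at:
  assumes "p \<le> (d::nat)"
  shows "(\<Sum>j<d. g j) = (\<Sum>j<p. g j) + (\<Sum>j<d-p. (g (p + j) :: 'a::comm_monoid_add))"
proof -
  have "(\<Sum>j<p + q. g j) = (\<Sum>j<p. g j) + (\<Sum>j<q. g (p + j))" for q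
    by (induction q) (auto simp: add_ac)
  from this[of "d - p"] show ?thesis using assms by simp
qed

text \<open>Rank and nullity for a finite dimensional subspace of any ambient space: the members that extend a
  basis of the kernel to one of \<open>U\<close> are mapped to a basis of the image.\<close>

lemma dim_image_kernel:
  assumes h: "clinear h" and U: "fin_dim_subspace U"
  shows "complex_vector.dim U = complex_vector.dim {u \<in> U. h u = 0} + complex_vector.dim (h ` U)"
proof -
  let ?K = "{u \<in> U. h u = 0}"
  have Us: "complex_vector.subspace U" using U fin_dim_subspace_subspace by blast
  have K: "complex_vector.subspace ?K"
    using Us by (intro complex_subspaceI)
      (auto simp: clinear_0[OF h] clinear_add[OF h] clinear_scale[OF h] complex_vector.subspace_0
        complex_vector.subspace_add complex_vector.subspace_scale)
  define p where "p = complex_vector.dim ?K"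
  define d where "d = complex_vector.dim U"
  obtain s where s: "indep_tuple p s" "frame_span p s = ?K"
    using frame_exists[OF fin_dim_subset[OF U K]] unfolding p_def by blast
  have sU: "s j \<in> U" "h (s j) = 0" if "j < p" for j using frame_span_superset[OF that, of s] s(2) by auto
  obtain f where v: "indep_tuple d (\<lambda>j. if j < p then s j else f j)" (is "indep_tuple d ?v")
    "frame_span d (\<lambda>j. if j < p then s j else f j) = U"
    using extend_to_basis[OF U s(1) sU(1), where T = U and t = "\<lambda>x. x"] unfolding d_def by (auto intro: complex_vector.span_base)
  have pd: "p \<le> d" unfolding d_def by (rule indep_tuple_le_dim[OF U s(1) sU(1)])
  let ?w = "\<lambda>j. h (f (p + j))"
  have split: "(\<Sum>j<d. g j) = (\<Sum>j<p. g j) + (\<Sum>j<d-p. g (p + j))" for g :: "nat \<Rightarrow> 'a"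
    using pd by (rule sum_split_at)
  have "indep_tuple (d - p) ?w"
    unfolding indep_tuple_iff
  proof (intro allI impI)
    fix c j assume c: "(\<Sum>j<d - p. scaleC (c j) (?w j)) = 0" and j: "j < d - p"
    let ?x = "\<Sum>j<d - p. scaleC (c j) (f (p + j))"
    have fU: "f (p + j) \<in> U" if "j < d - p" for j
      using frame_span_superset[of "p + j" d ?v] v(2) that by auto
    have "?x \<in> ?K"
      using c fU by (auto simp: clinear_combination[OF h] intro!: subspace_combination[OF Us])
    then obtain e where e: "?x = (\<Sum>j<p. scaleC (e j) (s j))" unfolding s(2)[symmetric] frame_span_iff by blast
    let ?c = "\<lambda>j. if j < p then e j else - c (j - p)"
    have "(\<Sum>j<d. scaleC (?c j) (?v j)) = (\<Sum>j<p. scaleC (e j) (s j)) + (\<Sum>j<d-p. scaleC (- c j) (f (p + j)))"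
      unfolding split by (intro arg_cong2[of _ _ _ _ "(+)"] sum.cong) auto
    also have "\<dots> = 0" unfolding e[symmetric] by (simp add: sum_negf)
    finally have "?c (p + j) = 0" 
      using j v(1)[unfolded indep_tuple_iff, THEN spec[where x = ?c]] less_diff_conv[of j d p]
      by (metis add.commute)
    then show "c j = 0" by simp
  qed
  moreover have "frame_span (d - p) ?w = h ` U"
  proof (intro equalityI subsetI)
    fix y assume "y \<in> frame_span (d - p) ?w"
    moreover have "frame_span (d - p) ?w \<subseteq> h ` U"
    proof (rule frame_span_minimal)
      show "complex_vector.subspace (h ` U)" using complex_pair.linear_subspace_image[OF h Us] .
      show "?w j \<in> h ` U" if "j < d - p" for j
        using frame_span_superset[of "p + j" d ?v] v(2) that by auto
    qed
    ultimately show "y \<in> h ` U" by blast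
  next
    fix y assume "y \<in> h ` U"
    then obtain c where "y = h (\<Sum>j<d. scaleC (c j) (?v j))" using v(2) by (auto simp: frame_span_iff)
    also have "\<dots> = (\<Sum>j<d. scaleC (c j) (h (?v j)))" by (rule clinear_combination[OF h])
    also have "\<dots> = (\<Sum>j<d - p. scaleC (c (p + j)) (?w j))"
    proof -
      have "(\<Sum>j<d. scaleC (c j) (h (?v j))) =
          (\<Sum>j\<in>{p..<d}. scaleC (c j) (h (?v j)))"
        using pd sU(2) by (intro sum.mono_neutral_right) auto
      also have "\<dots> = (\<Sum>j<d - p. scaleC (c (p + j)) (?w j))"
        by (rule sum.reindex_bij_witness[of _ "\<lambda>j. p + j" "\<lambda>j. j - p"]) auto
      finally show ?thesis .
    qed
    finally show "y \<in> frame_span (d - p) ?w" by (auto simp: frame_span_iff)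
  qed
  ultimately have "complex_vector.dim (h ` U) = d - p" using dim_frame_span by metis
  then show ?thesis using pd unfolding d_def p_def by simp
qed

text \<open>The maps of a representation are linear on its spaces only. Their linear extensions can be composed
  with functionals on the ambient space, and hence preserve regularity of families of vectors.\<close>

lemma clinear_on_extend:
  assumes f: "clinear_on S f" and S: "complex_vector.subspace S"
  shows "\<exists>g. clinear g \<and> (\<forall>x\<in>S. g x = f x)"
proof -
  obtain B where B: "B \<subseteq> S" "complex_vector.independent B" "S \<subseteq> complex_vector.span B"
    "card B = complex_vector.dim S"
    using complex_vector.basis_exists[of S] by blast
  obtain g where g: "clinear g" "\<forall>x\<in>B. g x = f x"
    using complex_pair.linear_independent_extend[OF B(2), of f] by (elim exE conjE)
  have add: "f (x + y) = f x + f y" if "x \<in> S" "y \<in> S" for x y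
    using f that unfolding clinear_on_def by auto
  have scale: "f (scaleC c x) = scaleC c (f x)" if "x \<in> S" for x c
    using f that unfolding clinear_on_def by auto
  have f0: "f 0 = 0" using scale[of 0 0] complex_vector.subspace_0[OF S] by simp
  have "B \<subseteq> {x \<in> S. g x = f x}" using g(2) B(1) by auto
  moreover have "complex_vector.subspace {x \<in> S. g x = f x}"
  proof (rule complex_subspaceI)
    show "0 \<in> {x \<in> S. g x = f x}" using f0 clinear_0[OF g(1)] complex_vector.subspace_0[OF S] by simp
    show "x + y \<in> {x \<in> S. g x = f x}" if "x \<in> {x \<in> S. g x = f x}" "y \<in> {x \<in> S. g x = f x}" for x y
      using that add clinear_add[OF g(1)] complex_vector.subspace_add[OF S] by simp
    show "scaleC c x \<in> {x \<in> S. g x = f x}" if "x \<in> {x \<in> S. g x = f x}" for c x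
      using that scale clinear_scale[OF g(1)] complex_vector.subspace_scale[OF S] by simp
  qed
  ultimately have "complex_vector.span B \<subseteq> {x \<in> S. g x = f x}" by (rule complex_vector.span_minimal)
  then show ?thesis using g(1) B(3) by blast
qed

subsection \<open>Coordinate spaces\<close>

definition unit_vec :: "nat \<Rightarrow> nat \<Rightarrow> complex" where
  "unit_vec i = (\<lambda>k. if k = i then 1 else 0)"

lemma scaleC_fun_apply [simp]: "scaleC c (f :: 'a \<Rightarrow> 'b::complex_vector) x = scaleC c (f x)"
  by (simp add: scaleC_fun_def)

lemma coord_space_expand:
  assumes "x \<in> coord_space d"
  shows "x = (\<Sum>i<d. scaleC (x i) (unit_vec i))"
proof
  fix k
  have "(\<Sum>i<d. x i * unit_vec i k) = (\<Sum>i<d. if k = i then x i else 0)"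
    by (intro sum.cong) (auto simp: unit_vec_def)
  then show "x k = (\<Sum>i<d. scaleC (x i) (unit_vec i)) k"
    using assms by (auto simp: sum_fun_apply coord_space_def)
qed

lemma unit_vec_in_coord_space: "i < d \<Longrightarrow> unit_vec i \<in> coord_space d"
  by (auto simp: coord_space_def unit_vec_def)

lemma subspace_coord_space: "complex_vector.subspace (coord_space d)"
  by (rule complex_subspaceI) (auto simp: coord_space_def)

lemma frame_span_unit_vec: "frame_span d unit_vec = coord_space d"
proof (rule subset_antisym)
  show "frame_span d unit_vec \<subseteq> coord_space d"
    by (rule frame_span_minimal[OF subspace_coord_space unit_vec_in_coord_space])
  show "coord_space d \<subseteq> frame_span d unit_vec"
  proof
    fix x assume "x \<in> coord_space d"
    then have "x = (\<Sum>i<d. scaleC (x i) (unit_vec i))" by (rule coord_space_expand)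
    then show "x \<in> frame_span d unit_vec" unfolding frame_span_iff by (rule exI[of _ x])
  qed
qed

lemma clinear_coordinate: "clinear (\<lambda>x :: nat \<Rightarrow> complex. x i)"
  by (rule clinearI) auto

lemma indep_tuple_unit_vec: "indep_tuple d unit_vec"
  by (rule indep_tuple_if_dual[of d "\<lambda>i x. x i"]) (auto simp: unit_vec_def clinear_coordinate)

lemma fin_dim_coord_space: "fin_dim_subspace (coord_space d)"
  using fin_dim_frame_span[of d unit_vec] by (simp add: frame_span_unit_vec)

lemma dim_coord_space: "complex_vector.dim (coord_space d) = d"
  using dim_frame_span[OF indep_tuple_unit_vec] by (simp add: frame_span_unit_vec)

section \<open>Regular families of vectors\<close>

text \<open>Testing with all functionals on the ambient space makes a choice of coordinates unnecessary.\<close>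

definition regular_vector :: "'z fspace \<Rightarrow> 'z set \<Rightarrow> ('z \<Rightarrow> 'v::complex_vector) \<Rightarrow> bool" where
  "regular_vector Z W x \<longleftrightarrow> (\<forall>l :: 'v \<Rightarrow> complex. clinear l \<longrightarrow> (\<lambda>z. l (x z)) \<in> reg_fun Z W)"

text \<open>The regularity of a family of functionals is expressed by its effect on regular vectors. In this
  form it passes through the steps of an elimination, and no coefficients have to be named.\<close>

definition regular_functional :: "'z fspace \<Rightarrow> 'z set \<Rightarrow> ('z \<Rightarrow> 'v::complex_vector \<Rightarrow> complex) \<Rightarrow> bool" where
  "regular_functional Z W \<phi> \<longleftrightarrow> (\<forall>z\<in>W. clinear (\<phi> z)) \<and>
     (\<forall>W' x. openin (zar Z) W' \<longrightarrow> W' \<subseteq> W \<longrightarrow> regular_vector Z W' x \<longrightarrow> (\<lambda>z. \<phi> z (x z)) \<in> reg_fun Z W')"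

lemma regular_vectorD: "regular_vector Z W x \<Longrightarrow> clinear l \<Longrightarrow> (\<lambda>z. l (x z) :: complex) \<in> reg_fun Z W"
  by (simp add: regular_vector_def)

lemma regular_vector_restrict:
  "locally_ringed Z \<Longrightarrow> regular_vector Z W x \<Longrightarrow> openin (zar Z) W \<Longrightarrow> openin (zar Z) W' \<Longrightarrow> W' \<subseteq> W \<Longrightarrow>
     regular_vector Z W' x"
  unfolding regular_vector_def by (auto intro: reg_restrict)

lemma regular_vector_induced:
  fixes x :: "'z \<Rightarrow> 'v::complex_vector"
  assumes Z: "openin (zar Z) W" "regular_vector Z W x" and "Y \<subseteq> W"
  shows "regular_vector (induced Z Y) Y x"
  unfolding regular_vector_def
proof (intro allI impI)
  fix l :: "'v \<Rightarrow> complex" assume "clinear l"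
  then have "(\<lambda>z. l (x z)) \<in> reg_fun (induced Z Y) (W \<inter> Y)"
    by (intro reg_induced_open Z regular_vectorD[OF Z(2)])
  then show "(\<lambda>z. l (x z)) \<in> reg_fun (induced Z Y) Y" using assms(3) by (simp add: Int_absorb1)
qed

lemma regular_vector_pullback:
  fixes x :: "'y \<Rightarrow> 'v::complex_vector"
  assumes "locally_ringed Z" "morphism Z Y \<phi>" "openin (zar Y) U" "regular_vector Y U x"
    and "openin (zar Z) W" "\<And>z. z \<in> W \<Longrightarrow> \<phi> z \<in> U"
  shows "regular_vector Z W (\<lambda>z. x (\<phi> z))"
  unfolding regular_vector_def
proof (intro allI impI)
  fix l :: "'v \<Rightarrow> complex" assume "clinear l"
  from morphism_reg_open[OF assms(1-3) regular_vectorD[OF assms(4) this] assms(5,6)]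
  show "(\<lambda>z. l (x (\<phi> z))) \<in> reg_fun Z W" .
qed

lemma regular_vector_const:
  "locally_ringed Z \<Longrightarrow> openin (zar Z) W \<Longrightarrow> regular_vector Z W (\<lambda>_. x)"
  by (simp add: regular_vector_def reg_const)

lemma clinear_compose: "clinear f \<Longrightarrow> clinear g \<Longrightarrow> clinear (\<lambda>x. g (f x))"
  by (intro clinearI) (simp_all only: clinear_add clinear_scale)

lemma regular_vector_clinear:
  assumes "clinear h" "regular_vector Z W x"
  shows "regular_vector Z W (\<lambda>z. h (x z))"
  using assms clinear_compose[OF assms(1)] unfolding regular_vector_def by blast

lemma regular_vector_combination:
  fixes s :: "'j \<Rightarrow> 'z \<Rightarrow> 'v::complex_vector"
  assumes Z: "locally_ringed Z" "openin (zar Z) W"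
    and "\<And>j. j \<in> J \<Longrightarrow> regular_vector Z W (s j)" "\<And>j. j \<in> J \<Longrightarrow> c j \<in> reg_fun Z W"
  shows "regular_vector Z W (\<lambda>z. \<Sum>j\<in>J. scaleC (c j z) (s j z))"
  unfolding regular_vector_def
proof (intro allI impI)
  fix l :: "'v \<Rightarrow> complex" assume l: "clinear l"
  show "(\<lambda>z. l (\<Sum>j\<in>J. scaleC (c j z) (s j z))) \<in> reg_fun Z W"
    unfolding clinear_combination[OF l] scaleC_complex
    by (intro reg_sum reg_mult Z assms regular_vectorD[OF assms(3) l])
qed

text \<open>On \<open>\<complex>\<^sup>d\<close> a functional is a linear combination of the coordinates, even if it comes from a functional
  on the infinite dimensional ambient space.\<close>

lemma regular_vector_coordinates:
  assumes Z: "locally_ringed Z" "openin (zar Z) W"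
    and x: "\<And>z. z \<in> W \<Longrightarrow> x z \<in> coord_space d" "\<And>i. i < d \<Longrightarrow> (\<lambda>z. x z i) \<in> reg_fun Z W"
  shows "regular_vector Z W x"
  unfolding regular_vector_def
proof (intro allI impI)
  fix l :: "(nat \<Rightarrow> complex) \<Rightarrow> complex" assume l: "clinear l"
  have "(\<lambda>z. \<Sum>i<d. x z i * l (unit_vec i)) \<in> reg_fun Z W"
    by (rule reg_sum[OF Z], rule reg_mult[OF Z _ reg_const[OF Z]], rule x(2)) simp
  moreover have "l (x z) = (\<Sum>i<d. x z i * l (unit_vec i))" if "z \<in> W" for z
    using arg_cong[OF coord_space_expand[OF x(1)[OF that]], of l] unfolding clinear_combination[OF l] by simp
  ultimately show "(\<lambda>z. l (x z)) \<in> reg_fun Z W" by (rule reg_cong[OF Z])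
qed

lemma regular_functionalD:
  "regular_functional Z W \<phi> \<Longrightarrow> openin (zar Z) W' \<Longrightarrow> W' \<subseteq> W \<Longrightarrow> regular_vector Z W' x \<Longrightarrow>
     (\<lambda>z. \<phi> z (x z)) \<in> reg_fun Z W'"
  by (simp add: regular_functional_def)

lemma regular_functional_clinear: "regular_functional Z W \<phi> \<Longrightarrow> z \<in> W \<Longrightarrow> clinear (\<phi> z)"
  by (simp add: regular_functional_def)

lemma regular_functional_restrict:
  "regular_functional Z W \<phi> \<Longrightarrow> W' \<subseteq> W \<Longrightarrow> regular_functional Z W' \<phi>"
  unfolding regular_functional_def by blast

lemma regular_functional_const: "clinear l \<Longrightarrow> regular_functional Z W (\<lambda>_. l)"
  by (simp add: regular_functional_def regular_vector_def)

lemma clinear_add_mult: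
  "clinear f \<Longrightarrow> clinear g \<Longrightarrow> clinear (\<lambda>v. f v + c * (g v :: complex))"
  by (intro clinearI) (simp_all add: clinear_add clinear_scale algebra_simps)

lemma regular_functional_add_mult:
  fixes \<phi> \<psi> :: "'z \<Rightarrow> 'v::complex_vector \<Rightarrow> complex"
  assumes Z: "locally_ringed Z" "openin (zar Z) W"
    and \<phi>: "regular_functional Z W \<phi>" and \<psi>: "regular_functional Z W \<psi>" and f: "f \<in> reg_fun Z W"
  shows "regular_functional Z W (\<lambda>z v. \<phi> z v + f z * \<psi> z v)"
  unfolding regular_functional_def
proof (intro conjI ballI allI impI)
  show "clinear (\<lambda>v. \<phi> z v + f z * \<psi> z v)" if "z \<in> W" for z
    by (rule clinear_add_mult[OF regular_functional_clinear[OF \<phi> that] regular_functional_clinear[OF \<psi> that]])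
  fix W' and x :: "'z \<Rightarrow> 'v" assume W': "openin (zar Z) W'" "W' \<subseteq> W" "regular_vector Z W' x"
  show "(\<lambda>z. \<phi> z (x z) + f z * \<psi> z (x z)) \<in> reg_fun Z W'"
    by (intro reg_add[OF Z(1) W'(1)] reg_mult[OF Z(1) W'(1)] regular_functionalD[OF \<phi>] regular_functionalD[OF \<psi>]
        W' reg_restrict[OF Z(1) f Z(2)])
qed

lemma regular_functional_sum:
  assumes Z: "locally_ringed Z" "openin (zar Z) W" and \<psi>: "regular_functional Z W \<psi>"
    and "\<And>j. j < m \<Longrightarrow> regular_functional Z W (\<phi> j)" "\<And>j. j < m \<Longrightarrow> f j \<in> reg_fun Z W"
  shows "regular_functional Z W (\<lambda>z v. \<psi> z v + (\<Sum>j<(m::nat). f j z * \<phi> j z v))"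
  using assms(4,5)
proof (induction m)
  case (Suc m)
  have "regular_functional Z W (\<lambda>z v. (\<psi> z v + (\<Sum>j<m. f j z * \<phi> j z v)) + f m z * \<phi> m z v)"
    by (intro regular_functional_add_mult[OF Z] Suc) auto
  then show ?case by (simp add: add.assoc)
qed (use \<psi> in simp)

text \<open>Gaussian elimination in a family, by induction on the length of the tuple. Given the functionals
  dual to the first \<open>m\<close> members, a functional \<open>l\<close> is corrected to \<open>\<mu>\<close>, which vanishes on these
  members. If \<open>l\<close> is nonzero on what is left of \<open>s m z0\<close> after removing its components along them, then the pivot
  \<open>d = \<mu> (s m)\<close> is nonzero at \<open>z0\<close>, hence near it. Then \<open>\<nu> = \<mu> / d\<close> is dual to the last member and
  multiples of it are subtracted from the earlier functionals. This one step gives everything that would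
  otherwise be obtained from minors: independence is an open condition, and coordinates are regular.\<close>

lemma local_dual:
  assumes Z: "locally_ringed Z" "openin (zar Z) W" and "z0 \<in> W"
    and s: "\<And>j. j < a \<Longrightarrow> regular_vector Z W (s j)" and "indep_tuple a (\<lambda>j. s j z0)"
  shows "\<exists>W' \<phi>. openin (zar Z) W' \<and> z0 \<in> W' \<and> W' \<subseteq> W \<and> (\<forall>i<a. regular_functional Z W' (\<phi> i)) \<and>
     (\<forall>z\<in>W'. \<forall>i<a. \<forall>j<a. \<phi> i z (s j z) = (if i = j then 1 else 0))"
  using s assms(5)
proof (induction a)
  case 0
  then show ?case using assms(2,3) by auto
next
  case (Suc m)
  have ind: "indep_tuple m (\<lambda>j. s j z0)"
    using Suc.prems(2) unfolding indep_tuple_def lessThan_Suc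
    using complex_vector.independent_mono[of "insert (s m z0) ((\<lambda>j. s j z0) ` {..<m})" "(\<lambda>j. s j z0) ` {..<m}"]
    by auto
  obtain W' \<phi> where W': "openin (zar Z) W'" "z0 \<in> W'" "W' \<subseteq> W"
    and \<phi>: "\<And>i. i < m \<Longrightarrow> regular_functional Z W' (\<phi> i)"
    and dual: "\<And>z i j. z \<in> W' \<Longrightarrow> i < m \<Longrightarrow> j < m \<Longrightarrow> \<phi> i z (s j z) = (if i = j then 1 else 0)"
    using Suc.IH[OF _ ind] Suc.prems(1) by (metis (no_types, lifting) less_Suc_eq)
  have sW: "regular_vector Z W' (s j)" if "j < Suc m" for j
    using regular_vector_restrict[OF Z(1) Suc.prems(1)[OF that] Z(2) W'(1,3)] .
  have "s m z0 - (\<Sum>i<m. scaleC (\<phi> i z0 (s m z0)) (s i z0)) \<noteq> 0"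
  proof
    assume eq: "s m z0 - (\<Sum>i<m. scaleC (\<phi> i z0 (s m z0)) (s i z0)) = 0"
    let ?c = "\<lambda>i. if i < m then - \<phi> i z0 (s m z0) else 1"
    have "(\<Sum>j<Suc m. scaleC (?c j) (s j z0)) = s m z0 - (\<Sum>i<m. scaleC (\<phi> i z0 (s m z0)) (s i z0))"
      by (simp add: scaleC_one sum_negf)
    then have "\<forall>j<Suc m. ?c j = 0"
      using eq Suc.prems(2)[unfolded indep_tuple_iff, THEN spec[where x = ?c]] by simp
    then have "?c m = 0" by blast
    then show False by simp
  qed
  then obtain l where l: "clinear l" "l (s m z0 - (\<Sum>i<m. scaleC (\<phi> i z0 (s m z0)) (s i z0))) \<noteq> (0::complex)"
    using clinear_separates by blast
  define \<mu> where "\<mu> = (\<lambda>z v. l v + (\<Sum>i<m. (- l (s i z)) * \<phi> i z v))"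
  have ls: "(\<lambda>z. - l (s i z)) \<in> reg_fun Z W'" if "i < m" for i
    using reg_mult[OF Z(1) W'(1) reg_const[OF Z(1) W'(1), of "-1"] regular_vectorD[OF sW l(1), of i]] that by simp
  have \<mu>: "regular_functional Z W' \<mu>"
    unfolding \<mu>_def by (intro regular_functional_sum[OF Z(1) W'(1)] regular_functional_const l(1) \<phi> ls)
  have \<mu>s: "\<mu> z (s j z) = 0" if "z \<in> W'" "j < m" for z j
  proof -
    have "(\<Sum>i<m. (- l (s i z)) * \<phi> i z (s j z)) = (\<Sum>i<m. if i = j then - l (s i z) else 0)"
      using dual that by (intro sum.cong) auto
    then show ?thesis using that(2) unfolding \<mu>_def by simp
  qed
  define d where "d = (\<lambda>z. \<mu> z (s m z))"
  have d: "d \<in> reg_fun Z W'" unfolding d_def by (rule regular_functionalD[OF \<mu> W'(1) subset_refl sW]) simp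
  have d0: "d z0 \<noteq> 0"
    using l(2) unfolding d_def \<mu>_def clinear_diff[OF l(1)] clinear_combination[OF l(1)]
    by (simp add: sum_negf mult.commute)
  define W'' where "W'' = {z \<in> W'. d z \<noteq> 0}"
  have W'': "openin (zar Z) W''" "z0 \<in> W''" "W'' \<subseteq> W'"
    using open_nonzero[OF Z(1) W'(1) d] W'(2) d0 by (auto simp: W''_def)
  have id: "(\<lambda>z. 1 / d z) \<in> reg_fun Z W''" unfolding W''_def by (rule reg_inverse[OF Z(1) W'(1) d])
  have zero: "regular_functional Z W'' (\<lambda>_ _. 0 :: complex)"
    by (intro regular_functional_const clinearI) auto
  define \<nu> where "\<nu> = (\<lambda>z v. 0 + (1 / d z) * \<mu> z v)"
  have \<nu>: "regular_functional Z W'' \<nu>"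
    unfolding \<nu>_def by (intro regular_functional_add_mult Z(1) W'' zero id regular_functional_restrict[OF \<mu>])
  have f: "(\<lambda>z. - \<phi> i z (s m z)) \<in> reg_fun Z W''" if "i < m" for i
  proof -
    have "(\<lambda>z. \<phi> i z (s m z)) \<in> reg_fun Z W'" by (rule regular_functionalD[OF \<phi>[OF that] W'(1) subset_refl sW]) simp
    then have "(\<lambda>z. \<phi> i z (s m z)) \<in> reg_fun Z W''" using reg_restrict[OF Z(1) _ W'(1) W''(1,3)] by blast
    from reg_mult[OF Z(1) W''(1) reg_const[OF Z(1) W''(1), of "-1"] this] show ?thesis by simp
  qed
  define \<phi>' where "\<phi>' = (\<lambda>i. if i < m then (\<lambda>z v. \<phi> i z v + (- \<phi> i z (s m z)) * \<nu> z v) else \<nu>)"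
  have "regular_functional Z W'' (\<phi>' i)" if "i < Suc m" for i
  proof (cases "i < m")
    case True
    show ?thesis
      using True unfolding \<phi>'_def
      by (auto intro!: regular_functional_add_mult[OF Z(1) W''(1)] \<nu> f regular_functional_restrict[OF \<phi> W''(3)]
          simp del: mult_minus_left)
  qed (simp add: \<phi>'_def \<nu>)
  moreover have "\<phi>' i z (s j z) = (if i = j then 1 else 0)" if z: "z \<in> W''" and ij: "i < Suc m" "j < Suc m" for z i j
  proof -
    have zW: "z \<in> W'" and dz: "d z \<noteq> 0" using z by (auto simp: W''_def)
    have \<nu>j: "\<nu> z (s j z) = (if j = m then 1 else 0)"
      using \<mu>s[OF zW, of j] dz ij(2) by (auto simp: \<nu>_def d_def less_Suc_eq)
    show ?thesis
      using \<nu>j dual[OF zW, of i j] ij by (auto simp: \<phi>'_def less_Suc_eq)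
  qed
  ultimately show ?case
    using W'' W'(3) by (intro exI[of _ W''] exI[of _ \<phi>']) auto
qed

lemma local_dualE:
  assumes Z: "locally_ringed Z" "openin (zar Z) W" and "z0 \<in> W"
    and s: "\<And>j. j < a \<Longrightarrow> regular_vector Z W (s j)" and "indep_tuple a (\<lambda>j. s j z0)"
  obtains W' \<phi> where "openin (zar Z) W'" "z0 \<in> W'" "W' \<subseteq> W" "\<And>i. i < a \<Longrightarrow> regular_functional Z W' (\<phi> i)"
    "\<And>z i j. z \<in> W' \<Longrightarrow> i < a \<Longrightarrow> j < a \<Longrightarrow> \<phi> i z (s j z) = (if i = j then 1 else 0)"
  using local_dual[OF assms] by metis

lemma local_independence:
  assumes Z: "locally_ringed Z" "openin (zar Z) W" and "z0 \<in> W"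
    and s: "\<And>j. j < a \<Longrightarrow> regular_vector Z W (s j)" and "indep_tuple a (\<lambda>j. s j z0)"
  shows "\<exists>W'. openin (zar Z) W' \<and> z0 \<in> W' \<and> W' \<subseteq> W \<and> (\<forall>z\<in>W'. indep_tuple a (\<lambda>j. s j z))"
proof -
  obtain W' \<phi> where W': "openin (zar Z) W'" "z0 \<in> W'" "W' \<subseteq> W"
    and \<phi>: "\<And>i. i < a \<Longrightarrow> regular_functional Z W' (\<phi> i)"
    and dual: "\<And>z i j. z \<in> W' \<Longrightarrow> i < a \<Longrightarrow> j < a \<Longrightarrow> \<phi> i z (s j z) = (if i = j then 1 else 0)"
    by (rule local_dualE[OF assms]) (assumption, rule that)
  have "indep_tuple a (\<lambda>j. s j z)" if "z \<in> W'" for z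
    by (rule indep_tuple_if_dual[of a "\<lambda>i. \<phi> i z"])
      (auto simp: dual that intro: regular_functional_clinear[OF \<phi> that])
  then show ?thesis using W' by blast
qed

section \<open>Morphisms to and from Grassmannians\<close>

lemma points_frames: "points (frames a V) = {s \<in> {..<a} \<rightarrow>\<^sub>E V. indep_tuple a s}"
  unfolding frames_def points_fraction_space[OF fraction_family_single] by (auto simp: indep_tuple_def)

lemma locally_ringed_frames: "locally_ringed (frames a V)"
  unfolding frames_def by (intro locally_ringed_fraction_space fraction_family_single)

lemma regular_vector_frames:
  fixes V :: "'v::complex_vector set"
  assumes "j < a"
  shows "regular_vector (frames a V) (points (frames a V)) (\<lambda>s. s j)"
  unfolding regular_vector_def
proof (intro allI impI)
  fix l :: "'v \<Rightarrow> complex" assume "clinear l"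
  then have "(\<lambda>s. l (s j)) \<in> gen_algebra {\<lambda>s. l (s j) | j l. j < a \<and> clinear l}"
    using assms by (intro gen_algebra.gen) blast
  from reg_of_algebra[OF fraction_family_single singletonI this, of "points (frames a V)"]
  show "(\<lambda>s. l (s j)) \<in> reg_fun (frames a V) (points (frames a V))"
    unfolding frames_def[of a V] points_fraction_space[OF fraction_family_single] by simp
qed

lemma morphism_to_frames:
  fixes V :: "'v::complex_vector set"
  assumes Z: "locally_ringed Z" and "\<And>z. z \<in> points Z \<Longrightarrow> s z \<in> points (frames a V)"
    and "\<And>j. j < a \<Longrightarrow> regular_vector Z (points Z) (\<lambda>z. s z j)"
  shows "morphism Z (frames a V) s"
  unfolding frames_def
proof (rule morphism_to_fraction_space_single[OF Z])
  fix z assume "z \<in> points Z"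
  then show "s z \<in> {s \<in> {..<a} \<rightarrow>\<^sub>E V. inj_on s {..<a} \<and> complex_vector.independent (s ` {..<a})}"
    using assms(2) by (auto simp: points_frames indep_tuple_def)
next
  fix g assume "g \<in> {\<lambda>s. l (s j) | j (l :: 'v \<Rightarrow> complex). j < a \<and> clinear l}"
  then obtain j l where g: "g = (\<lambda>s. l (s j))" "j < a" "clinear l" by blast
  show "(\<lambda>z. g (s z)) \<in> reg_fun Z (points Z)" unfolding g(1) by (rule regular_vectorD[OF assms(3) g(3)]) (rule g(2))
qed

lemma reg_gr:
  "f \<in> reg_fun (gr a V) U \<longleftrightarrow>
     (\<lambda>s. f (frame_span a s)) \<in> reg_fun (frames a V) {s \<in> points (frames a V). frame_span a s \<in> U}"
  by (simp add: gr_def)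

lemma open_frames: "openin (zar (gr a V)) U \<Longrightarrow> openin (zar (frames a V)) {s \<in> points (frames a V). frame_span a s \<in> U}"
  by (simp add: openin_gr)

text \<open>Functions and open sets are pulled back from the frames, and the pull-back commutes with all
  operations.\<close>

lemma locally_ringed_gr: "locally_ringed (gr a V)"
proof -
  let ?F = "frames a V" and ?pre = "\<lambda>U. {s \<in> points (frames a V). frame_span a s \<in> U}"
  note F = locally_ringed_frames[of a V]
  have sheaf: "fun_sheaf (gr a V)"
    unfolding fun_sheaf_def
  proof (intro conjI allI impI)
    fix U V' f
    assume U: "openin (zar (gr a V)) U" and V': "openin (zar (gr a V)) V'" "V' \<subseteq> U"
      and f: "f \<in> reg_fun (gr a V) U"
    have "?pre V' \<subseteq> ?pre U" using V'(2) by blast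
    then show "f \<in> reg_fun (gr a V) V'"
      unfolding reg_gr by (rule reg_restrict[OF F f[unfolded reg_gr] open_frames[OF U] open_frames[OF V'(1)]])
  next
    fix U f
    assume U: "openin (zar (gr a V)) U"
      and loc: "\<forall>x\<in>U. \<exists>W g. openin (zar (gr a V)) W \<and> x \<in> W \<and> W \<subseteq> U \<and>
                 g \<in> reg_fun (gr a V) W \<and> (\<forall>y\<in>W. f y = g y)"
    show "f \<in> reg_fun (gr a V) U"
      unfolding reg_gr
    proof (rule reg_glue[OF F open_frames[OF U]])
      fix s assume s: "s \<in> ?pre U"
      then have "frame_span a s \<in> U" by simp
      from bspec[OF loc this] obtain W g where W: "openin (zar (gr a V)) W \<and> frame_span a s \<in> W \<and> W \<subseteq> U \<and>
                 g \<in> reg_fun (gr a V) W \<and> (\<forall>y\<in>W. f y = g y)" by (elim exE)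
      show "\<exists>W g. openin (zar ?F) W \<and> s \<in> W \<and> W \<subseteq> ?pre U \<and> g \<in> reg_fun ?F W \<and> (\<forall>y\<in>W. f (frame_span a y) = g y)"
        using W s open_frames[of a V W]
        by (intro exI[of _ "?pre W"] exI[of _ "\<lambda>s. g (frame_span a s)"]) (auto simp: reg_gr)
    qed
  qed
  show ?thesis
    unfolding locally_ringed_def
  proof (intro conjI allI impI)
    fix U f g assume U: "openin (zar (gr a V)) U"
    show "(\<lambda>_. c) \<in> reg_fun (gr a V) U" for c unfolding reg_gr by (rule reg_const[OF F open_frames[OF U]])
    assume f: "f \<in> reg_fun (gr a V) U"
    have eq: "?pre {x \<in> U. f x \<noteq> 0} = {s \<in> ?pre U. f (frame_span a s) \<noteq> 0}" by auto
    show "openin (zar (gr a V)) {x \<in> U. f x \<noteq> 0}"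
      using open_nonzero[OF F open_frames[OF U] f[unfolded reg_gr]] U unfolding openin_gr eq by auto
    show "(\<lambda>x. 1 / f x) \<in> reg_fun (gr a V) {x \<in> U. f x \<noteq> 0}"
      using reg_inverse[OF F open_frames[OF U] f[unfolded reg_gr]] unfolding reg_gr eq .
    assume g: "g \<in> reg_fun (gr a V) U"
    show "(\<lambda>x. f x + g x) \<in> reg_fun (gr a V) U"
      using reg_add[OF F open_frames[OF U] f[unfolded reg_gr] g[unfolded reg_gr]] unfolding reg_gr .
    show "(\<lambda>x. f x * g x) \<in> reg_fun (gr a V) U"
      using reg_mult[OF F open_frames[OF U] f[unfolded reg_gr] g[unfolded reg_gr]] unfolding reg_gr .
  qed (rule sheaf)
qed

lemma frame_span_points:
  "complex_vector.subspace V \<Longrightarrow> s \<in> points (frames a V) \<Longrightarrow> frame_span a s \<in> gr_points a V"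
  by (rule frame_span_in_gr_points) (auto simp: points_frames)

lemma points_gr:
  assumes "complex_vector.subspace V"
  shows "points (gr a V) = gr_points a V"
proof -
  have "{s \<in> points (frames a V). frame_span a s \<in> gr_points a V} = points (frames a V)"
    using frame_span_points[OF assms] by auto
  then have "openin (zar (gr a V)) (gr_points a V)" by (simp add: openin_gr)
  moreover have "points (gr a V) \<subseteq> gr_points a V" using openin_gr[of a V "points (gr a V)"] by simp
  ultimately show ?thesis using openin_subset by blast
qed

lemma morphism_frame_span:
  assumes "complex_vector.subspace V"
  shows "morphism (frames a V) (gr a V) (frame_span a)"
proof (rule morphismI)
  show "frame_span a s \<in> points (gr a V)" if "s \<in> points (frames a V)" for s
    using frame_span_points[OF assms that] by (simp add: points_gr[OF assms])
qed (erule open_frames, simp only: reg_gr)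

lemma gr_point_frame:
  assumes V: "fin_dim_subspace V" and U: "U \<in> gr_points a V"
  shows "\<exists>s\<in>points (frames a V). frame_span a s = U"
proof -
  obtain s where s: "indep_tuple a s" "frame_span a s = U"
    using frame_exists[OF gr_points_fin_dim[OF assms]] U by (auto simp: gr_points_def)
  have "frame_span a (restrict s {..<a}) = U" "indep_tuple a (restrict s {..<a})"
    using s frame_span_cong[of a "restrict s {..<a}" s] indep_tuple_cong[of a "restrict s {..<a}" s] by auto
  moreover have "s j \<in> V" if "j < a" for j
    using frame_span_superset[OF that, of s] s(2) U by (auto simp: gr_points_def)
  ultimately show ?thesis by (intro bexI[of _ "restrict s {..<a}"]) (auto simp: points_frames)
qed

text \<open>A regular family of subspaces of constant dimension is a morphism. Of the spanning vectors, choose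
  \<open>a\<close> that are independent at a point. They remain independent near it, and there they still
  span because of the dimension; so they are a local lift to the variety of frames.\<close>

lemma morphism_to_gr:
  assumes Z: "locally_ringed Z" and V: "fin_dim_subspace V"
    and F: "\<And>z. z \<in> points Z \<Longrightarrow> F z \<in> gr_points a V"
    and loc: "\<And>z. z \<in> points Z \<Longrightarrow> \<exists>W m s. openin (zar Z) W \<and> z \<in> W \<and>
       (\<forall>k<m. regular_vector Z W (s k)) \<and> (\<forall>z\<in>W. F z = frame_span m (\<lambda>k. s k z))"
  shows "morphism Z (gr a V) F"
proof (rule morphism_local[OF Z])
  fix z0 assume z0: "z0 \<in> points Z"
  obtain W m s where W: "openin (zar Z) W" "z0 \<in> W"
    and s: "\<And>k. k < m \<Longrightarrow> regular_vector Z W (s k)" "\<And>z. z \<in> W \<Longrightarrow> F z = frame_span m (\<lambda>k. s k z)"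
    using loc[OF z0] by (elim exE conjE) blast
  have Vs: "complex_vector.subspace V" using V by (rule fin_dim_subspace_subspace)
  have FU: "fin_dim_subspace (F z)" "complex_vector.dim (F z) = a" "F z \<subseteq> V" if "z \<in> points Z" for z
    using F[OF that] gr_points_fin_dim[OF V] by (auto simp: gr_points_def)
  have sF: "s k z \<in> F z" if "z \<in> W" "k < m" for z k
    using s(2)[OF that(1)] frame_span_superset[OF that(2)] by simp
  have i0: "indep_tuple 0 (undefined :: nat \<Rightarrow> 'b)" by (simp add: indep_tuple_iff)
  have sp0: "F z0 \<subseteq> complex_vector.span ((\<lambda>k. s k z0) ` {..<m})"
    using s(2)[OF W(2)] unfolding frame_span_def by blast
  have "\<exists>f. (\<forall>j. 0 \<le> j \<and> j < a \<longrightarrow> f j \<in> {..<m}) \<and> indep_tuple a (\<lambda>j. if j < 0 then undefined j else s (f j) z0)"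
    using extend_to_basis[OF FU(1)[OF z0] i0, where T = "{..<m}" and t = "\<lambda>k. s k z0"]
      sF[OF W(2)] sp0 unfolding FU(2)[OF z0] by auto
  then obtain f where f: "\<And>j. j < a \<Longrightarrow> f j < m" "indep_tuple a (\<lambda>j. s (f j) z0)" by auto
  have "\<exists>W'. openin (zar Z) W' \<and> z0 \<in> W' \<and> W' \<subseteq> W \<and> (\<forall>z\<in>W'. indep_tuple a (\<lambda>j. s (f j) z))"
    by (rule local_independence[OF Z W]) (use f s(1) in auto)
  then obtain W' where W': "openin (zar Z) W'" "z0 \<in> W'" "W' \<subseteq> W"
    and ind: "\<And>z. z \<in> W' \<Longrightarrow> indep_tuple a (\<lambda>j. s (f j) z)" by blast
  let ?t = "\<lambda>z. \<lambda>j\<in>{..<a}. s (f j) z"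
  have t: "indep_tuple a (?t z)" if "z \<in> W'" for z
    using ind[OF that] indep_tuple_cong[of a "?t z" "\<lambda>j. s (f j) z"] by auto
  have W'p: "W' \<subseteq> points Z" using openin_subset[OF W'(1)] .
  have span: "frame_span a (?t z) = F z" if z: "z \<in> W'" for z
  proof -
    have zp: "z \<in> points Z" "z \<in> W" using z W'p W'(3) by auto
    have "frame_span (complex_vector.dim (F z)) (?t z) = F z"
      by (rule frame_span_eq[OF FU(1)[OF zp(1)]])
        (use t[OF z] sF[OF zp(2)] f(1) FU(2)[OF zp(1)] in auto)
    then show ?thesis using FU(2)[OF zp(1)] by simp
  qed
  have Z': "locally_ringed (induced Z W')" by (rule locally_ringed_induced[OF Z])
  have Z'p: "points (induced Z W') = W'" using W'p by auto
  have "morphism (induced Z W') (frames a V) ?t"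
  proof (rule morphism_to_frames[OF Z'])
    fix z assume "z \<in> points (induced Z W')"
    then have z: "z \<in> W'" by simp
    have "s (f j) z \<in> V" if "j < a" for j
      using sF[of z "f j"] f(1)[OF that] z W'(3) W'p FU(3)[of z] by blast
    then show "?t z \<in> points (frames a V)" using t[OF z] by (auto simp: points_frames)
  next
    fix j assume j: "j < a"
    have "regular_vector (induced Z W') W' (s (f j))"
      by (rule regular_vector_induced[OF W(1) s(1)[OF f(1)[OF j]] W'(3)])
    then show "regular_vector (induced Z W') (points (induced Z W')) (\<lambda>z. ?t z j)" using j unfolding Z'p by simp
  qed
  from morphism_compose[OF this morphism_frame_span[OF Vs]]
  have "morphism (induced Z W') (gr a V) F"
    by (rule morphism_cong[OF Z']) (use span in auto)
  then show "\<exists>W. openin (zar Z) W \<and> z0 \<in> W \<and> morphism (induced Z W) (gr a V) F" using W' by blast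
qed

subsection \<open>Charts and local frames\<close>

text \<open>The subspaces on which the \<open>a\<close> functionals \<open>\<psi>\<^sub>i\<close> are jointly injective, and therefore coordinates.\<close>

definition gr_chart :: "nat \<Rightarrow> 'v::complex_vector set \<Rightarrow> (nat \<Rightarrow> 'v \<Rightarrow> complex) \<Rightarrow> 'v set set" where
  "gr_chart a V \<psi> = {U \<in> gr_points a V. \<forall>u\<in>U. (\<forall>i<a. \<psi> i u = 0) \<longrightarrow> u = 0}"

text \<open>The \<open>i\<close>-th member of the basis of \<open>U\<close> dual to \<open>\<psi>\<close>, as a row of a reduced echelon form.\<close>

definition chart_vector :: "nat \<Rightarrow> (nat \<Rightarrow> 'v::complex_vector \<Rightarrow> complex) \<Rightarrow> nat \<Rightarrow> 'v set \<Rightarrow> 'v" where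
  "chart_vector a \<psi> i U = (THE u. u \<in> U \<and> (\<forall>k<a. \<psi> k u = (if k = i then 1 else 0)))"

definition functional_map :: "nat \<Rightarrow> (nat \<Rightarrow> 'v::complex_vector \<Rightarrow> complex) \<Rightarrow> 'v \<Rightarrow> nat \<Rightarrow> complex" where
  "functional_map a \<psi> u = (\<lambda>k. if k < a then \<psi> k u else 0)"

lemma clinear_functional_map: "(\<And>i. clinear (\<psi> i)) \<Longrightarrow> clinear (functional_map a \<psi>)"
  by (rule clinearI) (auto simp: functional_map_def fun_eq_iff clinear_add clinear_scale)

lemma functional_map_in_coord_space: "functional_map a \<psi> u \<in> coord_space a"
  by (simp add: functional_map_def coord_space_def)

lemma functional_map_eq_0: "functional_map a \<psi> u = 0 \<longleftrightarrow> (\<forall>i<a. \<psi> i u = 0)"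
  by (auto simp: functional_map_def fun_eq_iff)

lemma functional_map_eq_unit: "i < a \<Longrightarrow> functional_map a \<psi> u = unit_vec i \<longleftrightarrow> (\<forall>k<a. \<psi> k u = (if k = i then 1 else 0))"
  by (auto simp: functional_map_def unit_vec_def fun_eq_iff)

text \<open>On frames, the chart is the locus where the matrix \<open>\<psi>\<^sub>k(s\<^sub>j)\<close> has independent columns; in this form
  it is visibly open.\<close>

lemma gr_chart_iff:
  assumes \<psi>: "\<And>i. clinear (\<psi> i)" and "indep_tuple a s" "frame_span a s \<in> gr_points a V"
  shows "frame_span a s \<in> gr_chart a V \<psi> \<longleftrightarrow> indep_tuple a (\<lambda>j. functional_map a \<psi> (s j))"
proof
  note lin = clinear_functional_map[of \<psi> a, OF \<psi>]
  assume "frame_span a s \<in> gr_chart a V \<psi>"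
  then have ker: "u = 0" if "u \<in> frame_span a s" "functional_map a \<psi> u = 0" for u
    using that by (auto simp: gr_chart_def functional_map_eq_0)
  have "inj_on (functional_map a \<psi>) (frame_span a s)"
  proof (rule inj_onI)
    fix x y assume xy: "x \<in> frame_span a s" "y \<in> frame_span a s" "functional_map a \<psi> x = functional_map a \<psi> y"
    have "x - y \<in> frame_span a s" using xy by (intro complex_vector.subspace_diff subspace_frame_span)
    moreover have "functional_map a \<psi> (x - y) = 0"
      by (simp add: clinear_diff[OF lin] xy(3))
    ultimately have "x - y = 0" by (rule ker)
    then show "x = y" by simp
  qed
  then show "indep_tuple a (\<lambda>j. functional_map a \<psi> (s j))" by (rule indep_tuple_image[OF lin assms(2)])
next
  note lin = clinear_functional_map[of \<psi> a, OF \<psi>]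
  assume ind: "indep_tuple a (\<lambda>j. functional_map a \<psi> (s j))"
  have "u = 0" if u: "u \<in> frame_span a s" "\<forall>i<a. \<psi> i u = 0" for u
  proof -
    obtain c where c: "u = (\<Sum>j<a. scaleC (c j) (s j))" using u(1) unfolding frame_span_iff by blast
    have "(\<Sum>j<a. scaleC (c j) (functional_map a \<psi> (s j))) = 0"
      using u(2) unfolding functional_map_eq_0[symmetric] c clinear_combination[OF lin] .
    then have "\<forall>j<a. c j = 0" using ind[unfolded indep_tuple_iff, THEN spec[where x = c]] by blast
    then show ?thesis unfolding c by simp
  qed
  then show "frame_span a s \<in> gr_chart a V \<psi>" using assms(3) by (simp add: gr_chart_def)
qed

lemma chart_vector_unique:
  assumes \<psi>: "\<And>i. clinear (\<psi> i)" and U: "U \<in> gr_chart a V \<psi>"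
    and u: "u \<in> U" "\<And>k. k < a \<Longrightarrow> \<psi> k u = (if k = i then 1 else 0)"
  shows "chart_vector a \<psi> i U = u"
  unfolding chart_vector_def
proof (rule the_equality)
  show "u \<in> U \<and> (\<forall>k<a. \<psi> k u = (if k = i then 1 else 0))" using u by blast
  fix v assume v: "v \<in> U \<and> (\<forall>k<a. \<psi> k v = (if k = i then 1 else 0))"
  have "v - u \<in> U" using U u(1) v by (auto simp: gr_chart_def gr_points_def intro: complex_vector.subspace_diff)
  moreover have "\<forall>k<a. \<psi> k (v - u) = 0" using u(2) v by (simp add: clinear_diff[OF \<psi>])
  ultimately have "v - u = 0" using U unfolding gr_chart_def by blast
  then show "v = u" by simp
qed

lemma chart_vector:
  assumes V: "fin_dim_subspace V" and \<psi>: "\<And>i. clinear (\<psi> i)" and U: "U \<in> gr_chart a V \<psi>" and i: "i < a"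
  shows "chart_vector a \<psi> i U \<in> U" "\<And>k. k < a \<Longrightarrow> \<psi> k (chart_vector a \<psi> i U) = (if k = i then 1 else 0)"
proof -
  note lin = clinear_functional_map[of \<psi> a, OF \<psi>]
  have Up: "U \<in> gr_points a V" using U by (simp add: gr_chart_def)
  obtain s where s: "s \<in> points (frames a V)" "frame_span a s = U" using gr_point_frame[OF V Up] by blast
  have ind: "indep_tuple a (\<lambda>j. functional_map a \<psi> (s j))"
    using gr_chart_iff[of \<psi> a s V, OF \<psi>] s U Up by (simp add: points_frames)
  have "functional_map a \<psi> ` U = frame_span a (\<lambda>j. functional_map a \<psi> (s j))"
    using clinear_image_frame_span[OF lin] s(2) by metis
  also have "\<dots> = coord_space a"
    using frame_span_eq[OF fin_dim_coord_space, of a "\<lambda>j. functional_map a \<psi> (s j)"] ind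
    by (simp add: dim_coord_space functional_map_in_coord_space)
  finally obtain u where u: "u \<in> U" "functional_map a \<psi> u = unit_vec i"
    using unit_vec_in_coord_space[OF i] by (metis imageE)
  then have u2: "\<psi> k u = (if k = i then 1 else 0)" if "k < a" for k using functional_map_eq_unit[OF i, of \<psi> u] that by blast
  have "chart_vector a \<psi> i U = u" by (rule chart_vector_unique[OF \<psi> U u(1) u2])
  then show "chart_vector a \<psi> i U \<in> U" "\<And>k. k < a \<Longrightarrow> \<psi> k (chart_vector a \<psi> i U) = (if k = i then 1 else 0)"
    using u(1) u2 by simp_all
qed

lemma chart_vectors_frame:
  assumes V: "fin_dim_subspace V" and \<psi>: "\<And>i. clinear (\<psi> i)" and U: "U \<in> gr_chart a V \<psi>"
  shows "indep_tuple a (\<lambda>i. chart_vector a \<psi> i U)" "frame_span a (\<lambda>i. chart_vector a \<psi> i U) = U"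
proof -
  show ind: "indep_tuple a (\<lambda>i. chart_vector a \<psi> i U)"
    by (rule indep_tuple_if_dual[of a \<psi>]) (use \<psi> chart_vector(2)[OF V \<psi> U] in auto)
  have "fin_dim_subspace U" "complex_vector.dim U = a"
    using U gr_points_fin_dim[OF V] by (auto simp: gr_chart_def gr_points_def)
  then show "frame_span a (\<lambda>i. chart_vector a \<psi> i U) = U"
    using frame_span_eq[of U "\<lambda>i. chart_vector a \<psi> i U"] ind chart_vector(1)[OF V \<psi> U] by simp
qed

lemma regular_vector_functional_map_frames:
  assumes \<psi>: "\<And>i. clinear (\<psi> i)" and "j < a"
  shows "regular_vector (frames a V) (points (frames a V)) (\<lambda>s. functional_map a \<psi> (s j))"
  by (rule regular_vector_clinear[OF clinear_functional_map[of \<psi> a, OF \<psi>] regular_vector_frames[OF assms(2)]])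

lemma open_gr_chart:
  assumes V: "complex_vector.subspace V" and \<psi>: "\<And>i. clinear (\<psi> i)"
  shows "openin (zar (gr a V)) (gr_chart a V \<psi>)"
  unfolding openin_gr
proof
  let ?O = "{s \<in> points (frames a V). frame_span a s \<in> gr_chart a V \<psi>}"
  have iff: "s \<in> ?O \<longleftrightarrow> indep_tuple a (\<lambda>j. functional_map a \<psi> (s j))" if "s \<in> points (frames a V)" for s
    using gr_chart_iff[of \<psi> a s V, OF \<psi>] frame_span_points[OF V that] that by (simp add: points_frames)
  show "openin (zar (frames a V)) ?O"
  proof (subst openin_subopen, intro ballI)
    fix s assume s: "s \<in> ?O"
    then have "indep_tuple a (\<lambda>j. functional_map a \<psi> (s j))" "s \<in> points (frames a V)" using iff by auto
    then have "\<exists>W. openin (zar (frames a V)) W \<and> s \<in> W \<and> W \<subseteq> points (frames a V) \<and>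
        (\<forall>s\<in>W. indep_tuple a (\<lambda>j. functional_map a \<psi> (s j)))"
      by (intro local_independence[OF locally_ringed_frames openin_topspace]
          regular_vector_functional_map_frames[of \<psi>, OF \<psi>])
    then obtain W where W: "openin (zar (frames a V)) W" "s \<in> W" "W \<subseteq> points (frames a V)"
      "\<forall>s\<in>W. indep_tuple a (\<lambda>j. functional_map a \<psi> (s j))" by blast
    then show "\<exists>T. openin (zar (frames a V)) T \<and> s \<in> T \<and> T \<subseteq> ?O" using iff by (intro exI[of _ W]) blast
  qed
qed (auto simp: gr_chart_def)

text \<open>On frames, the echelon form is obtained by inverting the matrix \<open>\<psi>\<^sub>k(s\<^sub>j)\<close>. The inverse is regular,
  as its entries are the values of functionals dual to the columns at the unit vectors.\<close>

lemma regular_chart_vector: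
  assumes V: "fin_dim_subspace V" and \<psi>: "\<And>i. clinear (\<psi> i)" and i: "i < a"
  shows "regular_vector (gr a V) (gr_chart a V \<psi>) (chart_vector a \<psi> i)"
  unfolding regular_vector_def
proof (intro allI impI)
  fix l :: "'a \<Rightarrow> complex" assume l: "clinear l"
  note Vs = fin_dim_subspace_subspace[OF V] and lin = clinear_functional_map[of \<psi> a, OF \<psi>]
  note F = locally_ringed_frames[of a V]
  let ?O = "{s \<in> points (frames a V). frame_span a s \<in> gr_chart a V \<psi>}"
  let ?s = "\<lambda>j s. functional_map a \<psi> (s j)"
  have O: "openin (zar (frames a V)) ?O" by (rule open_frames[OF open_gr_chart[of V \<psi>, OF Vs \<psi>]])
  show "(\<lambda>U. l (chart_vector a \<psi> i U)) \<in> reg_fun (gr a V) (gr_chart a V \<psi>)"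
    unfolding reg_gr
  proof (rule reg_glue[OF F O])
    fix s0 assume s0: "s0 \<in> ?O"
    have ind: "indep_tuple a (\<lambda>j. ?s j s0)"
      using gr_chart_iff[of \<psi> a s0 V, OF \<psi>] s0 frame_span_points[OF Vs, of s0] by (auto simp: points_frames)
    have regs: "regular_vector (frames a V) ?O (?s j)" if "j < a" for j
      by (rule regular_vector_restrict[OF F regular_vector_functional_map_frames[of \<psi>, OF \<psi> that] openin_topspace O])
        auto
    obtain W \<phi> where W: "openin (zar (frames a V)) W" "s0 \<in> W" "W \<subseteq> ?O"
      and \<phi>: "\<And>j. j < a \<Longrightarrow> regular_functional (frames a V) W (\<phi> j)"
      and dual: "\<And>s k j. s \<in> W \<Longrightarrow> k < a \<Longrightarrow> j < a \<Longrightarrow> \<phi> k s (?s j s) = (if k = j then 1 else 0)"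
      by (rule local_dualE[where s = ?s, OF F O s0 regs ind]) (assumption, rule that)
    let ?g = "\<lambda>s. \<Sum>j<a. \<phi> j s (unit_vec i) * l (s j)"
    have "regular_vector (frames a V) W (\<lambda>s. s j)" if "j < a" for j
      by (rule regular_vector_restrict[OF F regular_vector_frames[OF that] openin_topspace W(1)]) (use W(3) in blast)
    then have "(\<lambda>s. l (s j)) \<in> reg_fun (frames a V) W" if "j < a" for j
      using regular_vectorD[OF _ l] that by blast
    moreover have "(\<lambda>s. \<phi> j s (unit_vec i)) \<in> reg_fun (frames a V) W" if "j < a" for j
      by (rule regular_functionalD[OF \<phi>[OF that] W(1) subset_refl regular_vector_const[OF F W(1)]])
    ultimately have g: "?g \<in> reg_fun (frames a V) W"
      by (intro reg_sum[OF F W(1)] reg_mult[OF F W(1)]) auto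
    have eq: "l (chart_vector a \<psi> i (frame_span a s)) = ?g s" if s: "s \<in> W" for s
    proof -
      have sO: "s \<in> points (frames a V)" "frame_span a s \<in> gr_chart a V \<psi>" using s W(3) by auto
      let ?u = "\<Sum>j<a. scaleC (\<phi> j s (unit_vec i)) (s j)"
      have dual': "\<And>k j. k < a \<Longrightarrow> j < a \<Longrightarrow> \<phi> k s (?s j s) = (if k = j then 1 else 0)" using dual[OF s] .
      have \<phi>lin: "\<And>k. k < a \<Longrightarrow> clinear (\<phi> k s)" using regular_functional_clinear[OF \<phi> s] .
      have inds: "indep_tuple a (\<lambda>j. ?s j s)" by (rule indep_tuple_if_dual[of a "\<lambda>k. \<phi> k s", OF \<phi>lin dual'])
      have "unit_vec i \<in> frame_span a (\<lambda>j. ?s j s)"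
        using frame_span_eq[OF fin_dim_coord_space, of a "\<lambda>j. ?s j s"] inds unit_vec_in_coord_space[OF i]
        by (simp add: dim_coord_space functional_map_in_coord_space)
      from dual_coordinates[of a "\<lambda>k. \<phi> k s", OF \<phi>lin dual' this]
      have "functional_map a \<psi> ?u = unit_vec i" unfolding clinear_combination[OF lin] by simp
      then have u: "\<And>k. k < a \<Longrightarrow> \<psi> k ?u = (if k = i then 1 else 0)" using functional_map_eq_unit[OF i] by blast
      have "?u \<in> frame_span a s" unfolding frame_span_iff by (rule exI[of _ "\<lambda>j. \<phi> j s (unit_vec i)"]) simp
      from chart_vector_unique[of \<psi>, OF \<psi> sO(2) this u]
      show ?thesis by (simp add: clinear_combination[OF l])
    qed
    show "\<exists>W g. openin (zar (frames a V)) W \<and> s0 \<in> W \<and> W \<subseteq> ?O \<and> g \<in> reg_fun (frames a V) W \<and>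
        (\<forall>y\<in>W. l (chart_vector a \<psi> i (frame_span a y)) = g y)"
      using W g eq by (intro exI[of _ W] exI[of _ ?g]) blast
  qed
qed

text \<open>Near \<open>z\<close>, the functionals dual to a basis of \<open>F z\<close> remain coordinates on the members of the family,
  and the basis dual to them varies regularly.\<close>

lemma local_frame:
  assumes V: "fin_dim_subspace V" and Z: "locally_ringed Z" and F: "morphism Z (gr a V) F" and z: "z \<in> points Z"
  obtains W s where "openin (zar Z) W" "z \<in> W" "\<And>j. j < a \<Longrightarrow> regular_vector Z W (s j)"
    "\<And>y. y \<in> W \<Longrightarrow> indep_tuple a (\<lambda>j. s j y)" "\<And>y. y \<in> W \<Longrightarrow> frame_span a (\<lambda>j. s j y) = F y"
proof -
  note Vs = fin_dim_subspace_subspace[OF V]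
  have Fz: "F z \<in> gr_points a V" using morphism_points[OF F z] points_gr[OF Vs] by simp
  obtain s where s: "indep_tuple a s" "frame_span a s = F z"
    using gr_point_frame[OF V Fz] by (auto simp: points_frames)
  obtain \<psi> where \<psi>: "\<And>i. clinear (\<psi> i)" "\<And>i j. i < a \<Longrightarrow> j < a \<Longrightarrow> \<psi> i (s j) = (if i = j then 1 else (0::complex))"
    using indep_tuple_dual[OF s(1)] by blast
  have "u = 0" if "u \<in> F z" "\<forall>i<a. \<psi> i u = 0" for u
    using dual_coordinates[of a \<psi> s u] \<psi> that s(2) by simp
  then have chart: "F z \<in> gr_chart a V \<psi>" using Fz by (simp add: gr_chart_def)
  note op = open_gr_chart[of V \<psi>, OF Vs \<psi>(1)]
  let ?W = "{y \<in> points Z. F y \<in> gr_chart a V \<psi>}"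
  have W: "openin (zar Z) ?W" by (rule morphism_open[OF F op])
  have "regular_vector Z ?W (\<lambda>y. chart_vector a \<psi> j (F y))" if "j < a" for j
    by (rule regular_vector_pullback[OF Z F op regular_chart_vector[OF V \<psi>(1) that] W]) auto
  then show ?thesis
    using W z chart chart_vectors_frame[OF V, of \<psi> _ a] \<psi>(1)
    by (intro that[of ?W "\<lambda>j y. chart_vector a \<psi> j (F y)"]) auto
qed

section \<open>Closed conditions and separation\<close>

lemma indep_tuple_snoc:
  assumes s: "indep_tuple a s" and x: "x \<notin> frame_span a s"
  shows "indep_tuple (Suc a) (\<lambda>k. if k < a then s k else x)"
proof -
  have im: "(\<lambda>k. if k < a then s k else x) ` {..<a} = s ` {..<a}" by auto
  have "x \<notin> s ` {..<a}" using x frame_span_superset by blast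
  moreover have "inj_on (\<lambda>k. if k < a then s k else x) {..<a}"
    using s by (auto simp: indep_tuple_def inj_on_def)
  moreover have "complex_vector.independent (insert x (s ` {..<a}))"
    using s x by (intro complex_vector.independent_insertI) (auto simp: indep_tuple_def frame_span_def)
  ultimately show ?thesis unfolding indep_tuple_def lessThan_Suc image_insert im by (auto simp: im)
qed

text \<open>If \<open>h\<close> maps a member of a frame of \<open>F\<close> outside of \<open>G\<close>, then its image and a frame of \<open>G\<close> together are
  independent. They remain so near that point, which excludes \<open>h F \<subseteq> G\<close> there. Subrepresentations
  are cut out by such conditions, and so is the diagonal of a Grassmannian.\<close>

lemma closed_incidence:
  assumes Z: "locally_ringed Z" and V: "fin_dim_subspace V" and V': "fin_dim_subspace V'"
    and F: "morphism Z (gr a V) F" and G: "morphism Z (gr b V') G" and h: "clinear h"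
  shows "closedin (zar Z) {z \<in> points Z. h ` F z \<subseteq> G z}"
proof -
  have "openin (zar Z) (points Z - {z \<in> points Z. h ` F z \<subseteq> G z})"
  proof (subst openin_subopen, intro ballI)
    fix z0 assume "z0 \<in> points Z - {z \<in> points Z. h ` F z \<subseteq> G z}"
    then have z0: "z0 \<in> points Z" "\<not> h ` F z0 \<subseteq> G z0" by auto
    obtain W s where W: "openin (zar Z) W" "z0 \<in> W" and s: "\<And>j. j < a \<Longrightarrow> regular_vector Z W (s j)"
      and sF: "\<And>y. y \<in> W \<Longrightarrow> indep_tuple a (\<lambda>j. s j y)" "\<And>y. y \<in> W \<Longrightarrow> frame_span a (\<lambda>j. s j y) = F y"
      by (rule local_frame[OF V Z F z0(1)]) (rule that)
    obtain W' t where W': "openin (zar Z) W'" "z0 \<in> W'" and t: "\<And>j. j < b \<Longrightarrow> regular_vector Z W' (t j)"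
      and tG: "\<And>y. y \<in> W' \<Longrightarrow> indep_tuple b (\<lambda>j. t j y)" "\<And>y. y \<in> W' \<Longrightarrow> frame_span b (\<lambda>j. t j y) = G y"
      by (rule local_frame[OF V' Z G z0(1)]) (rule that)
    have "\<exists>j<a. h (s j z0) \<notin> G z0"
    proof (rule ccontr)
      assume "\<not> (\<exists>j<a. h (s j z0) \<notin> G z0)"
      then have "frame_span a (\<lambda>j. h (s j z0)) \<subseteq> G z0"
        unfolding tG(2)[OF W'(2), symmetric] by (intro frame_span_minimal subspace_frame_span) blast
      then show False
        using z0(2) clinear_image_frame_span[OF h, of a "\<lambda>j. s j z0"] unfolding sF(2)[OF W(2)] by simp
    qed
    then obtain j where j: "j < a" "h (s j z0) \<notin> G z0" by blast
    define T where "T = (\<lambda>k z. if k < b then t k z else h (s j z))"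
    have WW: "openin (zar Z) (W \<inter> W')" "z0 \<in> W \<inter> W'" using W W' by auto
    have "regular_vector Z (W \<inter> W') (T k)" for k
    proof (cases "k < b")
      case True
      then show ?thesis
        using regular_vector_restrict[OF Z t[OF True] W'(1) WW(1)] unfolding T_def by simp
    next
      case False
      then show ?thesis
        using regular_vector_clinear[OF h regular_vector_restrict[OF Z s[OF j(1)] W(1) WW(1)]] unfolding T_def by simp
    qed
    moreover have "indep_tuple (Suc b) (\<lambda>k. T k z0)"
      using indep_tuple_snoc[OF tG(1)[OF W'(2)], of "h (s j z0)"] j(2) tG(2)[OF W'(2)] unfolding T_def by simp
    ultimately have "\<exists>N. openin (zar Z) N \<and> z0 \<in> N \<and> N \<subseteq> W \<inter> W' \<and> (\<forall>z\<in>N. indep_tuple (Suc b) (\<lambda>k. T k z))"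
      by (intro local_independence[OF Z WW])
    then obtain N where N: "openin (zar Z) N" "z0 \<in> N" "N \<subseteq> W \<inter> W'"
      "\<And>z. z \<in> N \<Longrightarrow> indep_tuple (Suc b) (\<lambda>k. T k z)" by blast
    have "\<not> h ` F z \<subseteq> G z" if z: "z \<in> N" for z
    proof
      assume hF: "h ` F z \<subseteq> G z"
      have zW: "z \<in> W" "z \<in> W'" using z N(3) by auto
      have fin: "fin_dim_subspace (G z)" "complex_vector.dim (G z) = b"
        using dim_frame_span[OF tG(1)[OF zW(2)]] fin_dim_frame_span[of b "\<lambda>j. t j z"] tG(2)[OF zW(2)] by simp_all
      have "T k z \<in> G z" for k
        using hF frame_span_superset[OF j(1), of "\<lambda>j. s j z"] frame_span_superset[of k b "\<lambda>j. t j z"]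
          sF(2)[OF zW(1)] tG(2)[OF zW(2)] unfolding T_def by auto
      from indep_tuple_le_dim[OF fin(1) N(4)[OF z] this] show False using fin(2) by simp
    qed
    then show "\<exists>T. openin (zar Z) T \<and> z0 \<in> T \<and> T \<subseteq> points Z - {z \<in> points Z. h ` F z \<subseteq> G z}"
      using N(1,2) openin_subset[OF N(1)] by (intro exI[of _ N]) blast
  qed
  then show ?thesis by (simp add: closedin_def) 
qed

definition separated :: "'a fspace \<Rightarrow> bool" where
  "separated X \<longleftrightarrow> closedin (zar (prod_fspace X X)) {(x, x) | x. x \<in> points X}"

lemma clinear_id: "clinear (\<lambda>x. x)"
  by (rule clinearI) auto

text \<open>For subspaces of equal dimension, equality is inclusion, a closed condition.\<close>

lemma separated_gr:
  assumes V: "fin_dim_subspace V"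
  shows "separated (gr a V)"
proof -
  note L = locally_ringed_gr[of a V]
  note P = points_gr[OF fin_dim_subspace_subspace[OF V], of a]
  have eq: "U = U'" if "U \<in> gr_points a V" "U' \<in> gr_points a V" "U \<subseteq> U'" for U U'
    using that subspace_eq_if_dim_eq[OF gr_points_fin_dim[OF V that(2)], of U] by (auto simp: gr_points_def)
  have "{(x, x) | x. x \<in> points (gr a V)} =
      {z \<in> points (prod_fspace (gr a V) (gr a V)). (\<lambda>x. x) ` fst z \<subseteq> snd z}"
    unfolding points_prod[OF L L] P by (auto dest: eq)
  then show ?thesis
    unfolding separated_def
    using closed_incidence[OF locally_ringed_prod[OF L L] V V morphism_fst[OF L L] morphism_snd[OF L L] clinear_id]
    by simp
qed

text \<open>This is the preimage of the diagonal of \<open>Y\<close> under \<open>f \<times> f\<close>.\<close>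

lemma closed_pullback_diagonal:
  assumes X: "locally_ringed X" and Y: "locally_ringed Y" and f: "morphism X Y f" and sep: "separated Y"
  shows "closedin (zar (prod_fspace X X)) {z \<in> points X \<times> points X. f (fst z) = f (snd z)}"
proof -
  note XX = locally_ringed_prod[OF X X]
  have "morphism (prod_fspace X X) (prod_fspace Y Y) (\<lambda>z. (f (fst z), f (snd z)))"
    by (intro morphism_to_prod XX Y morphism_compose[OF morphism_fst[OF X X] f] morphism_compose[OF morphism_snd[OF X X] f])
  from morphism_closed[OF this sep[unfolded separated_def]]
  have "closedin (zar (prod_fspace X X))
      {z \<in> points (prod_fspace X X). (f (fst z), f (snd z)) \<in> {(y, y) | y. y \<in> points Y}}" .
  moreover have "{z \<in> points (prod_fspace X X). (f (fst z), f (snd z)) \<in> {(y, y) | y. y \<in> points Y}} =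
      {z \<in> points X \<times> points X. f (fst z) = f (snd z)}"
    using morphism_points[OF f] by (auto simp: points_prod[OF X X])
  ultimately show ?thesis by simp
qed

lemma separated_injective:
  assumes X: "locally_ringed X" and Y: "locally_ringed Y" and f: "morphism X Y f" "inj_on f (points X)"
    and sep: "separated Y"
  shows "separated X"
proof -
  have "{(x, x) | x. x \<in> points X} = {z \<in> points X \<times> points X. f (fst z) = f (snd z)}"
    using f(2) by (auto dest: inj_onD)
  then show ?thesis unfolding separated_def using closed_pullback_diagonal[OF X Y f(1) sep] by simp
qed

lemma separated_Prod:
  assumes X: "\<forall>i\<in>I. locally_ringed (X i)" and sep: "\<And>i. i \<in> I \<Longrightarrow> separated (X i)"
  shows "separated (Prod_fspace I X)"
proof -
  note P = locally_ringed_Prod[OF X]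
  let ?P = "Prod_fspace I X"
  have "closedin (zar (prod_fspace ?P ?P)) {z \<in> points ?P \<times> points ?P. fst z i = snd z i}" if "i \<in> I" for i
    using closed_pullback_diagonal[OF P X[rule_format, OF that] morphism_component[OF X that] sep[OF that]] .
  then have "closedin (zar (prod_fspace ?P ?P))
      (\<Inter>S\<in>insert (points ?P \<times> points ?P) ((\<lambda>i. {z \<in> points ?P \<times> points ?P. fst z i = snd z i}) ` I). S)"
    using closedin_topspace[of "zar (prod_fspace ?P ?P)"] unfolding points_prod[OF P P]
    by (intro closedin_INT) auto
  moreover have "(\<Inter>S\<in>insert (points ?P \<times> points ?P) ((\<lambda>i. {z \<in> points ?P \<times> points ?P. fst z i = snd z i}) ` I). S) =
      {(x, x) | x. x \<in> points ?P}"
    unfolding points_Prod[OF X] by (auto intro!: PiE_ext[of _ I])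
  ultimately show ?thesis unfolding separated_def by simp
qed

section \<open>Coverings by affine spaces\<close>

text \<open>A product of affine spaces is obtained by joining lists of coordinates, with no equations to carry
  along. The coverings by affine varieties that a variety must have are then those induced on
  closed subspaces.\<close>

definition covered_by_affine_spaces :: "'a fspace \<Rightarrow> bool" where
  "covered_by_affine_spaces X \<longleftrightarrow> (\<exists>\<U>. finite \<U> \<and> \<Union>\<U> = points X \<and>
     (\<forall>U\<in>\<U>. openin (zar X) U \<and> (\<exists>d. isomorphic (induced X U) (affine_space d))))"

lemma isomorphicE:
  assumes "isomorphic X Y"
  obtains \<phi> \<psi> where "morphism X Y \<phi>" "morphism Y X \<psi>" "\<And>x. x \<in> points X \<Longrightarrow> \<psi> (\<phi> x) = x"
    "\<And>y. y \<in> points Y \<Longrightarrow> \<phi> (\<psi> y) = y"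
  using assms unfolding isomorphic_def isomorphism_def by blast

lemma isomorphismI:
  assumes "morphism X Y \<phi>" "morphism Y X \<psi>" "\<And>x. x \<in> points X \<Longrightarrow> \<psi> (\<phi> x) = x"
    "\<And>y. y \<in> points Y \<Longrightarrow> \<phi> (\<psi> y) = y"
  shows "isomorphism X Y \<phi>"
  using assms unfolding isomorphism_def by blast

lemma isomorphicI:
  assumes "morphism X Y \<phi>" "morphism Y X \<psi>" "\<And>x. x \<in> points X \<Longrightarrow> \<psi> (\<phi> x) = x"
    "\<And>y. y \<in> points Y \<Longrightarrow> \<phi> (\<psi> y) = y"
  shows "isomorphic X Y"
  using isomorphismI[OF assms] unfolding isomorphic_def by blast

lemma variety_closed_subspace:
  assumes X: "locally_ringed X" and cov: "covered_by_affine_spaces X" and sep: "separated X"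
    and C: "closedin (zar X) C"
  shows "variety (induced X C)"
proof -
  let ?Y = "induced X C"
  note Y = locally_ringed_induced[OF X, of C]
  obtain \<U> where \<U>: "finite \<U>" "\<Union>\<U> = points X"
    "\<And>U. U \<in> \<U> \<Longrightarrow> openin (zar X) U \<and> (\<exists>d. isomorphic (induced X U) (affine_space d))"
    using cov unfolding covered_by_affine_spaces_def by (elim exE conjE) simp
  have "affine_variety (induced ?Y (U \<inter> C))" if U: "U \<in> \<U>" for U
  proof -
    have Up: "U \<subseteq> points X" using \<U>(3)[OF U] openin_subset by blast
    obtain d where "isomorphic (induced X U) (affine_space d)" using \<U>(3)[OF U] by blast
    then obtain \<phi> \<psi> where \<phi>: "morphism (induced X U) (affine_space d) \<phi>" and \<psi>: "morphism (affine_space d) (induced X U) \<psi>"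
      and inv: "\<And>x. x \<in> points (induced X U) \<Longrightarrow> \<psi> (\<phi> x) = x" "\<And>y. y \<in> points (affine_space d) \<Longrightarrow> \<phi> (\<psi> y) = y"
      by (rule isomorphicE) (rule that)
    note A = locally_ringed_affine_space[of d]
    note XU = locally_ringed_induced[OF X, of U] and YU = locally_ringed_induced[OF Y, of "U \<inter> C"]
    let ?Z = "{y \<in> points (affine_space d). \<psi> y \<in> C}"
    have \<psi>X: "morphism (affine_space d) X \<psi>" by (rule morphism_compose[OF \<psi> morphism_inclusion[OF X]])
    have Z: "closedin (zar (affine_space d)) ?Z" by (rule morphism_closed[OF \<psi>X C])
    have \<psi>U: "\<psi> y \<in> U" if "y \<in> points (affine_space d)" for y using morphism_points[OF \<psi> that] by simp
    have incl: "morphism (induced ?Y (U \<inter> C)) (induced X U) (\<lambda>x. x)"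
      by (rule morphism_to_induced[OF YU morphism_compose[OF morphism_inclusion[OF Y] morphism_inclusion[OF X]]]) simp
    have "isomorphic (induced ?Y (U \<inter> C)) (induced (affine_space d) ?Z)"
    proof (rule isomorphicI[where \<phi> = \<phi> and \<psi> = \<psi>])
      show "morphism (induced ?Y (U \<inter> C)) (induced (affine_space d) ?Z) \<phi>"
        by (rule morphism_to_induced[OF YU morphism_compose[OF incl \<phi>]])
          (use inv(1) morphism_points[OF \<phi>] in fastforce)
      note AZ = locally_ringed_induced[OF A, of ?Z]
      have "morphism (induced (affine_space d) ?Z) ?Y \<psi>"
        by (rule morphism_to_induced[OF AZ morphism_from_induced[OF A \<psi>X]]) simp
      then show "morphism (induced (affine_space d) ?Z) (induced ?Y (U \<inter> C)) \<psi>"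
        by (rule morphism_to_induced[OF AZ]) (use \<psi>U in simp)
    qed (use inv in auto)
    then show ?thesis using Z unfolding affine_variety_def by blast
  qed
  moreover have "openin (zar ?Y) (U \<inter> C)" if "U \<in> \<U>" for U
    using \<U>(3)[OF that] unfolding openin_induced by blast
  ultimately have "\<exists>\<V>. finite \<V> \<and> \<Union>\<V> = points ?Y \<and> (\<forall>U\<in>\<V>. openin (zar ?Y) U \<and> affine_variety (induced ?Y U))"
    using \<U>(1,2) by (intro exI[of _ "(\<lambda>U. U \<inter> C) ` \<U>"]) auto
  moreover have "separated ?Y"
    by (rule separated_injective[OF Y X morphism_inclusion[OF X] _ sep]) simp
  ultimately show ?thesis
    using locally_ringed_sheaf[OF Y] unfolding variety_def separated_def by blast
qed

text \<open>The pieces are the products of one piece of each factor. The coordinates of such a product are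
  indexed by pairs of a factor and a coordinate of it, and \<open>e\<close> numbers these pairs.\<close>

lemma covered_by_affine_spaces_Prod:
  assumes I: "finite I" and X: "\<forall>i\<in>I. locally_ringed (X i)"
    and cov: "\<And>i. i \<in> I \<Longrightarrow> covered_by_affine_spaces (X i)"
  shows "covered_by_affine_spaces (Prod_fspace I X)"
proof -
  let ?P = "Prod_fspace I X"
  note P = locally_ringed_Prod[OF X]
  have "\<forall>i\<in>I. \<exists>\<U>. finite \<U> \<and> \<Union>\<U> = points (X i) \<and>
     (\<forall>U\<in>\<U>. openin (zar (X i)) U \<and> (\<exists>d. isomorphic (induced (X i) U) (affine_space d)))"
    using cov unfolding covered_by_affine_spaces_def by blast
  from bchoice[OF this] obtain \<U> where "\<forall>i\<in>I. finite (\<U> i) \<and> \<Union>(\<U> i) = points (X i) \<and>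
     (\<forall>U\<in>\<U> i. openin (zar (X i)) U \<and> (\<exists>d. isomorphic (induced (X i) U) (affine_space d)))" by (elim exE)
  note \<U> = this[rule_format (no_asm)]
  have piece: "openin (zar ?P) (PiE I u) \<and> (\<exists>d. isomorphic (induced ?P (PiE I u)) (affine_space d))"
    if u: "u \<in> PiE I \<U>" for u
  proof
    have ui: "u i \<in> \<U> i" if "i \<in> I" for i using u that by auto
    have uo: "openin (zar (X i)) (u i)" "u i \<subseteq> points (X i)" if "i \<in> I" for i
      using \<U>[OF that] ui[OF that] openin_subset by blast+
    have Pu: "PiE I u \<subseteq> points ?P" unfolding points_Prod[OF X] using uo(2) by (intro PiE_mono) auto
    have eq: "PiE I u = points ?P \<inter> (\<Inter>i\<in>I. {z \<in> points ?P. z i \<in> u i})"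
      using Pu unfolding points_Prod[OF X] by (auto simp: PiE_iff)
    show "openin (zar ?P) (PiE I u)"
      unfolding eq using I morphism_open[OF morphism_component[OF X] uo(1)]
      by (cases "I = {}") (auto intro!: openin_Int openin_INT2)
    have "\<forall>i\<in>I. \<exists>q. isomorphic (induced (X i) (u i)) (affine_space q)" using \<U> ui by blast
    from bchoice[OF this] obtain d where d: "\<And>i. i \<in> I \<Longrightarrow> isomorphic (induced (X i) (u i)) (affine_space (d i))" by blast
    have "\<forall>i\<in>I. \<exists>m. morphism (induced (X i) (u i)) (affine_space (d i)) (fst m) \<and>
        morphism (affine_space (d i)) (induced (X i) (u i)) (snd m) \<and>
        (\<forall>x \<in> points (induced (X i) (u i)). snd m (fst m x) = x) \<and>
        (\<forall>y \<in> points (affine_space (d i)). fst m (snd m y) = y)"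
    proof
      fix i assume "i \<in> I"
      obtain \<phi> \<psi> where "morphism (induced (X i) (u i)) (affine_space (d i)) \<phi>"
        "morphism (affine_space (d i)) (induced (X i) (u i)) \<psi>"
        "\<And>x. x \<in> points (induced (X i) (u i)) \<Longrightarrow> \<psi> (\<phi> x) = x"
        "\<And>y. y \<in> points (affine_space (d i)) \<Longrightarrow> \<phi> (\<psi> y) = y"
        by (rule isomorphicE[OF d[OF \<open>i \<in> I\<close>]]) (rule that)
      then show "\<exists>m. morphism (induced (X i) (u i)) (affine_space (d i)) (fst m) \<and>
        morphism (affine_space (d i)) (induced (X i) (u i)) (snd m) \<and>
        (\<forall>x \<in> points (induced (X i) (u i)). snd m (fst m x) = x) \<and>
        (\<forall>y \<in> points (affine_space (d i)). fst m (snd m y) = y)"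
        by (intro exI[of _ "(\<phi>, \<psi>)"]) auto
    qed
    from bchoice[OF this] obtain m where m: "\<And>i. i \<in> I \<Longrightarrow> morphism (induced (X i) (u i)) (affine_space (d i)) (fst (m i)) \<and>
        morphism (affine_space (d i)) (induced (X i) (u i)) (snd (m i)) \<and>
        (\<forall>x \<in> points (induced (X i) (u i)). snd (m i) (fst (m i) x) = x) \<and>
        (\<forall>y \<in> points (affine_space (d i)). fst (m i) (snd (m i) y) = y)" by blast
    define \<phi> where "\<phi> = (\<lambda>i. fst (m i))"
    define \<psi> where "\<psi> = (\<lambda>i. snd (m i))"
    have \<phi>: "morphism (induced (X i) (u i)) (affine_space (d i)) (\<phi> i)"
      and \<psi>: "morphism (affine_space (d i)) (induced (X i) (u i)) (\<psi> i)"
      and inv1: "\<And>x. x \<in> u i \<Longrightarrow> \<psi> i (\<phi> i x) = x"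
      and inv2: "\<And>y. y \<in> coord_space (d i) \<Longrightarrow> \<phi> i (\<psi> i y) = y" if "i \<in> I" for i
      using m[OF that] uo(2)[OF that] unfolding \<phi>_def \<psi>_def by auto
    have \<psi>u: "\<psi> i y \<in> u i" if "i \<in> I" "y \<in> coord_space (d i)" for i y
      using morphism_points[OF \<psi>[OF that(1)]] that(2) by simp
    have \<phi>c: "\<phi> i x \<in> coord_space (d i)" if "i \<in> I" "x \<in> u i" for i x
      using morphism_points[OF \<phi>[OF that(1)], of x] that uo(2)[OF that(1)] by auto
    let ?S = "SIGMA i:I. {..<d i}"
    define D where "D = card ?S"
    have "finite ?S" using I by auto
    then obtain e where e: "bij_betw e ?S {0..<D}" using ex_bij_betw_finite_nat unfolding D_def by blast
    define g where "g = inv_into ?S e"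
    have ge: "g (e (i, j)) = (i, j)" if "i \<in> I" "j < d i" for i j
      using e that unfolding g_def bij_betw_def by (intro inv_into_f_f) auto
    have eD: "e (i, j) < D" if "i \<in> I" "j < d i" for i j using e that unfolding bij_betw_def by fastforce
    have g: "fst (g t) \<in> I" "snd (g t) < d (fst (g t))" "e (g t) = t" if "t < D" for t
    proof -
      have "t \<in> e ` ?S" using e that unfolding bij_betw_def by auto
      from inv_into_into[OF this] f_inv_into_f[OF this]
      show "fst (g t) \<in> I" "snd (g t) < d (fst (g t))" "e (g t) = t" unfolding g_def by auto
    qed
    define \<Phi> where "\<Phi> = (\<lambda>z t. if t < D then \<phi> (fst (g t)) (z (fst (g t))) (snd (g t)) else 0)"
    define B where "B = (\<lambda>i (x :: nat \<Rightarrow> complex) j. if j < d i then x (e (i, j)) else 0)"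
    define \<Psi> where "\<Psi> = (\<lambda>x. \<lambda>i\<in>I. \<psi> i (B i x))"
    have B: "B i x \<in> coord_space (d i)" for i x by (auto simp: B_def coord_space_def)
    let ?Q = "induced ?P (PiE I u)"
    note Q = locally_ringed_induced[OF P, of "PiE I u"] and A = locally_ringed_affine_space
    have Qp: "points ?Q = PiE I u" using Pu by auto
    have comp: "morphism ?Q (induced (X i) (u i)) (\<lambda>z. z i)" if "i \<in> I" for i
      by (rule morphism_to_induced[OF Q morphism_from_induced[OF P morphism_component[OF X that]]]) (use that in auto)
    have "isomorphic ?Q (affine_space D)"
    proof (rule isomorphicI[where \<phi> = \<Phi> and \<psi> = \<Psi>])
      show "morphism ?Q (affine_space D) \<Phi>"
      proof (rule morphism_to_affine_space[OF Q])
        show "\<Phi> z \<in> coord_space D" for z by (auto simp: \<Phi>_def coord_space_def)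
        fix t assume t: "t < D"
        have "(\<lambda>z. \<phi> (fst (g t)) (z (fst (g t))) (snd (g t))) \<in> reg_fun ?Q (points ?Q)"
          by (rule morphism_reg_open[OF Q morphism_compose[OF comp \<phi>] _ reg_coordinate[OF g(2)[OF t]]])
            (use g(1)[OF t] \<phi>c Qp openin_topspace[of "zar (affine_space (d (fst (g t))))"] openin_topspace[of "zar ?Q"]
              in \<open>auto simp del: points_induced\<close>)
        then show "(\<lambda>z. \<Phi> z t) \<in> reg_fun ?Q (points ?Q)" using t by (simp add: \<Phi>_def)
      qed
      have "morphism (affine_space D) ?P \<Psi>"
      proof (rule morphism_to_Prod[OF A I X])
        fix i assume i: "i \<in> I"
        have "morphism (affine_space D) (affine_space (d i)) (B i)"
          by (rule morphism_to_affine_space[OF A B]) (use eD[OF i] reg_coordinate in \<open>simp add: B_def\<close>)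
        from morphism_compose[OF morphism_compose[OF this \<psi>[OF i]] morphism_inclusion[OF X[rule_format, OF i]]]
        show "morphism (affine_space D) (X i) (\<lambda>x. \<Psi> x i)" using i by (simp add: \<Psi>_def)
      qed (simp add: \<Psi>_def)
      then show "morphism (affine_space D) ?Q \<Psi>"
        by (rule morphism_to_induced[OF A]) (use \<psi>u B in \<open>auto simp: \<Psi>_def\<close>)
      show "\<Psi> (\<Phi> z) = z" if "z \<in> points ?Q" for z
      proof
        fix i
        have z: "z \<in> PiE I u" using that Qp by simp
        show "\<Psi> (\<Phi> z) i = z i"
        proof (cases "i \<in> I")
          case True
          have "B i (\<Phi> z) = \<phi> i (z i)"
          proof
            fix j
            have "z i \<in> u i" using z True by auto
            from \<phi>c[OF True this] show "B i (\<Phi> z) j = \<phi> i (z i) j"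
              using ge[OF True, of j] eD[OF True, of j] by (auto simp: B_def \<Phi>_def coord_space_def)
          qed
          then show ?thesis using True z inv1[OF True, of "z i"] by (auto simp: \<Psi>_def)
        next
          case False
          then show ?thesis using z by (auto simp: \<Psi>_def)
        qed
      qed
      show "\<Phi> (\<Psi> x) = x" if "x \<in> points (affine_space D)" for x
      proof
        fix t
        show "\<Phi> (\<Psi> x) t = x t"
        proof (cases "t < D")
          case True
          then show ?thesis
            using g[OF True] inv2[OF g(1)[OF True] B] by (simp add: \<Phi>_def \<Psi>_def) (simp add: B_def)
        qed (use that in \<open>simp add: \<Phi>_def coord_space_def\<close>)
      qed
    qed
    then show "\<exists>d. isomorphic ?Q (affine_space d)" by blast
  qed
  have "\<Union>((\<lambda>u. PiE I u) ` PiE I \<U>) = points ?P"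
  proof (intro equalityI subsetI)
    fix z assume "z \<in> points ?P"
    then have z: "z \<in> PiE I (\<lambda>i. points (X i))" by (simp add: points_Prod[OF X])
    have "\<forall>i\<in>I. \<exists>U. U \<in> \<U> i \<and> z i \<in> U" using z \<U> by (auto simp: PiE_iff) (metis UnionE)
    from bchoice[OF this] obtain u where u: "\<And>i. i \<in> I \<Longrightarrow> u i \<in> \<U> i \<and> z i \<in> u i" by blast
    then have "restrict u I \<in> PiE I \<U>" "z \<in> PiE I (restrict u I)" using z by (auto simp: PiE_iff)
    then show "z \<in> \<Union>((\<lambda>u. PiE I u) ` PiE I \<U>)" by blast
  next
    fix z assume "z \<in> \<Union>((\<lambda>u. PiE I u) ` PiE I \<U>)"
    then show "z \<in> points ?P" using piece openin_subset by blast
  qed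
  moreover have "finite ((\<lambda>u. PiE I u) ` PiE I \<U>)" using I \<U> by (intro finite_imageI finite_PiE) auto
  ultimately show ?thesis
    unfolding covered_by_affine_spaces_def using piece
    by (intro exI[of _ "(\<lambda>u. PiE I u) ` PiE I \<U>"]) blast
qed

text \<open>A member of the chart has a unique basis \<open>v\<^sub>i + \<Sum>\<^sub>k x\<^sub>i\<^sub>k v\<^bsub>a+k\<^esub>\<close> with \<open>i < a\<close>, and the \<open>x\<^sub>i\<^sub>k\<close> are arbitrary.
  The entry with indices \<open>i\<close> and \<open>k\<close> is the coordinate with number \<open>i (b - a) + k\<close> of affine space.\<close>

lemma gr_chart_isomorphic_affine_space:
  assumes V: "frame_span b v = V" and \<phi>: "\<And>i. clinear (\<phi> i)"
    and dual: "\<And>i j. i < b \<Longrightarrow> j < b \<Longrightarrow> \<phi> i (v j) = (if i = j then 1 else (0::complex))" and ab: "a \<le> b"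
  shows "isomorphic (induced (gr a V) (gr_chart a V \<phi>)) (affine_space (a * (b - a)))"
proof -
  define c where "c = b - a"
  let ?O = "gr_chart a V \<phi>"
  let ?w = "\<lambda>x i. v i + (\<Sum>k<c. scaleC (x (i * c + k)) (v (a + k)))"
  have Vf: "fin_dim_subspace V" using fin_dim_frame_span[of b v] V by simp
  note Vs = fin_dim_subspace_subspace[OF Vf] and G = locally_ringed_gr[of a V]
  note op = open_gr_chart[of V \<phi> a, OF Vs \<phi>]
  have Op: "?O \<subseteq> points (gr a V)" using openin_subset[OF op] .
  note Q = locally_ringed_induced[OF G, of ?O]
  have Qp: "points (induced (gr a V) ?O) = ?O" using Op by auto
  have vV: "v j \<in> V" if "j < b" for j using frame_span_superset[OF that, of v] V by simp
  have \<phi>w: "\<phi> k (?w x i) = (if k = i then 1 else 0)" if "k < a" "i < a" for k i x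
  proof -
    have "\<phi> k (?w x i) = \<phi> k (v i) + (\<Sum>j<c. x (i * c + j) * \<phi> k (v (a + j)))"
      by (simp add: clinear_add[OF \<phi>] clinear_combination[OF \<phi>])
    also have "(\<Sum>j<c. x (i * c + j) * \<phi> k (v (a + j))) = 0"
      using that ab dual by (intro sum.neutral) (auto simp: c_def)
    finally show ?thesis using that ab dual by auto
  qed
  have \<phi>w': "\<phi> (a + k) (?w x i) = x (i * c + k)" if "k < c" "i < a" for k i x
  proof -
    have "\<phi> (a + k) (?w x i) = \<phi> (a + k) (v i) + (\<Sum>j<c. x (i * c + j) * \<phi> (a + k) (v (a + j)))"
      by (simp add: clinear_add[OF \<phi>] clinear_combination[OF \<phi>])
    also have "(\<Sum>j<c. x (i * c + j) * \<phi> (a + k) (v (a + j))) = (\<Sum>j<c. if j = k then x (i * c + j) else 0)"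
      using that ab dual by (intro sum.cong) (auto simp: c_def)
    finally show ?thesis using that ab dual by (auto simp: c_def)
  qed
  have wV: "?w x i \<in> V" if "i < a" for x i
    using that ab by (auto intro!: complex_vector.subspace_add subspace_combination Vs vV simp: c_def)
  have indw: "indep_tuple a (?w x)" for x
    by (rule indep_tuple_if_dual[of a \<phi>]) (use \<phi> \<phi>w in auto)
  have chart: "frame_span a (?w x) \<in> ?O" for x
  proof -
    have "frame_span a (?w x) \<in> gr_points a V" by (rule frame_span_in_gr_points[OF Vs indw wV])
    moreover have "u = 0" if "u \<in> frame_span a (?w x)" "\<forall>i<a. \<phi> i u = 0" for u
      using dual_coordinates[of a \<phi> "?w x" u] \<phi> \<phi>w that by simp
    ultimately show ?thesis by (simp add: gr_chart_def)
  qed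
  have cv: "chart_vector a \<phi> i (frame_span a (?w x)) = ?w x i" if "i < a" for i x
    by (rule chart_vector_unique[of \<phi>, OF \<phi> chart frame_span_superset[OF that]]) (use \<phi>w that in auto)
  have wcv: "?w (\<lambda>t. if t < a * c then \<phi> (a + t mod c) (chart_vector a \<phi> (t div c) U) else 0) i = chart_vector a \<phi> i U"
    if U: "U \<in> ?O" and i: "i < a" for U i
  proof -
    let ?u = "chart_vector a \<phi> i U"
    have lt: "i * c + k < a * c" if "k < c" for k
    proof -
      have "i * c + k < (i + 1) * c" using that by simp
      also have "\<dots> \<le> a * c" using i by (intro mult_le_mono1) simp
      finally show ?thesis .
    qed
    have uV: "?u \<in> frame_span b v"
      using chart_vector(1)[OF Vf \<phi> U i] U V by (auto simp: gr_chart_def gr_points_def)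
    have "?u = (\<Sum>j<b. scaleC (\<phi> j ?u) (v j))"
      by (rule dual_coordinates[of b \<phi>]) (use \<phi> dual uV in auto)
    also have "\<dots> = (\<Sum>j<a. scaleC (\<phi> j ?u) (v j)) + (\<Sum>k<c. scaleC (\<phi> (a + k) ?u) (v (a + k)))"
      unfolding c_def by (rule sum_split_at[OF ab])
    also have "(\<Sum>j<a. scaleC (\<phi> j ?u) (v j)) = (\<Sum>j<a. if j = i then v j else 0)"
      using chart_vector(2)[OF Vf \<phi> U i] by (intro sum.cong) (auto simp: scaleC_one)
    also have "\<dots> = v i" using i by simp
    also have "(\<Sum>k<c. scaleC (\<phi> (a + k) ?u) (v (a + k))) =
        (\<Sum>k<c. scaleC (if i * c + k < a * c then \<phi> (a + (i * c + k) mod c) (chart_vector a \<phi> ((i * c + k) div c) U) else 0) (v (a + k)))"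
      using lt by (intro sum.cong) auto
    finally show ?thesis by simp
  qed
  have "isomorphic (induced (gr a V) ?O) (affine_space (a * c))"
  proof (rule isomorphicI)
    let ?\<Phi> = "\<lambda>U t. if t < a * c then \<phi> (a + t mod c) (chart_vector a \<phi> (t div c) U) else 0"
    let ?\<Psi> = "\<lambda>x. frame_span a (?w x)"
    have div: "t div c < a" "t mod c < c" if "t < a * c" for t
      using that by (auto simp: less_mult_imp_div_less intro!: mod_less_divisor gr0I)
    show "morphism (induced (gr a V) ?O) (affine_space (a * c)) ?\<Phi>"
    proof (rule morphism_to_affine_space[OF Q])
      show "?\<Phi> U \<in> coord_space (a * c)" for U by (auto simp: coord_space_def)
      fix t assume t: "t < a * c"
      have "(\<lambda>U. \<phi> (a + t mod c) (chart_vector a \<phi> (t div c) U)) \<in> reg_fun (induced (gr a V) ?O) ?O"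
        using reg_induced_open[OF op regular_vectorD[OF regular_chart_vector[OF Vf \<phi> div(1)[OF t]] \<phi>], of _ ?O] by simp
      then show "(\<lambda>U. ?\<Phi> U t) \<in> reg_fun (induced (gr a V) ?O) (points (induced (gr a V) ?O))"
        using t unfolding Qp by simp
    qed
    note A = locally_ringed_affine_space[of "a * c"]
    have "morphism (affine_space (a * c)) (gr a V) ?\<Psi>"
    proof (rule morphism_to_gr[OF A Vf])
      show "?\<Psi> x \<in> gr_points a V" for x using chart by (auto simp: gr_chart_def)
      note W = openin_topspace[of "zar (affine_space (a * c))", unfolded points_affine_space]
      have "regular_vector (affine_space (a * c)) (coord_space (a * c)) (\<lambda>x. ?w x i)" if i: "i < a" for i
        unfolding regular_vector_def
      proof (intro allI impI)
        fix l :: "'a \<Rightarrow> complex" assume l: "clinear l"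
        have "(\<lambda>x. x (i * c + k)) \<in> reg_fun (affine_space (a * c)) (coord_space (a * c))" if "k < c" for k
        proof (rule reg_coordinate)
          have "i * c + k < (i + 1) * c" using that by simp
          also have "\<dots> \<le> a * c" using i by (intro mult_le_mono1) simp
          finally show "i * c + k < a * c" .
        qed
        then have "(\<lambda>x. l (v i) + (\<Sum>k<c. x (i * c + k) * l (v (a + k)))) \<in>
            reg_fun (affine_space (a * c)) (coord_space (a * c))"
          by (intro reg_add[OF A W] reg_sum[OF A W] reg_mult[OF A W _ reg_const[OF A W]] reg_const[OF A W]) auto
        then show "(\<lambda>x. l (?w x i)) \<in> reg_fun (affine_space (a * c)) (coord_space (a * c))"
          by (simp add: clinear_add[OF l] clinear_combination[OF l])
      qed
      then show "\<exists>W m s. openin (zar (affine_space (a * c))) W \<and> x \<in> W \<and>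
         (\<forall>k<m. regular_vector (affine_space (a * c)) W (s k)) \<and> (\<forall>z\<in>W. ?\<Psi> z = frame_span m (\<lambda>k. s k z))"
        if "x \<in> points (affine_space (a * c))" for x
        using W that
        by (intro exI[of _ "coord_space (a * c)"] exI[of _ a] exI[of _ "\<lambda>i x. ?w x i"]) simp
    qed
    then show "morphism (affine_space (a * c)) (induced (gr a V) ?O) ?\<Psi>"
      by (rule morphism_to_induced[OF A]) (rule chart)
    show "?\<Psi> (?\<Phi> U) = U" if "U \<in> points (induced (gr a V) ?O)" for U
    proof -
      have U: "U \<in> ?O" using that unfolding Qp .
      have "?\<Psi> (?\<Phi> U) = frame_span a (\<lambda>i. chart_vector a \<phi> i U)"
        by (rule frame_span_cong) (rule wcv[OF U])
      then show ?thesis using chart_vectors_frame(2)[OF Vf \<phi> U] by simp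
    qed
    show "?\<Phi> (?\<Psi> x) = x" if "x \<in> points (affine_space (a * c))" for x
    proof
      fix t
      show "?\<Phi> (?\<Psi> x) t = x t"
      proof (cases "t < a * c")
        case True
        have "\<phi> (a + t mod c) (?w x (t div c)) = x t"
          unfolding \<phi>w'[OF div(2,1)[OF True]] by simp
        then show ?thesis using True cv[OF div(1)[OF True], of x] by simp
      qed (use that in \<open>simp add: coord_space_def\<close>)
    qed
  qed
  then show ?thesis unfolding c_def .
qed

text \<open>Finitely many charts suffice, namely those of the reorderings \<open>\<pi>\<close> of one basis \<open>v\<close>. A basis of \<open>U\<close> is
  completed to one of \<open>V\<close> by \<open>b - a\<close> members of \<open>v\<close>; if \<open>\<pi>\<close> puts these last, then \<open>U\<close> has no nonzero
  vector in their span, which says that the first \<open>a\<close> coordinates are injective on \<open>U\<close>.\<close>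

lemma covered_by_affine_spaces_gr:
  assumes V: "fin_dim_subspace V"
  shows "covered_by_affine_spaces (gr a V)"
proof -
  note Vs = fin_dim_subspace_subspace[OF V]
  define b where "b = complex_vector.dim V"
  obtain v where v: "indep_tuple b v" "frame_span b v = V" using frame_exists[OF V] unfolding b_def by blast
  obtain \<phi> where \<phi>: "\<And>i. clinear (\<phi> i)" "\<And>i j. i < b \<Longrightarrow> j < b \<Longrightarrow> \<phi> i (v j) = (if i = j then 1 else (0::complex))"
    using indep_tuple_dual[OF v(1)] by blast
  define perms where "perms = {\<pi> \<in> {..<b} \<rightarrow>\<^sub>E {..<b}. bij_betw \<pi> {..<b} {..<b}}"
  define chart where "chart = (\<lambda>\<pi>. gr_chart a V (\<lambda>i. \<phi> (\<pi> i)))"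
  have ab: "a \<le> b" if "U \<in> gr_points a V" for U
    using dim_mono_fin_dim[OF V, of U] that unfolding gr_points_def b_def by auto
  have iso: "isomorphic (induced (gr a V) (chart \<pi>)) (affine_space (a * (b - a)))"
    if \<pi>: "\<pi> \<in> perms" and ab: "a \<le> b" for \<pi>
    unfolding chart_def
  proof (rule gr_chart_isomorphic_affine_space[OF _ _ _ ab])
    have bij: "bij_betw \<pi> {..<b} {..<b}" using \<pi> by (simp add: perms_def)
    then have "(\<lambda>i. v (\<pi> i)) ` {..<b} = v ` {..<b}" unfolding bij_betw_def by (metis image_image)
    then show "frame_span b (\<lambda>i. v (\<pi> i)) = V" using v(2) by (simp add: frame_span_def)
    show "clinear (\<phi> (\<pi> i))" for i by (rule \<phi>(1))
    fix i j assume ij: "i < b" "j < b"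
    then have "\<pi> i < b" "\<pi> j < b" "\<pi> i = \<pi> j \<longleftrightarrow> i = j"
      using bij unfolding bij_betw_def inj_on_def by auto
    then show "\<phi> (\<pi> i) (v (\<pi> j)) = (if i = j then 1 else 0)" using \<phi>(2) by simp
  qed
  have cover: "\<exists>\<pi>\<in>perms. U \<in> chart \<pi>" if U: "U \<in> gr_points a V" for U
  proof -
    obtain s where s: "indep_tuple a s" "frame_span a s = U" using gr_point_frame[OF V U] by (auto simp: points_frames)
    have sV: "s j \<in> V" if "j < a" for j using frame_span_superset[OF that, of s] s(2) U by (auto simp: gr_points_def)
    have "V \<subseteq> complex_vector.span (v ` {..<b})" using v(2) by (simp add: frame_span_def)
    moreover have "v k \<in> V" if "k \<in> {..<b}" for k using frame_span_superset[of k b v] v(2) that by simp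
    ultimately obtain f where f: "\<And>j. a \<le> j \<Longrightarrow> j < b \<Longrightarrow> f j < b"
      "indep_tuple b (\<lambda>j. if j < a then s j else v (f j))"
      using extend_to_basis[OF V s(1) sV, where T = "{..<b}" and t = v] unfolding b_def[symmetric] by auto
    let ?t = "\<lambda>j. if j < a then s j else v (f j)"
    have inj: "inj_on f {a..<b}"
    proof (rule inj_onI)
      fix i j assume ij: "i \<in> {a..<b}" "j \<in> {a..<b}" "f i = f j"
      then have "?t i = ?t j" by simp
      then show "i = j" using f(2) ij(1,2) unfolding indep_tuple_def inj_on_def by auto
    qed
    have fsub: "f ` {a..<b} \<subseteq> {..<b}" using f(1) by auto
    have "card ({..<b} - f ` {a..<b}) = a"
      using ab[OF U] by (simp add: card_Diff_subset[OF _ fsub] card_image[OF inj])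
    then obtain g where g: "bij_betw g {..<a} ({..<b} - f ` {a..<b})"
      using finite_same_card_bij[of "{..<a}" "{..<b} - f ` {a..<b}"] by auto
    define \<pi> where "\<pi> = (\<lambda>j\<in>{..<b}. if j < a then g j else f j)"
    have "bij_betw (\<lambda>j. if j < a then g j else f j) ({..<a} \<union> {a..<b}) (({..<b} - f ` {a..<b}) \<union> f ` {a..<b})"
    proof (rule bij_betw_combine)
      show "bij_betw (\<lambda>j. if j < a then g j else f j) {..<a} ({..<b} - f ` {a..<b})"
        by (subst bij_betw_cong[of _ _ g]) (use g in auto)
      show "bij_betw (\<lambda>j. if j < a then g j else f j) {a..<b} (f ` {a..<b})"
        by (subst bij_betw_cong[of _ _ f]) (use inj in \<open>auto simp: bij_betw_def\<close>)
    qed auto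
    moreover have "{..<a} \<union> {a..<b} = {..<b}" "({..<b} - f ` {a..<b}) \<union> f ` {a..<b} = {..<b}"
      using ab[OF U] fsub by auto
    ultimately have bij: "bij_betw \<pi> {..<b} {..<b}"
      by (subst bij_betw_cong[of _ _ "\<lambda>j. if j < a then g j else f j"]) (auto simp: \<pi>_def)
    moreover have "\<pi> \<in> extensional {..<b}" by (simp add: \<pi>_def)
    ultimately have "\<pi> \<in> perms" unfolding perms_def by (auto simp: PiE_iff dest: bij_betwE)
    moreover have "u = 0" if u: "u \<in> U" "\<forall>i<a. \<phi> (\<pi> i) u = 0" for u
    proof -
      have uV: "u \<in> frame_span b v" using u(1) U v(2) by (auto simp: gr_points_def)
      have zero: "\<phi> k u = 0" if "k < b" "k \<notin> f ` {a..<b}" for k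
      proof -
        have "k \<in> g ` {..<a}" using that g unfolding bij_betw_def by simp
        then obtain i where "i < a" "g i = k" by auto
        then show ?thesis using u(2) ab[OF U] by (auto simp: \<pi>_def)
      qed
      have "u = (\<Sum>k<b. scaleC (\<phi> k u) (v k))"
        by (rule dual_coordinates[of b \<phi>]) (use \<phi> uV in auto)
      also have "\<dots> = (\<Sum>k\<in>f ` {a..<b}. scaleC (\<phi> k u) (v k))"
        using fsub zero by (intro sum.mono_neutral_right) auto
      also have "\<dots> = (\<Sum>j\<in>{a..<b}. scaleC (\<phi> (f j) u) (v (f j)))" by (simp add: sum.reindex[OF inj])
      finally have u1: "u = (\<Sum>j\<in>{a..<b}. scaleC (\<phi> (f j) u) (?t j))" by simp
      obtain c where c: "u = (\<Sum>j<a. scaleC (c j) (s j))" using u(1) s(2) frame_span_iff by metis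
      have "(\<Sum>j<b. scaleC (if j < a then c j else - \<phi> (f j) u) (?t j)) =
          (\<Sum>j<a. scaleC (if j < a then c j else - \<phi> (f j) u) (?t j)) +
          (\<Sum>j\<in>{a..<b}. scaleC (if j < a then c j else - \<phi> (f j) u) (?t j))"
        using ab[OF U] by (subst sum.union_disjoint[symmetric]) (auto intro!: sum.cong)
      also have "\<dots> = u - u"
        unfolding diff_conv_add_uminus
      proof (rule arg_cong2[of _ _ _ _ "(+)"])
        show "(\<Sum>j<a. scaleC (if j < a then c j else - \<phi> (f j) u) (?t j)) = u" unfolding c by (intro sum.cong) auto
        show "(\<Sum>j\<in>{a..<b}. scaleC (if j < a then c j else - \<phi> (f j) u) (?t j)) = - u"
        proof -
          have "(\<Sum>j\<in>{a..<b}. scaleC (if j < a then c j else - \<phi> (f j) u) (?t j)) =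
              (\<Sum>j\<in>{a..<b}. - scaleC (\<phi> (f j) u) (?t j))" by (intro sum.cong) auto
          also have "\<dots> = - u" by (simp only: sum_negf u1[symmetric])
          finally show ?thesis .
        qed
      qed
      finally have "\<forall>j<b. (if j < a then c j else - \<phi> (f j) u) = 0"
        using f(2)[unfolded indep_tuple_iff, THEN spec[where x = "\<lambda>j. if j < a then c j else - \<phi> (f j) u"]] by simp
      then have "c j = 0" if "j < a" for j using that ab[OF U] by (metis order_less_le_trans)
      then show "u = 0" unfolding c by simp
    qed
    ultimately show ?thesis using U unfolding chart_def gr_chart_def by blast
  qed
  have open_chart: "openin (zar (gr a V)) (chart \<pi>)" for \<pi> unfolding chart_def by (rule open_gr_chart[OF Vs \<phi>(1)])
  show ?thesis
  proof (cases "a \<le> b")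
    case True
    have "\<Union>(chart ` perms) = points (gr a V)"
      using cover unfolding points_gr[OF Vs] by (auto simp: chart_def gr_chart_def)
    moreover have "finite (chart ` perms)"
      unfolding perms_def by (intro finite_imageI finite_subset[OF _ finite_PiE[of "{..<b}" "\<lambda>_. {..<b}"]]) auto
    ultimately show ?thesis
      unfolding covered_by_affine_spaces_def using iso[OF _ True] open_chart
      by (intro exI[of _ "chart ` perms"]) blast
  next
    case False
    then have "points (gr a V) = {}" using ab points_gr[OF Vs] by blast
    then show ?thesis unfolding covered_by_affine_spaces_def by (intro exI[of _ "{}"]) simp
  qed
qed

section \<open>Quiver Grassmannians are varieties\<close>

lemma points_quiver_gr:
  assumes "\<And>v. v \<in> verts Q \<Longrightarrow> complex_vector.subspace (qspace V v)"
  shows "points (quiver_gr Q V f) = {U \<in> PiE (verts Q) (\<lambda>v. gr_points (f v) (qspace V v)).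
          \<forall>r\<in>arcs Q. qmap V r ` U (tail Q r) \<subseteq> U (head Q r)}"
proof -
  have lr: "\<forall>v\<in>verts Q. locally_ringed (gr (f v) (qspace V v))" using locally_ringed_gr by blast
  have "PiE (verts Q) (\<lambda>v. points (gr (f v) (qspace V v))) = PiE (verts Q) (\<lambda>v. gr_points (f v) (qspace V v))"
    by (intro PiE_cong points_gr assms)
  then show ?thesis unfolding quiver_gr_def points_induced points_Prod[OF lr] by auto
qed

lemma locally_ringed_quiver_gr: "locally_ringed (quiver_gr Q V f)"
  unfolding quiver_gr_def using locally_ringed_gr by (intro locally_ringed_induced locally_ringed_Prod) blast

text \<open>A closed subspace of a product of Grassmannians, with one incidence condition for each arrow.\<close>

lemma variety_quiver_gr:
  assumes V: "is_rep Q V" and fin: "finite (verts Q)"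
    and ends: "\<And>r. r \<in> arcs Q \<Longrightarrow> tail Q r \<in> verts Q \<and> head Q r \<in> verts Q"
  shows "variety (quiver_gr Q V f)"
proof -
  let ?X = "\<lambda>v. gr (f v) (qspace V v)"
  let ?P = "Prod_fspace (verts Q) ?X"
  have lr: "\<forall>v\<in>verts Q. locally_ringed (?X v)" using locally_ringed_gr by blast
  note P = locally_ringed_Prod[OF lr]
  have Vv: "fin_dim_subspace (qspace V v)" if "v \<in> verts Q" for v using V that unfolding is_rep_def by blast
  have Pp: "points ?P = PiE (verts Q) (\<lambda>v. gr_points (f v) (qspace V v))"
    unfolding points_Prod[OF lr] by (intro PiE_cong points_gr fin_dim_subspace_subspace Vv)
  have arc: "closedin (zar ?P) {U \<in> points ?P. qmap V r ` U (tail Q r) \<subseteq> U (head Q r)}" if r: "r \<in> arcs Q" for r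
  proof -
    have t: "tail Q r \<in> verts Q" and h: "head Q r \<in> verts Q" using ends[OF r] by auto
    have "clinear_on (qspace V (tail Q r)) (qmap V r)" using V r unfolding is_rep_def by blast
    from clinear_on_extend[OF this fin_dim_subspace_subspace[OF Vv[OF t]]]
    obtain g where g: "clinear g" "\<And>x. x \<in> qspace V (tail Q r) \<Longrightarrow> g x = qmap V r x" by blast
    have "g ` U (tail Q r) = qmap V r ` U (tail Q r)" if "U \<in> points ?P" for U
    proof (rule image_cong[OF refl])
      have "U (tail Q r) \<subseteq> qspace V (tail Q r)" using that t unfolding Pp by (auto simp: gr_points_def dest: PiE_mem)
      then show "g x = qmap V r x" if "x \<in> U (tail Q r)" for x using g(2) that by blast
    qed
    then have eq: "{U \<in> points ?P. qmap V r ` U (tail Q r) \<subseteq> U (head Q r)} =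
        {U \<in> points ?P. g ` U (tail Q r) \<subseteq> U (head Q r)}" by auto
    show ?thesis
      unfolding eq
      by (rule closed_incidence[OF P Vv[OF t] Vv[OF h] morphism_component[OF lr t] morphism_component[OF lr h] g(1)])
  qed
  have "closedin (zar ?P) (\<Inter>(insert (points ?P)
      ((\<lambda>r. {U \<in> points ?P. qmap V r ` U (tail Q r) \<subseteq> U (head Q r)}) ` arcs Q)))"
    using arc by (intro closedin_Inter) auto
  moreover have "\<Inter>(insert (points ?P) ((\<lambda>r. {U \<in> points ?P. qmap V r ` U (tail Q r) \<subseteq> U (head Q r)}) ` arcs Q)) =
      {U \<in> PiE (verts Q) (\<lambda>v. gr_points (f v) (qspace V v)).
          \<forall>r\<in>arcs Q. qmap V r ` U (tail Q r) \<subseteq> U (head Q r)}"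
    unfolding Pp by (rule set_eqI) (simp, blast)
  ultimately show ?thesis
    unfolding quiver_gr_def
    by (intro variety_closed_subspace P covered_by_affine_spaces_Prod fin lr separated_Prod)
      (auto intro: covered_by_affine_spaces_gr separated_gr Vv)
qed

section \<open>Bundles of subspaces between two given ones\<close>

lemma morphism_gr_image:
  assumes Z: "locally_ringed Z" and V: "fin_dim_subspace V" and V': "fin_dim_subspace V'"
    and h: "clinear h" "inj_on h V" "h ` V \<subseteq> V'" and F: "morphism Z (gr a V) F"
  shows "morphism Z (gr a V') (\<lambda>z. h ` F z)"
proof (rule morphism_to_gr[OF Z V'])
  note Vs = fin_dim_subspace_subspace[OF V]
  show "h ` F z \<in> gr_points a V'" if "z \<in> points Z" for z
  proof -
    have Fz: "F z \<in> gr_points a V" using morphism_points[OF F that] points_gr[OF Vs] by simp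
    then have FV: "F z \<subseteq> V" "complex_vector.subspace (F z)" "complex_vector.dim (F z) = a" by (auto simp: gr_points_def)
    have "complex_vector.dim (h ` F z) = a"
      using dim_image_injective[OF h(1) gr_points_fin_dim[OF V Fz] inj_on_subset[OF h(2) FV(1)]] FV(3) by simp
    then show ?thesis
      using complex_pair.linear_subspace_image[OF h(1) FV(2)] FV(1) h(3) unfolding gr_points_def by blast
  qed
  fix z assume z: "z \<in> points Z"
  obtain W s where W: "openin (zar Z) W" "z \<in> W" and s: "\<And>j. j < a \<Longrightarrow> regular_vector Z W (s j)"
    and "\<And>y. y \<in> W \<Longrightarrow> indep_tuple a (\<lambda>j. s j y)"
    and sF: "\<And>y. y \<in> W \<Longrightarrow> frame_span a (\<lambda>j. s j y) = F y"
    by (rule local_frame[OF V Z F z]) (rule that)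
  show "\<exists>W m s. openin (zar Z) W \<and> z \<in> W \<and> (\<forall>k<m. regular_vector Z W (s k)) \<and>
       (\<forall>z\<in>W. h ` F z = frame_span m (\<lambda>k. s k z))"
    using W regular_vector_clinear[OF h(1) s] sF clinear_image_frame_span[OF h(1)]
    by (intro exI[of _ W] exI[of _ a] exI[of _ "\<lambda>k z. h (s k z)"]) metis
qed

lemma dim_preimage:
  assumes V: "fin_dim_subspace V" and h: "clinear h" and U: "complex_vector.subspace U" "U \<subseteq> h ` V"
  shows "complex_vector.subspace {x \<in> V. h x \<in> U}" "h ` {x \<in> V. h x \<in> U} = U"
    "complex_vector.dim {x \<in> V. h x \<in> U} =
       complex_vector.dim U + (complex_vector.dim V - complex_vector.dim (h ` V))"
proof -
  note Vs = fin_dim_subspace_subspace[OF V]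
  show S: "complex_vector.subspace {x \<in> V. h x \<in> U}"
    using Vs U(1) by (intro complex_subspaceI)
      (auto simp: clinear_0[OF h] clinear_add[OF h] clinear_scale[OF h] complex_vector.subspace_0
        complex_vector.subspace_add complex_vector.subspace_scale)
  show im: "h ` {x \<in> V. h x \<in> U} = U" using U(2) by blast
  have "{x \<in> {x \<in> V. h x \<in> U}. h x = 0} = {x \<in> V. h x = 0}"
    using complex_vector.subspace_0[OF U(1)] by auto
  then show "complex_vector.dim {x \<in> V. h x \<in> U} =
       complex_vector.dim U + (complex_vector.dim V - complex_vector.dim (h ` V))"
    using dim_image_kernel[OF h fin_dim_subset[OF V S]] dim_image_kernel[OF h V] im by auto
qed

text \<open>The preimages have constant dimension, as \<open>h\<close> maps onto the ambient space of \<open>F\<close>. They are spanned by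
  a fixed basis of the kernel and the lifts of a local frame of \<open>F\<close> along a linear section \<open>\<sigma>\<close> of \<open>h\<close>.\<close>

lemma morphism_gr_preimage:
  assumes Z: "locally_ringed Z" and V: "fin_dim_subspace V" and h: "clinear h"
    and F: "morphism Z (gr b (h ` V)) F"
  shows "morphism Z (gr (b + (complex_vector.dim V - complex_vector.dim (h ` V))) V) (\<lambda>z. {x \<in> V. h x \<in> F z})"
proof (rule morphism_to_gr[OF Z V])
  note Vs = fin_dim_subspace_subspace[OF V]
  have V': "fin_dim_subspace (h ` V)" by (rule fin_dim_image[OF h V])
  have Fz: "F z \<subseteq> h ` V" "complex_vector.subspace (F z)" "complex_vector.dim (F z) = b" if "z \<in> points Z" for z
    using morphism_points[OF F that] points_gr[OF fin_dim_subspace_subspace[OF V']] by (auto simp: gr_points_def)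
  show "{x \<in> V. h x \<in> F z} \<in> gr_points (b + (complex_vector.dim V - complex_vector.dim (h ` V))) V"
    if "z \<in> points Z" for z
    using dim_preimage[OF V h Fz(2,1)[OF that]] Fz(3)[OF that] unfolding gr_points_def by auto
  fix z assume z: "z \<in> points Z"
  obtain W t where W: "openin (zar Z) W" "z \<in> W" and t: "\<And>j. j < b \<Longrightarrow> regular_vector Z W (t j)"
    and "\<And>y. y \<in> W \<Longrightarrow> indep_tuple b (\<lambda>j. t j y)"
    and tF: "\<And>y. y \<in> W \<Longrightarrow> frame_span b (\<lambda>j. t j y) = F y"
    by (rule local_frame[OF V' Z F z]) (rule that)
  obtain \<sigma> where \<sigma>: "range \<sigma> \<subseteq> V" "clinear \<sigma>" "\<And>v. v \<in> h ` V \<Longrightarrow> h (\<sigma> v) = v"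
    using complex_pair.linear_exists_right_inverse_on[OF h Vs] by blast
  let ?K = "{x \<in> V. h x = 0}"
  have Ks: "complex_vector.subspace ?K"
    using dim_preimage(1)[OF V h, of "{0}"] complex_vector.subspace_0[OF Vs] clinear_0[OF h]
    by (force simp: complex_vector.subspace_single_0)
  obtain \<kappa> where \<kappa>: "frame_span (complex_vector.dim ?K) \<kappa> = ?K" using frame_exists[OF fin_dim_subset[OF V Ks]] by auto
  define p where "p = complex_vector.dim ?K"
  define s where "s = (\<lambda>k y. if k < p then \<kappa> k else \<sigma> (t (k - p) y))"
  have "regular_vector Z W (s k)" if "k < p + b" for k
  proof (cases "k < p")
    case True
    then show ?thesis using regular_vector_const[OF Z W(1)] by (simp add: s_def)
  next
    case False
    then have "k - p < b" using that by simp
    then show ?thesis using False regular_vector_clinear[OF \<sigma>(2) t] by (simp add: s_def)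
  qed
  moreover have "{x \<in> V. h x \<in> F y} = frame_span (p + b) (\<lambda>k. s k y)" if y: "y \<in> W" for y
  proof (rule subset_antisym)
    have yp: "y \<in> points Z" using y openin_subset[OF W(1)] by blast
    have \<kappa>s: "\<kappa> k \<in> frame_span (p + b) (\<lambda>k. s k y)" if "k < p" for k
      using frame_span_superset[of k "p + b" "\<lambda>k. s k y"] that by (simp add: s_def)
    have \<sigma>s: "\<sigma> (t j y) \<in> frame_span (p + b) (\<lambda>k. s k y)" if "j < b" for j
      using frame_span_superset[of "p + j" "p + b" "\<lambda>k. s k y"] that by (simp add: s_def)
    have \<kappa>S: "frame_span p \<kappa> \<subseteq> frame_span (p + b) (\<lambda>k. s k y)"
      by (rule frame_span_minimal[OF subspace_frame_span \<kappa>s])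
    have \<sigma>S: "frame_span b (\<lambda>j. \<sigma> (t j y)) \<subseteq> frame_span (p + b) (\<lambda>k. s k y)"
      by (rule frame_span_minimal[OF subspace_frame_span \<sigma>s])
    show "{x \<in> V. h x \<in> F y} \<subseteq> frame_span (p + b) (\<lambda>k. s k y)"
    proof
      fix x assume x: "x \<in> {x \<in> V. h x \<in> F y}"
      have "h (\<sigma> (h x)) = h x" using x by (intro \<sigma>(3)) auto
      then have "x - \<sigma> (h x) \<in> ?K"
        using x \<sigma>(1) by (auto simp: clinear_diff[OF h] intro!: complex_vector.subspace_diff[OF Vs])
      then have 1: "x - \<sigma> (h x) \<in> frame_span (p + b) (\<lambda>k. s k y)"
        using \<kappa>S \<kappa> unfolding p_def by blast
      have "\<sigma> (h x) \<in> \<sigma> ` frame_span b (\<lambda>j. t j y)" using x unfolding tF[OF y] by blast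
      then have "\<sigma> (h x) \<in> frame_span (p + b) (\<lambda>k. s k y)"
        unfolding clinear_image_frame_span[OF \<sigma>(2)] using \<sigma>S by blast
      from complex_vector.subspace_add[OF subspace_frame_span 1 this]
      show "x \<in> frame_span (p + b) (\<lambda>k. s k y)" by simp
    qed
    show "frame_span (p + b) (\<lambda>k. s k y) \<subseteq> {x \<in> V. h x \<in> F y}"
    proof (rule frame_span_minimal[OF dim_preimage(1)[OF V h Fz(2,1)[OF yp]]])
      fix k assume k: "k < p + b"
      show "s k y \<in> {x \<in> V. h x \<in> F y}"
      proof (cases "k < p")
        case True
        then have "\<kappa> k \<in> ?K" using frame_span_superset[OF True, of \<kappa>] \<kappa> unfolding p_def by simp
        then show ?thesis using True complex_vector.subspace_0[OF Fz(2)[OF yp]] by (simp add: s_def)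
      next
        case False
        then have "t (k - p) y \<in> F y" using frame_span_superset[of "k - p" b "\<lambda>j. t j y"] tF[OF y] k by simp
        then show ?thesis using False \<sigma>(1,3) Fz(1)[OF yp] by (auto simp: s_def)
      qed
    qed
  qed
  ultimately show "\<exists>W m s. openin (zar Z) W \<and> z \<in> W \<and> (\<forall>k<m. regular_vector Z W (s k)) \<and>
       (\<forall>z\<in>W. {x \<in> V. h x \<in> F z} = frame_span m (\<lambda>k. s k z))"
    using W by (intro exI[of _ W] exI[of _ "p + b"] exI[of _ s]) auto
qed

text \<open>Extend a basis of \<open>A y\<close> to one of \<open>B y\<close> by members of a frame of \<open>B\<close>. The corresponding sections remain
  independent near \<open>y\<close>, and the dimensions of \<open>A\<close> and \<open>B\<close> determine the spans.\<close>

lemma local_flag_frame: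
  assumes Y: "locally_ringed Y" and V: "fin_dim_subspace V"
    and A: "morphism Y (gr p V) A" and B: "morphism Y (gr q V) B" and AB: "\<And>y. y \<in> points Y \<Longrightarrow> A y \<subseteq> B y"
    and y: "y \<in> points Y"
  obtains W v where "openin (zar Y) W" "y \<in> W" "\<And>j. j < q \<Longrightarrow> regular_vector Y W (v j)"
    "\<And>y. y \<in> W \<Longrightarrow> indep_tuple q (\<lambda>j. v j y)" "\<And>y. y \<in> W \<Longrightarrow> frame_span p (\<lambda>j. v j y) = A y"
    "\<And>y. y \<in> W \<Longrightarrow> frame_span q (\<lambda>j. v j y) = B y"
proof -
  note Vs = fin_dim_subspace_subspace[OF V]
  obtain W s where W: "openin (zar Y) W" "y \<in> W" and s: "\<And>j. j < p \<Longrightarrow> regular_vector Y W (s j)"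
    and sA: "\<And>y. y \<in> W \<Longrightarrow> indep_tuple p (\<lambda>j. s j y)" "\<And>y. y \<in> W \<Longrightarrow> frame_span p (\<lambda>j. s j y) = A y"
    by (rule local_frame[OF V Y A y]) (rule that)
  obtain W' t where W': "openin (zar Y) W'" "y \<in> W'" and t: "\<And>j. j < q \<Longrightarrow> regular_vector Y W' (t j)"
    and tB: "\<And>y. y \<in> W' \<Longrightarrow> indep_tuple q (\<lambda>j. t j y)" "\<And>y. y \<in> W' \<Longrightarrow> frame_span q (\<lambda>j. t j y) = B y"
    by (rule local_frame[OF V Y B y]) (rule that)
  have Bfin: "fin_dim_subspace (B y)" "complex_vector.dim (B y) = q" if "y \<in> W'" for y
    using dim_frame_span[OF tB(1)[OF that]] fin_dim_frame_span[of q "\<lambda>j. t j y"] tB(2)[OF that] by simp_all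
  have sB: "s j y \<in> B y" if "y \<in> W" "j < p" for j y
    using frame_span_superset[OF that(2), of "\<lambda>j. s j y"] sA(2)[OF that(1)] AB[of y] that(1) openin_subset[OF W(1)] by blast
  have tB': "t k y \<in> B y" if "y \<in> W'" "k < q" for k y
    using frame_span_superset[OF that(2), of "\<lambda>j. t j y"] tB(2)[OF that(1)] by simp
  have sp: "B y \<subseteq> complex_vector.span ((\<lambda>k. t k y) ` {..<q})" using tB(2)[OF W'(2)] by (simp add: frame_span_def)
  obtain f where f: "\<And>j. p \<le> j \<Longrightarrow> j < q \<Longrightarrow> f j < q"
    "indep_tuple q (\<lambda>j. if j < p then s j y else t (f j) y)"
    using extend_to_basis[OF Bfin(1)[OF W'(2)] sA(1)[OF W(2)] sB[OF W(2)], where T = "{..<q}" and t = "\<lambda>k. t k y"]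
      sp tB'[OF W'(2)] unfolding Bfin(2)[OF W'(2)] by auto
  define v where "v = (\<lambda>j y. if j < p then s j y else t (f j) y)"
  have WW: "openin (zar Y) (W \<inter> W')" "y \<in> W \<inter> W'" using W W' by auto
  have v: "regular_vector Y (W \<inter> W') (v j)" if "j < q" for j
  proof (cases "j < p")
    case True
    then show ?thesis using regular_vector_restrict[OF Y s W(1) WW(1)] unfolding v_def by simp
  next
    case False
    then have "f j < q" using f(1) that by simp
    then show ?thesis using False regular_vector_restrict[OF Y t W'(1) WW(1)] unfolding v_def by simp
  qed
  have "indep_tuple q (\<lambda>j. v j y)" using f(2) by (simp add: v_def)
  from local_independence[where s = v, OF Y WW v this]
  obtain N where N: "openin (zar Y) N" "y \<in> N" "N \<subseteq> W \<inter> W'" "\<And>y. y \<in> N \<Longrightarrow> indep_tuple q (\<lambda>j. v j y)" by blast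
  have spanB: "frame_span q (\<lambda>j. v j y) = B y" if y: "y \<in> N" for y
  proof -
    have y': "y \<in> W" "y \<in> W'" using y N(3) by auto
    have "v j y \<in> B y" if "j < q" for j
      using sB[OF y'(1)] tB'[OF y'(2)] f(1)[of j] that by (auto simp: v_def)
    then show ?thesis using frame_span_eq[OF Bfin(1)[OF y'(2)], of "\<lambda>j. v j y"] N(4)[OF y] Bfin(2)[OF y'(2)] by simp
  qed
  have spanA: "frame_span p (\<lambda>j. v j y) = A y" if "y \<in> N" for y
    using frame_span_cong[of p "\<lambda>j. v j y" "\<lambda>j. s j y"] sA(2)[of y] that N(3) by (auto simp: v_def)
  have vN: "regular_vector Y N (v j)" if "j < q" for j by (rule regular_vector_restrict[OF Y v[OF that] WW(1) N(1,3)])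
  show thesis by (rule that[OF N(1,2) vN N(4) spanA spanB])
qed

text \<open>Near each point the coefficients are the values of a regular family of dual functionals at \<open>x\<close>.\<close>

lemma regular_coordinates:
  assumes Z: "locally_ringed Z" "openin (zar Z) W"
    and v: "\<And>j. j < q \<Longrightarrow> regular_vector Z W (v j)" "\<And>z. z \<in> W \<Longrightarrow> indep_tuple q (\<lambda>j. v j z)"
    and x: "regular_vector Z W x" "\<And>z. z \<in> W \<Longrightarrow> x z = (\<Sum>j<q. scaleC (c j z) (v j z))" and i: "i < q"
  shows "c i \<in> reg_fun Z W"
proof (rule reg_glue[OF Z])
  fix z0 assume z0: "z0 \<in> W"
  obtain W' \<phi> where W': "openin (zar Z) W'" "z0 \<in> W'" "W' \<subseteq> W"
    and \<phi>: "\<And>i. i < q \<Longrightarrow> regular_functional Z W' (\<phi> i)"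
    and dual: "\<And>z i j. z \<in> W' \<Longrightarrow> i < q \<Longrightarrow> j < q \<Longrightarrow> \<phi> i z (v j z) = (if i = j then 1 else 0)"
    by (rule local_dualE[where s = v, OF Z z0 v(1) v(2)[OF z0]]) (assumption, rule that)
  have reg: "(\<lambda>z. \<phi> i z (x z)) \<in> reg_fun Z W'"
    by (rule regular_functionalD[OF \<phi>[OF i] W'(1) subset_refl regular_vector_restrict[OF Z(1) x(1) Z(2) W'(1,3)]])
  have "c i z = \<phi> i z (x z)" if z: "z \<in> W'" for z
  proof -
    have lin: "clinear (\<phi> i z)" by (rule regular_functional_clinear[OF \<phi>[OF i] z])
    have "\<phi> i z (x z) = (\<Sum>j<q. c j z * \<phi> i z (v j z))"
      using x(2)[of z] z W'(3) by (auto simp: clinear_combination[OF lin])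
    also have "\<dots> = (\<Sum>j<q. if i = j then c j z else 0)" using dual[OF z i] by (intro sum.cong) auto
    finally show ?thesis using i by simp
  qed
  then show "\<exists>W' g. openin (zar Z) W' \<and> z0 \<in> W' \<and> W' \<subseteq> W \<and> g \<in> reg_fun Z W' \<and> (\<forall>y\<in>W'. c i y = g y)"
    using W' reg by blast
qed

text \<open>For functionals dual to a \<open>q\<close>-tuple, the coordinates on the quotient of its span by the span of
  the first \<open>p\<close> members.\<close>

definition quotient_map :: "nat \<Rightarrow> nat \<Rightarrow> (nat \<Rightarrow> 'v::complex_vector \<Rightarrow> complex) \<Rightarrow> 'v \<Rightarrow> nat \<Rightarrow> complex" where
  "quotient_map p q \<phi> = functional_map (q - p) (\<lambda>j. \<phi> (p + j))"

lemma quotient_map: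
  assumes \<phi>: "\<And>i. clinear (\<phi> i)" and dual: "\<And>i j. i < q \<Longrightarrow> j < q \<Longrightarrow> \<phi> i (v j) = (if i = j then 1 else (0::complex))"
    and pq: "p \<le> q"
  shows "clinear (quotient_map p q \<phi>)"
    and "{u \<in> frame_span q v. quotient_map p q \<phi> u = 0} = frame_span p v"
    and "quotient_map p q \<phi> ` frame_span q v = coord_space (q - p)"
    and "\<And>x. x \<in> coord_space (q - p) \<Longrightarrow> quotient_map p q \<phi> (\<Sum>j<q-p. scaleC (x j) (v (p + j))) = x"
proof -
  show lin: "clinear (quotient_map p q \<phi>)" unfolding quotient_map_def by (rule clinear_functional_map) (rule \<phi>)
  have expand: "u = (\<Sum>j<p. scaleC (\<phi> j u) (v j)) + (\<Sum>j<q-p. scaleC (\<phi> (p + j) u) (v (p + j)))"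
    if "u \<in> frame_span q v" for u
    using dual_coordinates[of q \<phi> v u, OF \<phi> dual that] unfolding sum_split_at[OF pq] by simp
  have sub: "frame_span p v \<subseteq> frame_span q v"
    using pq by (intro frame_span_minimal subspace_frame_span frame_span_superset) simp
  show "{u \<in> frame_span q v. quotient_map p q \<phi> u = 0} = frame_span p v"
  proof (intro equalityI subsetI)
    fix u assume u: "u \<in> {u \<in> frame_span q v. quotient_map p q \<phi> u = 0}"
    then have "\<phi> (p + j) u = 0" if "j < q - p" for j
      using that by (simp add: quotient_map_def functional_map_eq_0)
    then have "u = (\<Sum>j<p. scaleC (\<phi> j u) (v j))" using expand[of u] u by simp
    then show "u \<in> frame_span p v" unfolding frame_span_iff by (rule exI[of _ "\<lambda>j. \<phi> j u"])
  next
    fix u assume u: "u \<in> frame_span p v"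
    have "\<phi> (p + j) u = 0" if j: "j < q - p" for j
    proof -
      obtain c where c: "u = (\<Sum>j<p. scaleC (c j) (v j))" using u unfolding frame_span_iff by blast
      show ?thesis
        unfolding c clinear_combination[OF \<phi>] using dual[of "p + j"] j pq by (intro sum.neutral) auto
    qed
    then show "u \<in> {u \<in> frame_span q v. quotient_map p q \<phi> u = 0}"
      using u sub by (auto simp: quotient_map_def functional_map_eq_0)
  qed
  show lift: "quotient_map p q \<phi> (\<Sum>j<q-p. scaleC (x j) (v (p + j))) = x" if x: "x \<in> coord_space (q - p)" for x
  proof
    fix k
    have "\<phi> (p + k) (\<Sum>j<q-p. scaleC (x j) (v (p + j))) = x k" if "k < q - p"
    proof -
      have "\<phi> (p + k) (\<Sum>j<q-p. scaleC (x j) (v (p + j))) = (\<Sum>j<q-p. if k = j then x j else 0)"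
        unfolding clinear_combination[OF \<phi>] using dual that by (intro sum.cong) auto
      then show ?thesis using that by simp
    qed
    then show "quotient_map p q \<phi> (\<Sum>j<q-p. scaleC (x j) (v (p + j))) k = x k"
      using x by (auto simp: quotient_map_def functional_map_def coord_space_def)
  qed
  show "quotient_map p q \<phi> ` frame_span q v = coord_space (q - p)"
  proof (intro equalityI subsetI)
    fix x assume x: "x \<in> coord_space (q - p)"
    have "(\<Sum>j<q-p. scaleC (x j) (v (p + j))) \<in> frame_span q v"
      by (intro subspace_combination subspace_frame_span frame_span_superset) auto
    then show "x \<in> quotient_map p q \<phi> ` frame_span q v" 
      by (rule image_eqI[where f = "quotient_map p q \<phi>", OF lift[OF x, symmetric]])
  qed (auto simp: quotient_map_def functional_map_in_coord_space)
qed

lemma dim_quotient_map: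
  assumes \<phi>: "\<And>i. clinear (\<phi> i)" and dual: "\<And>i j. i < q \<Longrightarrow> j < q \<Longrightarrow> \<phi> i (v j) = (if i = j then 1 else (0::complex))"
    and pq: "p \<le> q" and U: "complex_vector.subspace U" "U \<subseteq> frame_span q v" "frame_span p v \<subseteq> U"
  shows "complex_vector.dim U = p + complex_vector.dim (quotient_map p q \<phi> ` U)"
proof -
  have ind: "indep_tuple q v" by (rule indep_tuple_if_dual[of q \<phi>]) (use \<phi> dual in auto)
  have indp: "indep_tuple p v"
    by (rule indep_tuple_if_dual[of p \<phi>]) (use \<phi> dual pq in auto)
  have "{u \<in> U. quotient_map p q \<phi> u = 0} = frame_span p v"
    using quotient_map(2)[of \<phi> q v p, OF \<phi> dual pq] U by blast
  then show ?thesis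
    using dim_image_kernel[OF quotient_map(1)[of \<phi> q v p, OF \<phi> dual pq] fin_dim_subset[OF fin_dim_frame_span U(1,2)]]
      dim_frame_span[OF indp] by simp
qed

text \<open>The fibre of \<open>P\<close> over \<open>y\<close> consists of the tuples of subspaces \<open>U\<^sub>i\<close> of dimension \<open>a\<^sub>i\<close> with
  \<open>A\<^sub>i(y) \<subseteq> U\<^sub>i \<subseteq> B\<^sub>i(y)\<close>: the morphisms \<open>u\<^sub>i\<close> read off its members, and \<open>mk y U\<close> is the point with
  given projection and members. The last hypothesis says that \<open>mk\<close> is algebraic in families; the type
  of \<open>Z\<close> is that of the product of an open subset of \<open>Y\<close> with the fibre, on which the inverse of the
  trivialisation is defined.

  A regular flag of bases over an open set identifies all the quotients \<open>B\<^sub>i(y) / A\<^sub>i(y)\<close> with one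
  coordinate space, and \<open>U\<^sub>i\<close> corresponds to \<open>U\<^sub>i / A\<^sub>i(y)\<close>. Both directions are morphisms because they
  are given by regular spanning families of constant rank: the images of a frame of \<open>U\<^sub>i\<close> in the
  coordinate space, and, conversely, the basis of \<open>A\<^sub>i(y)\<close> together with lifts of a frame in
  that space.\<close>

lemma fibration_of_intermediate_subspaces:
  fixes X :: "'x fspace" and Y :: "'y fspace" and r :: nat and V :: "nat \<Rightarrow> 'v::complex_vector set"
    and mk :: "'y \<Rightarrow> (nat \<Rightarrow> 'v set) \<Rightarrow> 'x"
  assumes X: "locally_ringed X" and Y: "locally_ringed Y" and P: "morphism X Y P"
    and V: "\<And>i. i < r \<Longrightarrow> fin_dim_subspace (V i)"
    and A: "\<And>i. i < r \<Longrightarrow> morphism Y (gr (p i) (V i)) (A i)"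
    and B: "\<And>i. i < r \<Longrightarrow> morphism Y (gr (q i) (V i)) (B i)"
    and AB: "\<And>i y. i < r \<Longrightarrow> y \<in> points Y \<Longrightarrow> A i y \<subseteq> B i y"
    and pa: "\<And>i. i < r \<Longrightarrow> p i \<le> a i" and aq: "\<And>i. i < r \<Longrightarrow> a i \<le> q i"
    and u: "\<And>i. i < r \<Longrightarrow> morphism X (gr (a i) (V i)) (u i)"
    and AuB: "\<And>i x. i < r \<Longrightarrow> x \<in> points X \<Longrightarrow> A i (P x) \<subseteq> u i x \<and> u i x \<subseteq> B i (P x)"
    and P_mk: "\<And>y U. y \<in> points Y \<Longrightarrow> (\<And>i. i < r \<Longrightarrow> U i \<in> gr_points (a i) (V i) \<and> A i y \<subseteq> U i \<and> U i \<subseteq> B i y) \<Longrightarrow>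
        P (mk y U) = y"
    and u_mk: "\<And>y U i. y \<in> points Y \<Longrightarrow> (\<And>i. i < r \<Longrightarrow> U i \<in> gr_points (a i) (V i) \<and> A i y \<subseteq> U i \<and> U i \<subseteq> B i y) \<Longrightarrow>
        i < r \<Longrightarrow> u i (mk y U) = U i"
    and mk_eq: "\<And>x U. x \<in> points X \<Longrightarrow> (\<And>i. i < r \<Longrightarrow> U i = u i x) \<Longrightarrow> mk (P x) U = x"
    and mk: "\<And>(Z :: ('y \<times> (nat \<Rightarrow> (nat \<Rightarrow> complex) set)) fspace) f g. locally_ringed Z \<Longrightarrow> morphism Z Y f \<Longrightarrow>
        (\<And>i. i < r \<Longrightarrow> morphism Z (gr (a i) (V i)) (\<lambda>z. g z i)) \<Longrightarrow>
        (\<And>z i. z \<in> points Z \<Longrightarrow> i < r \<Longrightarrow> A i (f z) \<subseteq> g z i \<and> g z i \<subseteq> B i (f z)) \<Longrightarrow>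
        morphism Z X (\<lambda>z. mk (f z) (g z))"
  shows "fibration X Y P (Prod_fspace {..<r} (\<lambda>i. gr (a i - p i) (coord_space (q i - p i))))"
  unfolding fibration_def
proof (intro conjI ballI)
  show "morphism X Y P" by (rule P)
  fix y0 assume y0: "y0 \<in> points Y"
  have "\<forall>i\<in>{..<r}. \<exists>Wv. openin (zar Y) (fst Wv) \<and> y0 \<in> fst Wv \<and> (\<forall>j<q i. regular_vector Y (fst Wv) (snd Wv j)) \<and>
      (\<forall>y\<in>fst Wv. indep_tuple (q i) (\<lambda>j. snd Wv j y) \<and> frame_span (p i) (\<lambda>j. snd Wv j y) = A i y \<and>
        frame_span (q i) (\<lambda>j. snd Wv j y) = B i y)"
  proof
    fix i assume "i \<in> {..<r}"
    then have i: "i < r" by simp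
    obtain W v where "openin (zar Y) W" "y0 \<in> W" "\<And>j. j < q i \<Longrightarrow> regular_vector Y W (v j)"
      "\<And>y. y \<in> W \<Longrightarrow> indep_tuple (q i) (\<lambda>j. v j y)" "\<And>y. y \<in> W \<Longrightarrow> frame_span (p i) (\<lambda>j. v j y) = A i y"
      "\<And>y. y \<in> W \<Longrightarrow> frame_span (q i) (\<lambda>j. v j y) = B i y"
      by (rule local_flag_frame[OF Y V[OF i] A[OF i] B[OF i] AB[OF i] y0]) (assumption, rule that)
    then show "\<exists>Wv. openin (zar Y) (fst Wv) \<and> y0 \<in> fst Wv \<and> (\<forall>j<q i. regular_vector Y (fst Wv) (snd Wv j)) \<and>
      (\<forall>y\<in>fst Wv. indep_tuple (q i) (\<lambda>j. snd Wv j y) \<and> frame_span (p i) (\<lambda>j. snd Wv j y) = A i y \<and>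
        frame_span (q i) (\<lambda>j. snd Wv j y) = B i y)"
      by (intro exI[of _ "(W, v)"]) simp
  qed
  from bchoice[OF this] obtain Wv where Wv: "\<forall>i\<in>{..<r}. openin (zar Y) (fst (Wv i)) \<and> y0 \<in> fst (Wv i) \<and>
      (\<forall>j<q i. regular_vector Y (fst (Wv i)) (snd (Wv i) j)) \<and>
      (\<forall>y\<in>fst (Wv i). indep_tuple (q i) (\<lambda>j. snd (Wv i) j y) \<and> frame_span (p i) (\<lambda>j. snd (Wv i) j y) = A i y \<and>
        frame_span (q i) (\<lambda>j. snd (Wv i) j y) = B i y)" by (elim exE)
  define v where "v = (\<lambda>i. snd (Wv i))"
  define N where "N = points Y \<inter> (\<Inter>i\<in>{..<r}. fst (Wv i))"
  have "openin (zar Y) N"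
    unfolding N_def using Wv by (cases "r = 0") (auto intro!: openin_Int openin_INT2)
  moreover have "y0 \<in> N" "N \<subseteq> points Y" using Wv y0 unfolding N_def by auto
  ultimately have N: "openin (zar Y) N" "y0 \<in> N" "N \<subseteq> points Y" by blast+
  have vreg: "regular_vector Y N (v i j)" if "i < r" "j < q i" for i j
  proof (rule regular_vector_restrict[OF Y _ _ N(1)])
    show "regular_vector Y (fst (Wv i)) (v i j)" "openin (zar Y) (fst (Wv i))" "N \<subseteq> fst (Wv i)"
      using Wv that unfolding v_def N_def by auto
  qed
  have vind: "indep_tuple (q i) (\<lambda>j. v i j y)" and vA: "frame_span (p i) (\<lambda>j. v i j y) = A i y"
    and vB: "frame_span (q i) (\<lambda>j. v i j y) = B i y" if "i < r" "y \<in> N" for i y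
    using Wv that unfolding v_def N_def by auto
  have "\<forall>iy\<in>{..<r} \<times> N. \<exists>\<phi>. (\<forall>k. clinear (\<phi> k)) \<and>
      (\<forall>k<q (fst iy). \<forall>j<q (fst iy). \<phi> k (v (fst iy) j (snd iy)) = (if k = j then 1 else (0::complex)))"
    using vind by (intro ballI indep_tuple_dual) auto
  from bchoice[OF this] obtain \<Phi> where \<Phi>: "\<forall>iy\<in>{..<r} \<times> N. (\<forall>k. clinear (\<Phi> iy k)) \<and>
      (\<forall>k<q (fst iy). \<forall>j<q (fst iy). \<Phi> iy k (v (fst iy) j (snd iy)) = (if k = j then 1 else (0::complex)))"
    by (elim exE)
  have lin: "clinear (\<Phi> (i, y) k)" if "i < r" "y \<in> N" for i y k using \<Phi> that by auto
  have dual: "\<Phi> (i, y) k (v i j y) = (if k = j then 1 else 0)" if "i < r" "y \<in> N" "k < q i" "j < q i" for i y k j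
    using \<Phi> that by auto
  define \<pi> where "\<pi> = (\<lambda>i y. quotient_map (p i) (q i) (\<Phi> (i, y)))"
  have pq: "p i \<le> q i" if "i < r" for i using pa[OF that] aq[OF that] by simp
  have \<pi>lin: "clinear (\<pi> i y)" and \<pi>ker: "{w \<in> B i y. \<pi> i y w = 0} = A i y"
    and \<pi>im: "\<pi> i y ` B i y = coord_space (q i - p i)"
    and \<pi>lift: "\<And>x. x \<in> coord_space (q i - p i) \<Longrightarrow> \<pi> i y (\<Sum>j<q i - p i. scaleC (x j) (v i (p i + j) y)) = x"
    if iy: "i < r" "y \<in> N" for i y
    using quotient_map[of "\<Phi> (i, y)" "q i" "\<lambda>j. v i j y" "p i", OF lin[OF iy] dual[OF iy] pq[OF iy(1)]]
    unfolding \<pi>_def vA[OF iy] vB[OF iy] by blast+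
  have \<pi>dim: "complex_vector.dim U = p i + complex_vector.dim (\<pi> i y ` U)"
    if iy: "i < r" "y \<in> N" and "complex_vector.subspace U" "U \<subseteq> B i y" "A i y \<subseteq> U" for i y U
    using dim_quotient_map[of "\<Phi> (i, y)" "q i" "\<lambda>j. v i j y" "p i", OF lin[OF iy] dual[OF iy] pq[OF iy(1)]] that(3-)
    unfolding \<pi>_def vA[OF iy] vB[OF iy] by blast
  have Bsub: "complex_vector.subspace (B i y)" "fin_dim_subspace (B i y)" and Asub: "complex_vector.subspace (A i y)"
    and BV: "B i y \<subseteq> V i"
    if iy: "i < r" "y \<in> N" for i y
  proof -
    show "complex_vector.subspace (B i y)" "fin_dim_subspace (B i y)" "complex_vector.subspace (A i y)"
      unfolding vB[OF iy, symmetric] vA[OF iy, symmetric] by (rule subspace_frame_span fin_dim_frame_span)+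
    have "y \<in> points Y" using iy(2) N(3) by blast
    from morphism_points[OF B[OF iy(1)] this] show "B i y \<subseteq> V i"
      unfolding points_gr[OF fin_dim_subspace_subspace[OF V[OF iy(1)]]] gr_points_def by blast
  qed
  let ?XN = "induced X {x \<in> points X. P x \<in> N}"
  let ?YN = "induced Y N"
  let ?G = "\<lambda>i. gr (a i - p i) (coord_space (q i - p i))"
  let ?F = "Prod_fspace {..<r} ?G"
  let ?Z = "prod_fspace ?YN ?F"
  have lrG: "\<forall>i\<in>{..<r}. locally_ringed (?G i)" using locally_ringed_gr by blast
  note lrF = locally_ringed_Prod[OF lrG] and lrYN = locally_ringed_induced[OF Y, of N]
    and lrXN = locally_ringed_induced[OF X, of "{x \<in> points X. P x \<in> N}"]
  note lrZ = locally_ringed_prod[OF lrYN lrF]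
  note C = fin_dim_coord_space and Cs = fin_dim_subspace_subspace[OF fin_dim_coord_space]
  have Zp: "points ?Z = N \<times> PiE {..<r} (\<lambda>i. gr_points (a i - p i) (coord_space (q i - p i)))"
    unfolding points_prod[OF lrYN lrF] points_Prod[OF lrG] using N(3) by (auto simp: points_gr[OF Cs])
  have XNp: "points ?XN = {x \<in> points X. P x \<in> N}" by auto
  have up: "u i x \<in> gr_points (a i) (V i)" if "i < r" "x \<in> points X" for i x
    using morphism_points[OF u[OF that(1)] that(2)] points_gr[OF fin_dim_subspace_subspace[OF V[OF that(1)]]] by simp
  have \<pi>u: "\<pi> i (P x) ` u i x \<in> gr_points (a i - p i) (coord_space (q i - p i))" if i: "i < r" and x: "x \<in> points ?XN" for i x
  proof -
    have x': "x \<in> points X" "P x \<in> N" using x by auto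
    have us: "complex_vector.subspace (u i x)" "complex_vector.dim (u i x) = a i"
      using up[OF i x'(1)] by (auto simp: gr_points_def)
    note AuB' = AuB[OF i x'(1)]
    have "complex_vector.dim (\<pi> i (P x) ` u i x) = a i - p i"
      using \<pi>dim[OF i x'(2) us(1)] AuB' us(2) by simp
    moreover have "\<pi> i (P x) ` u i x \<subseteq> coord_space (q i - p i)" using \<pi>im[OF i x'(2)] AuB' by blast
    ultimately show ?thesis
      using complex_pair.linear_subspace_image[OF \<pi>lin[OF i x'(2)] us(1)] by (simp add: gr_points_def)
  qed
  \<comment> \<open>the subspace between \<open>A i y\<close> and \<open>B i y\<close> with given image \<open>W\<close> in the quotient\<close>
  define L where "L = (\<lambda>i y W. {w \<in> B i y. \<pi> i y w \<in> (W :: (nat \<Rightarrow> complex) set)})"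
  have L: "L i y W \<in> gr_points (a i) (V i)" "A i y \<subseteq> L i y W" "L i y W \<subseteq> B i y" "\<pi> i y ` L i y W = W"
    if iy: "i < r" "y \<in> N" and W: "W \<in> gr_points (a i - p i) (coord_space (q i - p i))" for i y W
  proof -
    have W': "complex_vector.subspace W" "W \<subseteq> \<pi> i y ` B i y" "complex_vector.dim W = a i - p i"
      using W \<pi>im[OF iy] by (auto simp: gr_points_def)
    note pre = dim_preimage[OF Bsub(2)[OF iy] \<pi>lin[OF iy] W'(1,2), folded L_def]
    show LB: "L i y W \<subseteq> B i y" by (auto simp: L_def)
    show AL: "A i y \<subseteq> L i y W"
      unfolding \<pi>ker[OF iy, symmetric] L_def using complex_vector.subspace_0[OF W'(1)] by auto
    show im: "\<pi> i y ` L i y W = W" using pre(2) unfolding L_def .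
    have "complex_vector.subspace (L i y W)" using pre(1) unfolding L_def .
    moreover from \<pi>dim[OF iy this LB AL] have "complex_vector.dim (L i y W) = a i"
      using im W'(3) pa[OF iy(1)] by simp
    ultimately show "L i y W \<in> gr_points (a i) (V i)" using LB BV[OF iy] by (auto simp: gr_points_def)
  qed
  let ?f = "\<lambda>x. (P x, \<lambda>i\<in>{..<r}. \<pi> i (P x) ` u i x)"
  let ?g = "\<lambda>z. mk (fst z) (\<lambda>i. L i (fst z) (snd z i))"
  have "isomorphism ?XN ?Z ?f"
  proof (rule isomorphismI[where \<psi> = ?g])
    show "morphism ?XN ?Z ?f"
    proof (rule morphism_to_prod[OF lrXN lrYN lrF])
      show PN: "morphism ?XN ?YN P"
        by (rule morphism_to_induced[OF lrXN morphism_from_induced[OF X P]]) auto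
      show "morphism ?XN ?F (\<lambda>x. \<lambda>i\<in>{..<r}. \<pi> i (P x) ` u i x)"
      proof (rule morphism_to_Prod[OF lrXN _ lrG])
        fix i assume "i \<in> {..<r}"
        then have i: "i < r" by simp
        note uN = morphism_from_induced[OF X u[OF i], of "{x \<in> points X. P x \<in> N}"]
        have "morphism ?XN (?G i) (\<lambda>x. \<pi> i (P x) ` u i x)"
        proof (rule morphism_to_gr[OF lrXN C \<pi>u[OF i]])
          fix x0 assume x0: "x0 \<in> points ?XN"
          obtain W s where W: "openin (zar ?XN) W" "x0 \<in> W" and s: "\<And>j. j < a i \<Longrightarrow> regular_vector ?XN W (s j)"
            and "\<And>x. x \<in> W \<Longrightarrow> indep_tuple (a i) (\<lambda>j. s j x)"
            and su: "\<And>x. x \<in> W \<Longrightarrow> frame_span (a i) (\<lambda>j. s j x) = u i x"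
            by (rule local_frame[OF V[OF i] lrXN uN x0]) (rule that)
          have Wp: "x \<in> points X" "P x \<in> N" if "x \<in> W" for x using openin_subset[OF W(1)] that by auto
          have sB: "s j x \<in> B i (P x)" if "x \<in> W" "j < a i" for x j
            using frame_span_superset[OF that(2), of "\<lambda>j. s j x"] su[OF that(1)] AuB[OF i Wp(1)[OF that(1)]] by blast
          have "regular_vector ?XN W (\<lambda>x. \<pi> i (P x) (s j x))" if j: "j < a i" for j
          proof (rule regular_vector_coordinates[OF lrXN W(1), where d = "q i - p i"])
            show "\<pi> i (P x) (s j x) \<in> coord_space (q i - p i)" if "x \<in> W" for x
              using \<pi>im[OF i Wp(2)[OF that]] sB[OF that j] by blast
            fix k assume k: "k < q i - p i"
            \<comment> \<open>\<open>\<Phi>\<close> was chosen pointwise, but on the span of the basis its values are the coordinates,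
              which are regular\<close>
            have "(\<lambda>x. \<Phi> (i, P x) (p i + k) (s j x)) \<in> reg_fun ?XN W"
            proof (rule regular_coordinates[OF lrXN W(1) _ _ s[OF j], where v = "\<lambda>l x. v i l (P x)" and q = "q i"
                  and c = "\<lambda>k x. \<Phi> (i, P x) k (s j x)"])
              show "regular_vector ?XN W (\<lambda>x. v i l (P x))" if "l < q i" for l
                by (rule regular_vector_pullback[OF lrXN morphism_from_induced[OF X P] N(1) vreg[OF i that] W(1) Wp(2)])
              show "indep_tuple (q i) (\<lambda>j. v i j (P x))" if "x \<in> W" for x by (rule vind[OF i Wp(2)[OF that]])
              show "s j x = (\<Sum>l<q i. scaleC (\<Phi> (i, P x) l (s j x)) (v i l (P x)))" if "x \<in> W" for x
                by (rule dual_coordinates[of "q i" "\<Phi> (i, P x)" "\<lambda>l. v i l (P x)"])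
                  (use lin[OF i Wp(2)[OF that]] dual[OF i Wp(2)[OF that]] sB[OF that j] vB[OF i Wp(2)[OF that]] in auto)
              show "p i + k < q i" using k by simp
            qed
            then show "(\<lambda>x. \<pi> i (P x) (s j x) k) \<in> reg_fun ?XN W"
              using k by (simp add: \<pi>_def quotient_map_def functional_map_def)
          qed
          moreover have "\<pi> i (P x) ` u i x = frame_span (a i) (\<lambda>j. \<pi> i (P x) (s j x))" if "x \<in> W" for x
            using clinear_image_frame_span[OF \<pi>lin[OF i Wp(2)[OF that]], of "a i" "\<lambda>j. s j x"] su[OF that] by simp
          ultimately show "\<exists>W m s. openin (zar ?XN) W \<and> x0 \<in> W \<and> (\<forall>k<m. regular_vector ?XN W (s k)) \<and>
              (\<forall>x\<in>W. \<pi> i (P x) ` u i x = frame_span m (\<lambda>k. s k x))"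
            using W by (intro exI[of _ W] exI[of _ "a i"] exI[of _ "\<lambda>j x. \<pi> i (P x) (s j x)"]) auto
        qed
        then show "morphism ?XN (?G i) (\<lambda>x. (\<lambda>i\<in>{..<r}. \<pi> i (P x) ` u i x) i)" using i by simp
      qed auto
    qed
    have fstZ: "morphism ?Z Y fst" by (rule morphism_compose[OF morphism_fst[OF lrYN lrF] morphism_inclusion[OF Y]])
    have Wp: "snd z i \<in> gr_points (a i - p i) (coord_space (q i - p i))" "fst z \<in> N" if "z \<in> points ?Z" "i < r" for z i
      using that unfolding Zp by auto
    have gX: "morphism ?Z X ?g"
    proof (rule mk[OF lrZ fstZ])
      show "A i (fst z) \<subseteq> L i (fst z) (snd z i) \<and> L i (fst z) (snd z i) \<subseteq> B i (fst z)"
        if "z \<in> points ?Z" "i < r" for z i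
        using L(2,3)[OF that(2) Wp(2,1)[OF that]] by blast
      fix i assume i: "i < r"
      have sndZ: "morphism ?Z (?G i) (\<lambda>z. snd z i)"
        by (rule morphism_compose[OF morphism_snd[OF lrYN lrF] morphism_component[OF lrG]]) (use i in simp)
      show "morphism ?Z (gr (a i) (V i)) (\<lambda>z. L i (fst z) (snd z i))"
      proof (rule morphism_to_gr[OF lrZ V[OF i]])
        show "L i (fst z) (snd z i) \<in> gr_points (a i) (V i)" if "z \<in> points ?Z" for z
          by (rule L(1)[OF i Wp(2,1)[OF that i]])
        fix z0 assume z0: "z0 \<in> points ?Z"
        obtain W w where W: "openin (zar ?Z) W" "z0 \<in> W"
          and w: "\<And>k. k < a i - p i \<Longrightarrow> regular_vector ?Z W (w k)"
          and "\<And>z. z \<in> W \<Longrightarrow> indep_tuple (a i - p i) (\<lambda>k. w k z)"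
          and wW: "\<And>z. z \<in> W \<Longrightarrow> frame_span (a i - p i) (\<lambda>k. w k z) = snd z i"
          by (rule local_frame[OF C lrZ sndZ z0]) (rule that)
        have Wz: "z \<in> points ?Z" if "z \<in> W" for z using openin_subset[OF W(1)] that by blast
        have fN: "fst z \<in> N" if "z \<in> W" for z using Wp(2)[OF Wz[OF that] i] .
        have vZ: "regular_vector ?Z W (\<lambda>z. v i j (fst z))" if "j < q i" for j
          by (rule regular_vector_pullback[OF lrZ fstZ N(1) vreg[OF i that] W(1) fN])
        define s where "s = (\<lambda>k z. if k < p i then v i k (fst z)
            else (\<Sum>j<q i - p i. scaleC (w (k - p i) z j) (v i (p i + j) (fst z))))"
        have "regular_vector ?Z W (s k)" if k: "k < a i" for k
        proof (cases "k < p i")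
          case True
          then show ?thesis using vZ[of k] pq[OF i] by (simp add: s_def)
        next
          case False
          then have k': "k - p i < a i - p i" using k by simp
          have "regular_vector ?Z W (\<lambda>z. \<Sum>j<q i - p i. scaleC (w (k - p i) z j) (v i (p i + j) (fst z)))"
            by (intro regular_vector_combination[OF lrZ W(1)] vZ regular_vectorD[OF w[OF k'] clinear_coordinate]) auto
          then show ?thesis using False by (simp add: s_def)
        qed
        moreover have "L i (fst z) (snd z i) = frame_span (a i) (\<lambda>k. s k z)" if z: "z \<in> W" for z
        proof -
          let ?y = "fst z" and ?W = "snd z i"
          note y = fN[OF z] and WG = Wp(1)[OF Wz[OF z] i]
          have vB': "v i j ?y \<in> B i ?y" if "j < q i" for j
            using frame_span_superset[OF that, of "\<lambda>j. v i j ?y"] vB[OF i y] by simp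
          have vA': "v i j ?y \<in> A i ?y" if "j < p i" for j
            using frame_span_superset[OF that, of "\<lambda>j. v i j ?y"] vA[OF i y] by simp
          have wk: "w k z \<in> ?W" if "k < a i - p i" for k
            using frame_span_superset[OF that, of "\<lambda>k. w k z"] wW[OF z] by simp
          have wC: "w k z \<in> coord_space (q i - p i)" if "k < a i - p i" for k
            using wk[OF that] WG by (auto simp: gr_points_def)
          have \<pi>s: "\<pi> i ?y (s (p i + k) z) = w k z" if "k < a i - p i" for k
            using \<pi>lift[OF i y wC[OF that]] by (simp add: s_def)
          have sB: "s k z \<in> B i ?y" if "k < a i" for k
            using that vB' pq[OF i] by (auto simp: s_def intro!: subspace_combination[OF Bsub(1)[OF i y]])
          have sL: "s k z \<in> L i ?y ?W" if k: "k < a i" for k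
          proof (cases "k < p i")
            case True
            then show ?thesis using vA'[OF True] L(2)[OF i y WG] by (auto simp: s_def)
          next
            case False
            then have "\<pi> i ?y (s k z) = w (k - p i) z" "k - p i < a i - p i" using \<pi>s[of "k - p i"] k by simp_all
            then show ?thesis using wk sB[OF k] by (auto simp: L_def)
          qed
          have Ls: "complex_vector.subspace (L i ?y ?W)" using L(1)[OF i y WG] by (simp add: gr_points_def)
          let ?S = "frame_span (a i) (\<lambda>k. s k z)"
          have SL: "?S \<subseteq> L i ?y ?W" by (rule frame_span_minimal[OF Ls sL])
          have "A i ?y \<subseteq> ?S"
            unfolding vA[OF i y, symmetric]
          proof (rule frame_span_minimal[OF subspace_frame_span])
            fix j assume "j < p i"
            then show "v i j ?y \<in> ?S" using frame_span_superset[of j "a i" "\<lambda>k. s k z"] pa[OF i] by (simp add: s_def)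
          qed
          moreover have "?W \<subseteq> \<pi> i ?y ` ?S"
            unfolding wW[OF z, symmetric]
          proof (rule frame_span_minimal)
            show "complex_vector.subspace (\<pi> i ?y ` ?S)"
              by (rule complex_pair.linear_subspace_image[OF \<pi>lin[OF i y] subspace_frame_span])
            fix k assume k: "k < a i - p i"
            then have "s (p i + k) z \<in> ?S" by (intro frame_span_superset) simp
            then show "w k z \<in> \<pi> i ?y ` ?S" using \<pi>s[OF k] by (metis image_eqI)
          qed
          ultimately have "L i ?y ?W \<subseteq> ?S"
          proof (intro subsetI)
            assume AS: "A i ?y \<subseteq> ?S" and WS: "?W \<subseteq> \<pi> i ?y ` ?S"
            fix x assume x: "x \<in> L i ?y ?W"
            then obtain x' where x': "x' \<in> ?S" "\<pi> i ?y x = \<pi> i ?y x'" using WS by (auto simp: L_def)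
            have "x - x' \<in> B i ?y" using x x'(1) SL L(3)[OF i y WG] by (intro complex_vector.subspace_diff Bsub(1)[OF i y]) auto
            then have "x - x' \<in> A i ?y" using \<pi>ker[OF i y] x'(2) clinear_diff[OF \<pi>lin[OF i y]] by auto
            then have "x' + (x - x') \<in> ?S" using AS x'(1) by (intro complex_vector.subspace_add subspace_frame_span) auto
            then show "x \<in> ?S" by simp
          qed
          then show ?thesis using SL by blast
        qed
        ultimately show "\<exists>W m s. openin (zar ?Z) W \<and> z0 \<in> W \<and> (\<forall>k<m. regular_vector ?Z W (s k)) \<and>
              (\<forall>z\<in>W. L i (fst z) (snd z i) = frame_span m (\<lambda>k. s k z))"
          using W by (intro exI[of _ W] exI[of _ "a i"] exI[of _ s]) auto
      qed
    qed
    have LP: "P (?g z) = fst z" "\<And>i. i < r \<Longrightarrow> u i (?g z) = L i (fst z) (snd z i)" if z: "z \<in> points ?Z" for z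
    proof -
      have y: "fst z \<in> points Y" using z N(3) unfolding Zp by auto
      have U: "L i (fst z) (snd z i) \<in> gr_points (a i) (V i) \<and> A i (fst z) \<subseteq> L i (fst z) (snd z i) \<and>
          L i (fst z) (snd z i) \<subseteq> B i (fst z)" if "i < r" for i
        using L[OF that Wp(2,1)[OF z that]] by blast
      show "P (?g z) = fst z" by (rule P_mk[OF y U])
      show "u i (?g z) = L i (fst z) (snd z i)" if "i < r" for i by (rule u_mk[OF y U that])
    qed
    show "morphism ?Z ?XN ?g"
    proof (rule morphism_to_induced[OF lrZ gX])
      fix z assume z: "z \<in> points ?Z"
      have "fst z \<in> N" using z unfolding Zp by auto
      then show "?g z \<in> {x \<in> points X. P x \<in> N}" using LP(1)[OF z] morphism_points[OF gX z] by simp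
    qed
    show "?g (?f x) = x" if x: "x \<in> points ?XN" for x
    proof -
      have x': "x \<in> points X" "P x \<in> N" using x by auto
      have "L i (P x) (\<pi> i (P x) ` u i x) = u i x" if i: "i < r" for i
      proof (rule subset_antisym)
        note AuB' = AuB[OF i x'(1)]
        show "u i x \<subseteq> L i (P x) (\<pi> i (P x) ` u i x)" using AuB' by (auto simp: L_def)
        show "L i (P x) (\<pi> i (P x) ` u i x) \<subseteq> u i x"
        proof
          fix b assume "b \<in> L i (P x) (\<pi> i (P x) ` u i x)"
          then obtain b' where b: "b \<in> B i (P x)" "b' \<in> u i x" "\<pi> i (P x) b = \<pi> i (P x) b'" by (auto simp: L_def)
          have us: "complex_vector.subspace (u i x)" using up[OF i x'(1)] by (simp add: gr_points_def)
          have "b - b' \<in> B i (P x)" using b AuB' by (intro complex_vector.subspace_diff Bsub(1)[OF i x'(2)]) auto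
          then have "b - b' \<in> A i (P x)" using \<pi>ker[OF i x'(2)] b(3) clinear_diff[OF \<pi>lin[OF i x'(2)]] by auto
          then have "b' + (b - b') \<in> u i x" using AuB' b(2) by (intro complex_vector.subspace_add us) auto
          then show "b \<in> u i x" by simp
        qed
      qed
      then show ?thesis by (auto intro!: mk_eq x'(1))
    qed
    show "?f (?g z) = z" if z: "z \<in> points ?Z" for z
    proof (rule prod_eqI)
      show "fst (?f (?g z)) = fst z" using LP(1)[OF z] by simp
      show "snd (?f (?g z)) = snd z"
      proof
        fix i
        show "snd (?f (?g z)) i = snd z i"
          using LP[OF z] L(4)[OF _ Wp(2,1)[OF z], of i] z by (cases "i < r") (auto simp: Zp PiE_iff extensional_def)
      qed
    qed
  qed
  then show "\<exists>U \<phi>. openin (zar Y) U \<and> y0 \<in> U \<and>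
        isomorphism (induced X {x \<in> points X. P x \<in> U}) (prod_fspace (induced Y U) ?F) \<phi> \<and>
        (\<forall>x\<in>points X. P x \<in> U \<longrightarrow> fst (\<phi> x) = P x)"
    using N by (intro exI[of _ N] exI[of _ ?f]) simp
qed

section \<open>Representations of the cycle and their images on the cylinder\<close>

lemma cycle_rep_space:
  assumes "is_rep (cycle_quiver n) M" "i < n"
  shows "fin_dim_subspace (qspace M i)" "clinear_on (qspace M i) (qmap M i)"
    "x \<in> qspace M i \<Longrightarrow> qmap M i x \<in> qspace M ((i + 1) mod n)"
  using assms unfolding is_rep_def cycle_quiver_def by auto

lemma cycle_comp_mem:
  assumes M: "is_rep (cycle_quiver n) M" and i: "i < n" and x: "x \<in> qspace M i"
  shows "cycle_comp n M i l x \<in> qspace M ((i + l) mod n)"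
proof (induction l)
  case (Suc l)
  have "(i + l) mod n < n" using i by simp
  from cycle_rep_space(3)[OF M this Suc] show ?case by (simp add: mod_simps)
qed (use i x in simp)

lemma clinear_on_cycle_comp:
  assumes M: "is_rep (cycle_quiver n) M" and i: "i < n"
  shows "clinear_on (qspace M i) (cycle_comp n M i l)"
proof (induction l)
  case (Suc l)
  have "(i + l) mod n < n" using i by simp
  from cycle_rep_space(2)[OF M this] Suc show ?case
    using cycle_comp_mem[OF M i] unfolding clinear_on_def by simp
qed (simp add: clinear_on_def)

text \<open>The composition is defined by adding maps at its end; splitting off the first map instead shows that
  the space at \<open>(i, k)\<close> is contained in that at \<open>(i + 1, k - 1)\<close>.\<close>

lemma cycle_comp_shift:
  "cycle_comp n M i (Suc l) x = cycle_comp n M ((i + 1) mod n) l (qmap M (i mod n) x)"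
  by (induction l) (simp_all add: mod_simps)

lemma fin_dim_Lambda_space:
  assumes M: "is_rep (cycle_quiver n) M" and i: "i < n"
  shows "fin_dim_subspace (Lambda_space n M (i, k))"
proof -
  note V = cycle_rep_space(1)[OF M i]
  obtain g where g: "clinear g" "\<forall>x\<in>qspace M i. g x = cycle_comp n M i (k - 1) x"
    using clinear_on_extend[OF clinear_on_cycle_comp[OF M i] fin_dim_subspace_subspace[OF V]] by blast
  have "Lambda_space n M (i, k) = g ` qspace M i" using g(2) by auto
  then show ?thesis using fin_dim_image[OF g(1) V] by simp
qed

lemma Lambda_space_subset:
  assumes M: "is_rep (cycle_quiver n) M" and i: "i < n" and k: "1 \<le> k"
  shows "Lambda_space n M (i, k) \<subseteq> qspace M ((i + k - 1) mod n)"
  using cycle_comp_mem[OF M i, of _ "k - 1"] k by auto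

lemma Lambda_space_alpha:
  assumes "1 \<le> k"
  shows "qmap M ((i + k - 1) mod n) ` Lambda_space n M (i, k) = Lambda_space n M (i, k + 1)"
proof -
  obtain l where "k = Suc l" using assms by (cases k) auto
  then show ?thesis by (simp add: image_comp)
qed

lemma Lambda_space_beta:
  assumes M: "is_rep (cycle_quiver n) M" and i: "i < n" and k: "2 \<le> k"
  shows "Lambda_space n M (i, k) \<subseteq> Lambda_space n M ((i + 1) mod n, k - 1)"
proof -
  obtain l where k: "k = Suc (Suc l)" using k by (metis Suc_le_D numeral_2_eq_2 Suc_le_mono)
  show ?thesis
  proof
    fix y assume "y \<in> Lambda_space n M (i, k)"
    then obtain x where x: "x \<in> qspace M i" "y = cycle_comp n M i (Suc l) x" using k by auto
    have "y = cycle_comp n M ((i + 1) mod n) l (qmap M i x)"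
      unfolding x(2) cycle_comp_shift using i by simp
    then show "y \<in> Lambda_space n M ((i + 1) mod n, k - 1)" using cycle_rep_space(3)[OF M i x(1)] k by simp
  qed
qed

text \<open>A member of the last level is a value of \<open>N - 1\<close> consecutive maps, and one more map makes it zero.\<close>

lemma Lambda_space_top:
  assumes M: "M \<in> cycle_reps n N" and N: "1 \<le> N" and i: "i < n" and x: "x \<in> Lambda_space n M (i, N)"
  shows "qmap M ((i + N - 1) mod n) x = 0"
proof -
  have "qmap M ((i + N - 1) mod n) x \<in> Lambda_space n M (i, N + 1)"
    unfolding Lambda_space_alpha[OF N, symmetric] using x by (rule imageI)
  then obtain y where "y \<in> qspace M i" "qmap M ((i + N - 1) mod n) x = cycle_comp n M i N y" by auto
  then show ?thesis using M i by (simp add: cycle_reps_def)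
qed

lemma cycle_comp_cong: "qmap M' = qmap M \<Longrightarrow> cycle_comp n M' i l = cycle_comp n M i l"
  by (induction l) simp_all

section \<open>The tower\<close>

text \<open>The full subquiver on the levels \<open>k, \<dots>, N\<close>. On the last level alone no arrow is left, so the quiver
  Grassmannians of these subquivers interpolate between that of the cylinder and a product.\<close>

definition cylinder_above :: "nat \<Rightarrow> nat \<Rightarrow> nat \<Rightarrow> (nat \<times> nat, cyl_arrow) pre_digraph" where
  "cylinder_above n N k =
     \<lparr>verts = {..<n} \<times> {k..N},
      arcs = {Alpha i j | i j. i < n \<and> j \<in> {k..<N}} \<union> {Beta i j | i j. i < n \<and> j \<in> {Suc k..N}},
      tail = cyl_tail, head = cyl_head n\<rparr>"

lemma cylinder_above_1: "cylinder_above n N 1 = cylinder_quiver n N"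
  unfolding cylinder_above_def cylinder_quiver_def by (simp add: numeral_2_eq_2)

lemma cylinder_above_ends:
  assumes "r \<in> arcs (cylinder_above n N k)"
  shows "tail (cylinder_above n N k) r \<in> verts (cylinder_above n N k)"
    "head (cylinder_above n N k) r \<in> verts (cylinder_above n N k)"
  using assms unfolding cylinder_above_def by auto

lemma is_rep_Lambda:
  assumes M: "is_rep (cycle_quiver n) M" and k: "1 \<le> k"
  shows "is_rep (cylinder_above n N k) (Lambda n M)"
  unfolding is_rep_def
proof (intro conjI ballI)
  fix v assume "v \<in> verts (cylinder_above n N k)"
  then show "fin_dim_subspace (qspace (Lambda n M) v)"
    using fin_dim_Lambda_space[OF M] by (auto simp: cylinder_above_def Lambda_def simp del: Lambda_space.simps)
next
  fix r assume r: "r \<in> arcs (cylinder_above n N k)"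
  let ?Q = "cylinder_above n N k" and ?V = "Lambda n M"
  have "clinear_on (qspace ?V (tail ?Q r)) (qmap ?V r) \<and>
        qmap ?V r ` qspace ?V (tail ?Q r) \<subseteq> qspace ?V (head ?Q r)"
  proof (cases r)
    case (Alpha i j)
    then have ij: "i < n" "k \<le> j" "j < N" using r by (auto simp: cylinder_above_def)
    have "(i + j - 1) mod n < n" using ij by simp
    from cycle_rep_space(2)[OF M this] Lambda_space_subset[OF M ij(1), of j] ij k
    have "clinear_on (Lambda_space n M (i, j)) (qmap M ((i + j - 1) mod n))"
      unfolding clinear_on_def by (meson order_trans subsetD)
    then show ?thesis
      using Lambda_space_alpha[of j M i n] ij k Alpha
      by (simp add: cylinder_above_def Lambda_def del: Lambda_space.simps)
  next
    case (Beta i j)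
    then have ij: "i < n" "Suc k \<le> j" "j \<le> N" using r by (auto simp: cylinder_above_def)
    then show ?thesis
      using Lambda_space_beta[OF M ij(1), of j] k Beta
      by (simp add: cylinder_above_def Lambda_def clinear_on_def del: Lambda_space.simps)
  qed
  then show "clinear_on (qspace ?V (tail ?Q r)) (qmap ?V r)"
    "qmap ?V r ` qspace ?V (tail ?Q r) \<subseteq> qspace ?V (head ?Q r)" by blast+
qed

abbreviation tower :: "nat \<Rightarrow> nat \<Rightarrow> (nat, nat, 'v::complex_vector) qrep \<Rightarrow> (nat \<times> nat \<Rightarrow> nat) \<Rightarrow> nat \<Rightarrow>
    (nat \<times> nat \<Rightarrow> 'v set) fspace" where
  "tower n N M f k \<equiv> quiver_gr (cylinder_above n N k) (Lambda n M) f"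

lemma points_tower:
  assumes M: "is_rep (cycle_quiver n) M"
  shows "U \<in> points (tower n N M f k) \<longleftrightarrow>
    U \<in> PiE ({..<n} \<times> {k..N}) (\<lambda>v. gr_points (f v) (Lambda_space n M v)) \<and>
    (\<forall>i<n. \<forall>j\<in>{k..<N}. qmap M ((i + j - 1) mod n) ` U (i, j) \<subseteq> U (i, j + 1)) \<and>
    (\<forall>i<n. \<forall>j\<in>{Suc k..N}. U (i, j) \<subseteq> U ((i + 1) mod n, j - 1))"
proof -
  have sub: "complex_vector.subspace (qspace (Lambda n M) v)" if "v \<in> verts (cylinder_above n N k)" for v
    using fin_dim_subspace_subspace[OF fin_dim_Lambda_space[OF M]] that
    by (auto simp: cylinder_above_def Lambda_def simp del: Lambda_space.simps)
  have arcs: "(\<forall>r\<in>arcs (cylinder_above n N k). R r) \<longleftrightarrow>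
      (\<forall>i<n. \<forall>j\<in>{k..<N}. R (Alpha i j)) \<and> (\<forall>i<n. \<forall>j\<in>{Suc k..N}. R (Beta i j))" for R
    unfolding cylinder_above_def by auto
  have "points (tower n N M f k) = {U \<in> PiE (verts (cylinder_above n N k)) (\<lambda>v. gr_points (f v) (qspace (Lambda n M) v)).
      \<forall>r\<in>arcs (cylinder_above n N k). qmap (Lambda n M) r ` U (tail (cylinder_above n N k) r) \<subseteq>
         U (head (cylinder_above n N k) r)}"
    by (rule points_quiver_gr) (rule sub)
  then show ?thesis
    unfolding arcs
    by (simp add: cylinder_above_def Lambda_def del: Lambda_space.simps)
qed

lemma morphism_tower_component:
  assumes "v \<in> {..<n} \<times> {k..N}"
  shows "morphism (tower n N M f k) (gr (f v) (Lambda_space n M v)) (\<lambda>U. U v)"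
proof -
  have lr: "\<forall>v\<in>verts (cylinder_above n N k). locally_ringed (gr (f v) (qspace (Lambda n M) v))"
    using locally_ringed_gr by blast
  have "v \<in> verts (cylinder_above n N k)" using assms by (simp add: cylinder_above_def)
  from morphism_from_induced[OF locally_ringed_Prod[OF lr] morphism_component[OF lr this]]
  show ?thesis unfolding quiver_gr_def by (simp add: Lambda_def del: Lambda_space.simps)
qed

lemma morphism_to_tower:
  assumes M: "is_rep (cycle_quiver n) M" and Z: "locally_ringed Z"
    and \<phi>: "\<And>v. v \<in> {..<n} \<times> {k..N} \<Longrightarrow> morphism Z (gr (f v) (Lambda_space n M v)) (\<lambda>z. \<phi> z v)"
    and p: "\<And>z. z \<in> points Z \<Longrightarrow> \<phi> z \<in> points (tower n N M f k)"
  shows "morphism Z (tower n N M f k) \<phi>"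
proof -
  have lr: "\<forall>v\<in>verts (cylinder_above n N k). locally_ringed (gr (f v) (qspace (Lambda n M) v))"
    using locally_ringed_gr by blast
  have "morphism Z (Prod_fspace (verts (cylinder_above n N k)) (\<lambda>v. gr (f v) (qspace (Lambda n M) v))) \<phi>"
  proof (rule morphism_to_Prod[OF Z _ lr])
    show "finite (verts (cylinder_above n N k))" by (simp add: cylinder_above_def)
    show "morphism Z (gr (f v) (qspace (Lambda n M) v)) (\<lambda>z. \<phi> z v)" if "v \<in> verts (cylinder_above n N k)" for v
      using \<phi>[of v] that by (simp add: cylinder_above_def Lambda_def del: Lambda_space.simps)
    show "\<phi> z \<in> extensional (verts (cylinder_above n N k))" if "z \<in> points Z" for z
      using p[OF that] unfolding points_tower[OF M] by (simp add: cylinder_above_def PiE_def)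
  qed
  then show ?thesis
    unfolding quiver_gr_def
    by (rule morphism_to_induced[OF Z]) (use p in \<open>auto simp: quiver_gr_def\<close>)
qed

text \<open>The arrows at \<open>(i, k)\<close> that are not in the smaller quiver say that \<open>U\<^bsub>i,k\<^esub>\<close> contains \<open>A = U\<^bsub>i-1,k+1\<^esub>\<close>
  and is contained in the preimage \<open>B\<close> of \<open>U\<^bsub>i,k+1\<^esub>\<close> under the map of \<open>\<alpha>\<^bsub>i,k\<^esub>\<close>, which is surjective. To
  see that \<open>A \<subseteq> B\<close>, note that this map agrees on \<open>A\<close> with that of \<open>\<alpha>\<^bsub>i-1,k+1\<^esub>\<close>, which leads into
  \<open>U\<^bsub>i-1,k+2\<^esub> \<subseteq> U\<^bsub>i,k+1\<^esub>\<close> if \<open>k + 1 < N\<close> and is zero if \<open>k + 1 = N\<close>. The indices in \<open>\<int>/n\<close> are kept in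
  \<open>{..<n}\<close>, so \<open>i - 1\<close> appears as \<open>(i + n - 1) mod n\<close>.\<close>

lemma fibration_tower:
  assumes M: "M \<in> cycle_reps n N" and n: "1 \<le> n" and k: "1 \<le> k" "k < N"
    and pa: "\<And>i. i < n \<Longrightarrow> f ((i + n - 1) mod n, k + 1) \<le> f (i, k)"
    and aq: "\<And>i. i < n \<Longrightarrow> f (i, k) \<le> f (i, k + 1) +
       (complex_vector.dim (Lambda_space n M (i, k)) - complex_vector.dim (Lambda_space n M (i, k + 1)))"
  shows "fibration (tower n N M f k) (tower n N M f (k + 1)) (\<lambda>U. restrict U ({..<n} \<times> {k+1..N}))
    (Prod_fspace {..<n} (\<lambda>i. gr (f (i, k) - f ((i + n - 1) mod n, k + 1))
      (coord_space (f (i, k + 1) + (complex_vector.dim (Lambda_space n M (i, k)) -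
         complex_vector.dim (Lambda_space n M (i, k + 1))) - f ((i + n - 1) mod n, k + 1)))))"
proof -
  have Mr: "is_rep (cycle_quiver n) M" using M by (simp add: cycle_reps_def)
  note finL = fin_dim_Lambda_space[OF Mr]
  let ?V = "\<lambda>i. Lambda_space n M (i, k)"
  let ?X = "tower n N M f k" and ?Y = "tower n N M f (k + 1)"
  define pr where "pr = (\<lambda>i. (i + n - 1) mod n)"
  have pr: "pr i < n" "(pr i + 1) mod n = i" "pr ((i + 1) mod n) = i" "(pr i + k) mod n = (i + k - 1) mod n"
    if i: "i < n" for i
  proof -
    show "pr i < n" using n unfolding pr_def by simp
    have "(pr i + 1) mod n = (i + n - 1 + 1) mod n" unfolding pr_def by (simp only: mod_simps)
    then show "(pr i + 1) mod n = i" using i n by simp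
    have "pr ((i + 1) mod n) = ((i + 1) mod n + (n - 1)) mod n" using n unfolding pr_def by simp
    also have "\<dots> = (i + 1 + (n - 1)) mod n" by (simp only: mod_simps)
    finally show "pr ((i + 1) mod n) = i" using i n by simp
    have "(pr i + k) mod n = (i + n - 1 + k) mod n" unfolding pr_def by (simp only: mod_simps)
    also have "i + n - 1 + k = (i + k - 1) + n" using n k by simp
    finally show "(pr i + k) mod n = (i + k - 1) mod n" by simp
  qed
  have "\<forall>i\<in>{..<n}. \<exists>g. clinear g \<and> (\<forall>x\<in>?V i. g x = qmap M ((i + k - 1) mod n) x)"
  proof
    fix i assume "i \<in> {..<n}"
    then have i: "i < n" "(i + k - 1) mod n < n" by auto
    have "clinear_on (?V i) (qmap M ((i + k - 1) mod n))"
      using cycle_rep_space(2)[OF Mr i(2)] Lambda_space_subset[OF Mr i(1) k(1)]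
      unfolding clinear_on_def by (meson subsetD)
    then show "\<exists>g. clinear g \<and> (\<forall>x\<in>?V i. g x = qmap M ((i + k - 1) mod n) x)"
      by (rule clinear_on_extend[OF _ fin_dim_subspace_subspace[OF finL[OF i(1)]]])
  qed
  from bchoice[OF this] obtain h where h0: "\<forall>i\<in>{..<n}. clinear (h i) \<and> (\<forall>x\<in>?V i. h i x = qmap M ((i + k - 1) mod n) x)"
    by (elim exE)
  have h: "clinear (h i)" and hx: "\<And>x. x \<in> ?V i \<Longrightarrow> h i x = qmap M ((i + k - 1) mod n) x" if "i < n" for i
    using h0 that by auto
  have hV: "h i ` ?V i = Lambda_space n M (i, k + 1)" if "i < n" for i
  proof -
    have "h i ` ?V i = qmap M ((i + k - 1) mod n) ` ?V i" by (rule image_cong[OF refl hx[OF that]])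
    then show ?thesis unfolding Lambda_space_alpha[OF k(1)] .
  qed
  define A where "A = (\<lambda>i (y :: nat \<times> nat \<Rightarrow> 'a set). y (pr i, k + 1))"
  define B where "B = (\<lambda>i (y :: nat \<times> nat \<Rightarrow> 'a set). {x \<in> ?V i. h i x \<in> y (i, k + 1)})"
  define mk where "mk = (\<lambda>(y :: nat \<times> nat \<Rightarrow> 'a set) W. \<lambda>v\<in>{..<n} \<times> {k..N}. if snd v = k then W (fst v) else y v)"
  let ?q = "\<lambda>i. f (i, k + 1) + (complex_vector.dim (?V i) - complex_vector.dim (Lambda_space n M (i, k + 1)))"
  have lrX: "locally_ringed (tower n N M f l)" for l by (rule locally_ringed_quiver_gr)
  have VA: "Lambda_space n M (pr i, k + 1) \<subseteq> ?V i" if "i < n" for i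
    using Lambda_space_beta[OF Mr pr(1)[OF that], of "k + 1"] k(1) unfolding pr(2)[OF that] by simp
  have Ymem: "y v \<in> gr_points (f v) (Lambda_space n M v)" if "y \<in> points ?Y" "v \<in> {..<n} \<times> {k+1..N}" for y v
    using that unfolding points_tower[OF Mr] by (auto simp: PiE_iff simp del: Lambda_space.simps)
  have Yalpha: "qmap M ((i + j - 1) mod n) ` y (i, j) \<subseteq> y (i, j + 1)" if "y \<in> points ?Y" "i < n" "k + 1 \<le> j" "j < N" for y i j
    using that unfolding points_tower[OF Mr] by (simp del: Lambda_space.simps)
  have Ybeta: "y (i, j) \<subseteq> y ((i + 1) mod n, j - 1)" if "y \<in> points ?Y" "i < n" "k + 2 \<le> j" "j \<le> N" for y i j
    using that unfolding points_tower[OF Mr] by (simp del: Lambda_space.simps)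
  have AB: "A i y \<subseteq> B i y" if i: "i < n" and y: "y \<in> points ?Y" for i y
  proof
    fix x assume "x \<in> A i y"
    then have x: "x \<in> y (pr i, k + 1)" by (simp add: A_def)
    have xL: "x \<in> Lambda_space n M (pr i, k + 1)"
      using Ymem[OF y, of "(pr i, k + 1)"] x pr(1)[OF i] k(2) by (auto simp: gr_points_def simp del: Lambda_space.simps)
    then have xV: "x \<in> ?V i" using VA[OF i] by blast
    have hxx: "h i x = qmap M ((pr i + (k + 1) - 1) mod n) x" using hx[OF i xV] pr(4)[OF i] by simp
    have "h i x \<in> y (i, k + 1)"
    proof (cases "k + 1 = N")
      case True
      have "h i x = 0" unfolding hxx True by (rule Lambda_space_top[OF M _ pr(1)[OF i]]) (use xL k True in auto)
      moreover have "complex_vector.subspace (y (i, k + 1))"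
        using Ymem[OF y, of "(i, k + 1)"] i k(2) by (auto simp: gr_points_def)
      ultimately show ?thesis using complex_vector.subspace_0 by metis
    next
      case False
      then have lt: "k + 1 < N" using k(2) by simp
      have "h i x \<in> y (pr i, k + 1 + 1)"
        unfolding hxx using Yalpha[OF y pr(1)[OF i] order_refl lt] x by blast
      also have "\<dots> \<subseteq> y (i, k + 1)"
        using Ybeta[OF y pr(1)[OF i], of "k + 1 + 1"] lt pr(2)[OF i] by simp
      finally show ?thesis .
    qed
    then show "x \<in> B i y" using xV by (simp add: B_def)
  qed
  have Xmem: "U v \<in> gr_points (f v) (Lambda_space n M v)" if "U \<in> points ?X" "v \<in> {..<n} \<times> {k..N}" for U v
    using that unfolding points_tower[OF Mr] by (auto simp: PiE_iff simp del: Lambda_space.simps)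
  have Xalpha: "qmap M ((i + j - 1) mod n) ` U (i, j) \<subseteq> U (i, j + 1)" if "U \<in> points ?X" "i < n" "k \<le> j" "j < N" for U i j
    using that unfolding points_tower[OF Mr] by (simp del: Lambda_space.simps)
  have Xbeta: "U (i, j) \<subseteq> U ((i + 1) mod n, j - 1)" if "U \<in> points ?X" "i < n" "k + 1 \<le> j" "j \<le> N" for U i j
    using that unfolding points_tower[OF Mr] by (simp del: Lambda_space.simps)
  let ?P = "\<lambda>U. restrict U ({..<n} \<times> {k+1..N})"
  have Pp: "?P U \<in> points ?Y" if U: "U \<in> points ?X" for U
    unfolding points_tower[OF Mr]
  proof (intro conjI allI impI ballI)
    show "?P U \<in> PiE ({..<n} \<times> {k + 1..N}) (\<lambda>v. gr_points (f v) (Lambda_space n M v))"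
      using Xmem[OF U] by (auto simp del: Lambda_space.simps)
    show "qmap M ((i + j - 1) mod n) ` ?P U (i, j) \<subseteq> ?P U (i, j + 1)" if "i < n" "j \<in> {k + 1..<N}" for i j
      using Xalpha[OF U that(1), of j] that by simp
    show "?P U (i, j) \<subseteq> ?P U ((i + 1) mod n, j - 1)" if "i < n" "j \<in> {Suc (k + 1)..N}" for i j
    proof -
      have "(i + 1) mod n < n" "k + 1 \<le> j - 1" "j - 1 \<le> N" using that by auto
      then show ?thesis using Xbeta[OF U that(1), of j] that by simp
    qed
  qed
  have mk_points: "mk y W \<in> points ?X"
    if y: "y \<in> points ?Y" and W: "\<And>i. i < n \<Longrightarrow> W i \<in> gr_points (f (i, k)) (?V i) \<and> A i y \<subseteq> W i \<and> W i \<subseteq> B i y" for y W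
    unfolding points_tower[OF Mr]
  proof (intro conjI allI impI ballI)
    show "mk y W \<in> PiE ({..<n} \<times> {k..N}) (\<lambda>v. gr_points (f v) (Lambda_space n M v))"
      using W Ymem[OF y] by (auto simp: mk_def simp del: Lambda_space.simps)
    show "qmap M ((i + j - 1) mod n) ` mk y W (i, j) \<subseteq> mk y W (i, j + 1)" if i: "i < n" and j: "j \<in> {k..<N}" for i j
    proof (cases "j = k")
      case True
      have "qmap M ((i + k - 1) mod n) ` W i \<subseteq> y (i, k + 1)" using W[OF i] hx[OF i] by (auto simp: B_def)
      then show ?thesis using True i j by (simp add: mk_def)
    next
      case False
      then show ?thesis using Yalpha[OF y i, of j] i j by (simp add: mk_def)
    qed
    show "mk y W (i, j) \<subseteq> mk y W ((i + 1) mod n, j - 1)" if i: "i < n" and j: "j \<in> {Suc k..N}" for i j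
    proof (cases "j = Suc k")
      case True
      have i': "(i + 1) mod n < n" using n by simp
      from W[OF this] have "y (i, k + 1) \<subseteq> W ((i + 1) mod n)" unfolding A_def pr(3)[OF i] by blast
      then show ?thesis using True i i' j by (simp add: mk_def)
    next
      case False
      then show ?thesis using Ybeta[OF y i, of j] i j n by (auto simp: mk_def)
    qed
  qed
  have "fibration ?X ?Y ?P (Prod_fspace {..<n} (\<lambda>i. gr (f (i, k) - f (pr i, k + 1)) (coord_space (?q i - f (pr i, k + 1)))))"
  proof (rule fibration_of_intermediate_subspaces[where V = ?V and A = A and B = B and u = "\<lambda>i U. U (i, k)" and mk = mk])
    show "locally_ringed ?X" "locally_ringed ?Y" by (rule lrX)+
    show "morphism ?X ?Y ?P"
    proof (rule morphism_to_tower[OF Mr lrX _ Pp])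
      fix v assume v: "v \<in> {..<n} \<times> {k + 1..N}"
      then have "v \<in> {..<n} \<times> {k..N}" by auto
      from morphism_tower_component[OF this] v
      show "morphism ?X (gr (f v) (Lambda_space n M v)) (\<lambda>U. ?P U v)" by simp
    qed
    fix i assume i: "i < n"
    show "fin_dim_subspace (?V i)" by (rule finL[OF i])
    have "(pr i, k + 1) \<in> {..<n} \<times> {k + 1..N}" using pr(1)[OF i] k(2) by simp
    from morphism_gr_image[OF lrX finL[OF pr(1)[OF i]] finL[OF i] clinear_id _ _ morphism_tower_component[OF this]]
    show "morphism ?Y (gr (f (pr i, k + 1)) (?V i)) (A i)"
      using VA[OF i] unfolding A_def by (simp del: Lambda_space.simps)
    have "(i, k + 1) \<in> {..<n} \<times> {k + 1..N}" using i k(2) by simp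
    from morphism_tower_component[OF this, of M f]
    have "morphism ?Y (gr (f (i, k + 1)) (h i ` ?V i)) (\<lambda>y. y (i, k + 1))" unfolding hV[OF i] .
    from morphism_gr_preimage[OF lrX finL[OF i] h[OF i] this]
    show "morphism ?Y (gr (?q i) (?V i)) (B i)" unfolding B_def hV[OF i] .
    show "A i y \<subseteq> B i y" if "y \<in> points ?Y" for y by (rule AB[OF i that])
    show "f (pr i, k + 1) \<le> f (i, k)" using pa[OF i] by (simp add: pr_def)
    show "f (i, k) \<le> ?q i" by (rule aq[OF i])
    show "morphism ?X (gr (f (i, k)) (?V i)) (\<lambda>U. U (i, k))"
      by (rule morphism_tower_component) (use i k in simp)
    show "A i (?P U) \<subseteq> U (i, k) \<and> U (i, k) \<subseteq> B i (?P U)" if U: "U \<in> points ?X" for U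
    proof
      show "A i (?P U) \<subseteq> U (i, k)"
        using Xbeta[OF U pr(1)[OF i], of "k + 1"] pr(1,2)[OF i] k by (simp add: A_def)
      have "U (i, k) \<subseteq> ?V i" using Xmem[OF U, of "(i, k)"] i k by (auto simp: gr_points_def simp del: Lambda_space.simps)
      then show "U (i, k) \<subseteq> B i (?P U)"
        using Xalpha[OF U i order_refl k(2)] hx[OF i] i k unfolding B_def by (auto simp del: Lambda_space.simps)
    qed
  next
    fix y W assume y: "y \<in> points ?Y"
      and W: "\<And>i. i < n \<Longrightarrow> W i \<in> gr_points (f (i, k)) (?V i) \<and> A i y \<subseteq> W i \<and> W i \<subseteq> B i y"
    have ext: "y \<in> extensional ({..<n} \<times> {k + 1..N})" using y unfolding points_tower[OF Mr] by (simp add: PiE_def)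
    have "?P (mk y W) v = y v" for v
    proof (cases "v \<in> {..<n} \<times> {k + 1..N}")
      case True
      then have "v \<in> {..<n} \<times> {k..N}" "snd v \<noteq> k" by auto
      then show ?thesis using True by (simp only: mk_def restrict_apply' if_False)
    next
      case False
      then show ?thesis using extensional_arb[OF ext False] by (simp only: restrict_apply if_False)
    qed
    then show "?P (mk y W) = y" by (intro HOL.ext)
    show "mk y W (i, k) = W i" if "i < n" for i using that k by (simp add: mk_def)
  next
    fix U W assume U: "U \<in> points ?X" and W: "\<And>i. i < n \<Longrightarrow> W i = U (i, k)"
    have ext: "U \<in> extensional ({..<n} \<times> {k..N})" using U unfolding points_tower[OF Mr] by (simp add: PiE_def)
    have "mk (?P U) W v = U v" for v
    proof (cases "v \<in> {..<n} \<times> {k..N}")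
      case v: True
      show ?thesis
      proof (cases "snd v = k")
        case True
        then have "U v = U (fst v, k)" by (metis prod.collapse)
        moreover have "W (fst v) = U (fst v, k)" using v by (intro W) auto
        moreover have "mk (?P U) W v = W (fst v)" using v True by (simp add: mk_def)
        ultimately show ?thesis by simp
      next
        case False
        then have "v \<in> {..<n} \<times> {k + 1..N}" using v by auto
        then show ?thesis using v False by (simp only: mk_def restrict_apply' if_False)
      qed
    next
      case False
      then show ?thesis using extensional_arb[OF ext False] by (simp only: mk_def restrict_apply if_False)
    qed
    then show "mk (?P U) W = U" by (intro HOL.ext)
  next
    fix Z :: "((nat \<times> nat \<Rightarrow> 'a set) \<times> (nat \<Rightarrow> (nat \<Rightarrow> complex) set)) fspace" and g W
    assume Z: "locally_ringed Z" and g: "morphism Z ?Y g"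
      and W: "\<And>i. i < n \<Longrightarrow> morphism Z (gr (f (i, k)) (?V i)) (\<lambda>z. W z i)"
      and AWB: "\<And>z i. z \<in> points Z \<Longrightarrow> i < n \<Longrightarrow> A i (g z) \<subseteq> W z i \<and> W z i \<subseteq> B i (g z)"
    show "morphism Z ?X (\<lambda>z. mk (g z) (W z))"
    proof (rule morphism_to_tower[OF Mr Z])
      fix v assume v: "v \<in> {..<n} \<times> {k..N}"
      show "morphism Z (gr (f v) (Lambda_space n M v)) (\<lambda>z. mk (g z) (W z) v)"
      proof (cases "snd v = k")
        case True
        then obtain i where i: "v = (i, k)" "i < n" using v by (cases v) auto
        then show ?thesis using W[OF i(2)] k by (simp add: mk_def del: Lambda_space.simps)
      next
        case False
        then have "v \<in> {..<n} \<times> {k + 1..N}" using v by auto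
        from morphism_compose[OF g morphism_tower_component[OF this]] show ?thesis using False v by (simp add: mk_def)
      qed
    next
      fix z assume z: "z \<in> points Z"
      show "mk (g z) (W z) \<in> points ?X"
      proof (rule mk_points[OF morphism_points[OF g z]])
        fix i assume i: "i < n"
        show "W z i \<in> gr_points (f (i, k)) (?V i) \<and> A i (g z) \<subseteq> W z i \<and> W z i \<subseteq> B i (g z)"
          using morphism_points[OF W[OF i] z] AWB[OF z i]
          unfolding points_gr[OF fin_dim_subspace_subspace[OF finL[OF i]]] by blast
      qed
    qed
  qed
  then show ?thesis unfolding pr_def .
qed

lemma coordinates_exist:
  fixes V :: "'v::complex_vector set"
  assumes V: "fin_dim_subspace V"
  shows "\<exists>(h :: 'v \<Rightarrow> nat \<Rightarrow> complex) c. clinear h \<and> clinear c \<and>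
     h ` V = coord_space (complex_vector.dim V) \<and> c ` coord_space (complex_vector.dim V) = V \<and>
     (\<forall>x\<in>V. c (h x) = x) \<and> (\<forall>y\<in>coord_space (complex_vector.dim V). h (c y) = y)"
proof -
  define m where "m = complex_vector.dim V"
  obtain s where s: "indep_tuple m s" "frame_span m s = V" using frame_exists[OF V] unfolding m_def by blast
  obtain \<phi> where \<phi>: "\<And>i. clinear (\<phi> i)" "\<And>i j. i < m \<Longrightarrow> j < m \<Longrightarrow> \<phi> i (s j) = (if i = j then 1 else (0::complex))"
    using indep_tuple_dual[OF s(1)] by blast
  let ?h = "quotient_map 0 m \<phi>" and ?c = "\<lambda>y. \<Sum>j<m. scaleC (y j) (s j)"
  note h = quotient_map[of \<phi> m s 0, OF \<phi> le0, simplified, unfolded s(2)]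
  have c: "clinear ?c"
    by (rule clinearI) (simp_all add: scaleC_add_left sum.distrib complex_vector.scale_sum_right scaleC_scaleC)
  have ch: "?c (?h x) = x" if "x \<in> V" for x
  proof -
    have "?c (?h x) = (\<Sum>j<m. scaleC (\<phi> j x) (s j))"
      by (intro sum.cong) (auto simp: quotient_map_def functional_map_def)
    then show ?thesis using dual_coordinates[of m \<phi> s x, OF \<phi>] that s(2) by simp
  qed
  have "?c y \<in> V" if "y \<in> coord_space m" for y
    unfolding s(2)[symmetric] by (intro subspace_combination subspace_frame_span frame_span_superset) simp
  moreover have "V \<subseteq> ?c ` coord_space m"
  proof
    fix x assume x: "x \<in> V"
    then have "?h x \<in> coord_space m" using h(3) by blast
    then show "x \<in> ?c ` coord_space m" by (rule image_eqI[where f = ?c, OF ch[OF x, symmetric]])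
  qed
  ultimately have "?c ` coord_space m = V" by blast
  then show ?thesis
    unfolding m_def[symmetric] by (intro exI[of _ ?h] exI[of _ ?c] conjI ballI h(1,3,4) c ch)
qed

text \<open>Without arrows the quiver Grassmannian is the product of the Grassmannians of its spaces, and each of
  these spaces is identified with a coordinate space by a choice of basis.\<close>

lemma top_of_tower:
  assumes M: "is_rep (cycle_quiver n) M"
  shows "isomorphic (tower n N M f N)
    (Prod_fspace {..<n} (\<lambda>i. gr (f (i, N)) (coord_space (complex_vector.dim (Lambda_space n M (i, N))))))"
proof -
  let ?V = "\<lambda>i. Lambda_space n M (i, N)"
  let ?C = "\<lambda>i. coord_space (complex_vector.dim (?V i))"
  let ?G = "\<lambda>i. gr (f (i, N)) (?C i)"
  have V: "fin_dim_subspace (?V i)" if "i < n" for i by (rule fin_dim_Lambda_space[OF M that])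
  have "\<forall>i\<in>{..<n}. \<exists>hc. clinear (fst hc :: _ \<Rightarrow> nat \<Rightarrow> complex) \<and> clinear (snd hc) \<and> fst hc ` ?V i = ?C i \<and> snd hc ` ?C i = ?V i \<and>
      (\<forall>x\<in>?V i. snd hc (fst hc x) = x) \<and> (\<forall>y\<in>?C i. fst hc (snd hc y) = y)"
  proof
    fix i assume "i \<in> {..<n}"
    then have i: "i < n" by simp
    obtain h :: "_ \<Rightarrow> nat \<Rightarrow> complex" and c where "clinear h \<and> clinear c \<and> h ` ?V i = ?C i \<and> c ` ?C i = ?V i \<and>
      (\<forall>x\<in>?V i. c (h x) = x) \<and> (\<forall>y\<in>?C i. h (c y) = y)"
      using coordinates_exist[OF V[OF i]] by (elim exE)
    then show "\<exists>hc. clinear (fst hc :: _ \<Rightarrow> nat \<Rightarrow> complex) \<and> clinear (snd hc) \<and> fst hc ` ?V i = ?C i \<and> snd hc ` ?C i = ?V i \<and>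
      (\<forall>x\<in>?V i. snd hc (fst hc x) = x) \<and> (\<forall>y\<in>?C i. fst hc (snd hc y) = y)"
      by (intro exI[of _ "(h, c)"]) (simp del: Lambda_space.simps)
  qed
  from bchoice[OF this] obtain hc where hc: "\<forall>i\<in>{..<n}. clinear (fst (hc i) :: _ \<Rightarrow> nat \<Rightarrow> complex) \<and> clinear (snd (hc i)) \<and>
      fst (hc i) ` ?V i = ?C i \<and> snd (hc i) ` ?C i = ?V i \<and>
      (\<forall>x\<in>?V i. snd (hc i) (fst (hc i) x) = x) \<and> (\<forall>y\<in>?C i. fst (hc i) (snd (hc i) y) = y)" by (elim exE)
  define h where "h = (\<lambda>i. fst (hc i))"
  define c where "c = (\<lambda>i. snd (hc i))"
  have h: "clinear (h i)" and c: "clinear (c i)" and hV: "h i ` ?V i = ?C i" and cC: "c i ` ?C i = ?V i"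
    and ch: "\<And>x. x \<in> ?V i \<Longrightarrow> c i (h i x) = x" and hcy: "\<And>y. y \<in> ?C i \<Longrightarrow> h i (c i y) = y" if "i < n" for i
    using hc that unfolding h_def c_def by (simp_all del: Lambda_space.simps)
  have hinj: "inj_on (h i) (?V i)" and cinj: "inj_on (c i) (?C i)" if "i < n" for i
    using ch[OF that] hcy[OF that] by (metis inj_onI)+
  let ?X = "tower n N M f N" and ?Y = "Prod_fspace {..<n} ?G"
  have lrG: "\<forall>i\<in>{..<n}. locally_ringed (?G i)" using locally_ringed_gr by blast
  note lrX = locally_ringed_quiver_gr[of "cylinder_above n N N" "Lambda n M" f] and lrY = locally_ringed_Prod[OF lrG]
  let ?I = "{..<n} \<times> {N..N}"
  have Xp: "U \<in> points ?X \<longleftrightarrow> U \<in> PiE ?I (\<lambda>v. gr_points (f v) (Lambda_space n M v))" for U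
    unfolding points_tower[OF M] by (simp del: Lambda_space.simps)
  have Yp: "points ?Y = PiE {..<n} (\<lambda>i. gr_points (f (i, N)) (?C i))"
    unfolding points_Prod[OF lrG] by (simp add: points_gr[OF subspace_coord_space])
  let ?\<Phi> = "\<lambda>U. \<lambda>i\<in>{..<n}. h i ` U (i, N)" and ?\<Psi> = "\<lambda>W. \<lambda>v\<in>?I. c (fst v) ` W (fst v)"
  have \<Psi>comp: "morphism ?Y (gr (f v) (Lambda_space n M v)) (\<lambda>W. ?\<Psi> W v)" if v: "v \<in> ?I" for v
  proof -
    obtain i where i: "v = (i, N)" "i < n" using v by (cases v) auto
    have "morphism ?Y (?G i) (\<lambda>W. W i)" by (rule morphism_component[OF lrG]) (use i in simp)
    from morphism_gr_image[OF lrY fin_dim_coord_space V[OF i(2)] c[OF i(2)] cinj[OF i(2)] _ this] cC[OF i(2)]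
    show ?thesis using i by (simp del: Lambda_space.simps)
  qed
  have \<Psi>p: "?\<Psi> W \<in> points ?X" if W: "W \<in> points ?Y" for W
    unfolding Xp
  proof (rule PiE_I)
    fix v assume v: "v \<in> ?I"
    then have "fst v < n" "v = (fst v, N)" by auto
    then have "points (gr (f v) (Lambda_space n M v)) = gr_points (f v) (Lambda_space n M v)"
      using points_gr[OF fin_dim_subspace_subspace[OF V[of "fst v"]]] by metis
    then show "?\<Psi> W v \<in> gr_points (f v) (Lambda_space n M v)" using morphism_points[OF \<Psi>comp[OF v] W] by simp
  qed simp
  show ?thesis
  proof (rule isomorphicI[where \<phi> = ?\<Phi> and \<psi> = ?\<Psi>])
    show "morphism ?X ?Y ?\<Phi>"
    proof (rule morphism_to_Prod[OF lrX _ lrG])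
      fix i assume "i \<in> {..<n}"
      then have i: "i < n" by simp
      have "morphism ?X (gr (f (i, N)) (?V i)) (\<lambda>U. U (i, N))" by (rule morphism_tower_component) (use i in simp)
      from morphism_gr_image[OF lrX V[OF i] fin_dim_coord_space h[OF i] hinj[OF i] _ this] hV[OF i]
      show "morphism ?X (?G i) (\<lambda>U. ?\<Phi> U i)" using i by (simp del: Lambda_space.simps)
    qed auto
    show "morphism ?Y ?X ?\<Psi>" by (rule morphism_to_tower[OF M lrY \<Psi>comp \<Psi>p])
    show "?\<Psi> (?\<Phi> U) = U" if "U \<in> points ?X" for U
    proof
      fix v
      show "?\<Psi> (?\<Phi> U) v = U v"
      proof (cases "v \<in> ?I")
        case True
        then obtain i where i: "v = (i, N)" "i < n" by (cases v) auto
        have "U v \<subseteq> ?V i" using that True unfolding Xp i(1) by (auto simp: gr_points_def simp del: Lambda_space.simps dest!: PiE_mem)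
        then have "c i ` h i ` U v = U v" using ch[OF i(2)] by (force simp del: Lambda_space.simps)
        then show ?thesis using i True by simp
      next
        case False
        have "U \<in> extensional ?I" using that unfolding Xp by (simp add: PiE_def)
        from extensional_arb[OF this False] False show ?thesis by (simp only: restrict_apply if_False)
      qed
    qed
    show "?\<Phi> (?\<Psi> W) = W" if "W \<in> points ?Y" for W
    proof
      fix i
      show "?\<Phi> (?\<Psi> W) i = W i"
      proof (cases "i < n")
        case True
        have "W i \<subseteq> ?C i" using that True unfolding Yp by (auto simp: gr_points_def simp del: Lambda_space.simps dest!: PiE_mem)
        then have "h i ` c i ` W i = W i" using hcy[OF True] by (force simp del: Lambda_space.simps)
        then show ?thesis using True by simp
      next
        case False
        then show ?thesis using that unfolding Yp by (simp add: PiE_def extensional_def)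
      qed
    qed
  qed
qed

lemma dim_Lambda_space_iso:
  assumes M: "is_rep (cycle_quiver n) M" and iso: "rep_iso (cycle_quiver n) M E" and i: "i < n"
  shows "complex_vector.dim (Lambda_space n E (i, k)) = complex_vector.dim (Lambda_space n M (i, k))"
proof -
  obtain \<phi> where \<phi>: "\<And>j. j < n \<Longrightarrow> clinear_on (qspace M j) (\<phi> j) \<and> bij_betw (\<phi> j) (qspace M j) (qspace E j)"
    and nat: "\<And>j x. j < n \<Longrightarrow> x \<in> qspace M j \<Longrightarrow> \<phi> ((j + 1) mod n) (qmap M j x) = qmap E j (\<phi> j x)"
    using iso unfolding rep_iso_def cycle_quiver_def by auto
  have comp: "\<phi> ((i + l) mod n) (cycle_comp n M i l x) = cycle_comp n E i l (\<phi> i x)" if "x \<in> qspace M i" for x l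
  proof (induction l)
    case (Suc l)
    have "(i + l) mod n < n" using i by simp
    from nat[OF this cycle_comp_mem[OF M i that]] Suc show ?case by (simp add: mod_simps)
  qed (use i in simp)
  define j where "j = (i + (k - 1)) mod n"
  have j: "j < n" using i by (simp add: j_def)
  obtain g where g: "clinear g" "\<And>x. x \<in> qspace M j \<Longrightarrow> g x = \<phi> j x"
    using clinear_on_extend[OF conjunct1[OF \<phi>[OF j]] fin_dim_subspace_subspace[OF cycle_rep_space(1)[OF M j]]] by blast
  have sub: "Lambda_space n M (i, k) \<subseteq> qspace M j" using cycle_comp_mem[OF M i, of _ "k - 1"] by (auto simp: j_def)
  have "qspace E i = \<phi> i ` qspace M i" using \<phi>[OF i] by (simp add: bij_betw_def)
  then have "Lambda_space n E (i, k) = (\<lambda>x. cycle_comp n E i (k - 1) (\<phi> i x)) ` qspace M i" by (simp add: image_image)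
  also have "\<dots> = (\<lambda>x. g (cycle_comp n M i (k - 1) x)) ` qspace M i"
  proof (rule image_cong[OF refl])
    fix x assume x: "x \<in> qspace M i"
    show "cycle_comp n E i (k - 1) (\<phi> i x) = g (cycle_comp n M i (k - 1) x)"
      using comp[OF x, of "k - 1"] g(2)[OF cycle_comp_mem[OF M i x, of "k - 1", folded j_def]] by (simp add: j_def)
  qed
  also have "\<dots> = g ` Lambda_space n M (i, k)" by (simp add: image_image)
  finally have eq: "Lambda_space n E (i, k) = g ` Lambda_space n M (i, k)" .
  have "inj_on g (qspace M j)" using \<phi>[OF j] g(2) by (simp add: bij_betw_def inj_on_def)
  from dim_image_injective[OF g(1) fin_dim_Lambda_space[OF M i] inj_on_subset[OF this sub]]
  show ?thesis unfolding eq .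
qed

text \<open>The inequalities that make the fibres of the tower nonempty. They hold because \<open>\<Lambda> U\<close> is a
  subrepresentation of \<open>\<Lambda> M\<close>: its space at \<open>(i, k)\<close> lies between the two bounds given by its
  own spaces on level \<open>k + 1\<close>.\<close>

lemma dim_Lambda_space_bounds:
  assumes M: "is_rep (cycle_quiver n) M" and U: "is_rep (cycle_quiver n) U" "qmap U = qmap M"
    "\<And>i. i < n \<Longrightarrow> qspace U i \<subseteq> qspace M i" and i: "i < n" and k: "1 \<le> k"
  shows "complex_vector.dim (Lambda_space n U ((i + n - 1) mod n, k + 1)) \<le> complex_vector.dim (Lambda_space n U (i, k))"
    and "complex_vector.dim (Lambda_space n U (i, k)) \<le> complex_vector.dim (Lambda_space n U (i, k + 1)) +
       (complex_vector.dim (Lambda_space n M (i, k)) - complex_vector.dim (Lambda_space n M (i, k + 1)))"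
proof -
  have p: "(i + n - 1) mod n < n" using i by simp
  have "((i + n - 1) mod n + 1) mod n = (i + n - 1 + 1) mod n" by (simp only: mod_simps)
  then have "((i + n - 1) mod n + 1) mod n = i" using i by simp
  then have "Lambda_space n U ((i + n - 1) mod n, k + 1) \<subseteq> Lambda_space n U (i, k)"
    using Lambda_space_beta[OF U(1) p, of "k + 1"] k by simp
  then show "complex_vector.dim (Lambda_space n U ((i + n - 1) mod n, k + 1)) \<le> complex_vector.dim (Lambda_space n U (i, k))"
    by (intro dim_mono_fin_dim fin_dim_subspace_subspace fin_dim_Lambda_space U(1) i p)
  let ?V = "Lambda_space n M (i, k)"
  note V = fin_dim_Lambda_space[OF M i, of k]
  let ?j = "(i + k - 1) mod n"
  have j: "?j < n" using i by simp
  have "clinear_on ?V (qmap M ?j)"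
    using cycle_rep_space(2)[OF M j] Lambda_space_subset[OF M i k] unfolding clinear_on_def by (meson subsetD)
  from clinear_on_extend[OF this fin_dim_subspace_subspace[OF V]]
  obtain h where h: "clinear h" "\<And>x. x \<in> ?V \<Longrightarrow> h x = qmap M ?j x" by blast
  have hV: "h ` ?V = Lambda_space n M (i, k + 1)"
  proof -
    have "h ` ?V = qmap M ?j ` ?V" by (rule image_cong[OF refl h(2)])
    then show ?thesis unfolding Lambda_space_alpha[OF k] .
  qed
  have UM: "Lambda_space n U (i, l) \<subseteq> Lambda_space n M (i, l)" for l
    using U(3)[OF i] cycle_comp_cong[OF U(2), of n i "l - 1"] by auto
  let ?S = "{x \<in> ?V. h x \<in> Lambda_space n U (i, k + 1)}"
  have "Lambda_space n U (i, k) \<subseteq> ?S"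
  proof
    fix x assume x: "x \<in> Lambda_space n U (i, k)"
    then have xV: "x \<in> ?V" using UM by blast
    have "h x \<in> qmap U ?j ` Lambda_space n U (i, k)" using x h(2)[OF xV] U(2) by (metis imageI)
    then show "x \<in> ?S" unfolding Lambda_space_alpha[OF k] using xV by blast
  qed
  moreover note pre = dim_preimage[OF V h(1), of "Lambda_space n U (i, k + 1)", unfolded hV,
      OF fin_dim_subspace_subspace[OF fin_dim_Lambda_space[OF U(1) i]] UM]
  moreover have "fin_dim_subspace ?S" by (rule fin_dim_subset[OF V pre(1)]) blast
  ultimately show "complex_vector.dim (Lambda_space n U (i, k)) \<le> complex_vector.dim (Lambda_space n U (i, k + 1)) +
       (complex_vector.dim (Lambda_space n M (i, k)) - complex_vector.dim (Lambda_space n M (i, k + 1)))"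
    using dim_mono_fin_dim[of ?S "Lambda_space n U (i, k)"]
      fin_dim_subspace_subspace[OF fin_dim_Lambda_space[OF U(1) i]] by metis
qed

theorem theorem3p21:
  fixes n N :: nat
    and M :: "(nat, nat, 'v::complex_vector) qrep"
    and E :: "(nat, nat, 'w::complex_vector) qrep"
    and e :: "nat \<Rightarrow> nat"
  assumes "n \<ge> 1" and "N \<ge> 1"
    and "M \<in> cycle_reps n N"
    and "E \<in> gsub (cycle_quiver n) e M"
  shows "\<exists>(X :: nat \<Rightarrow> (nat \<times> nat \<Rightarrow> 'v set) fspace) p.
    (\<forall>k\<in>{1..N}. variety (X k)) \<and>
    X 1 = quiver_gr (cylinder_quiver n N) (Lambda n M) (dim_vec (Lambda n E)) \<and>
    isomorphic (X N)
      (Prod_fspace {..<n}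
        (\<lambda>i. gr (dim_vec (Lambda n E) (i, N)) (coord_space (dim_vec (Lambda n M) (i, N))))) \<and>
    (\<forall>k\<in>{1..<N}. \<exists>(r :: nat) a b.
       (\<forall>j<r. a j \<le> b j) \<and>
       fibration (X k) (X (k + 1)) (p k) (Prod_fspace {..<r} (\<lambda>j. gr (a j) (coord_space (b j)))))"
proof -
  have M: "is_rep (cycle_quiver n) M" using assms(3) by (simp add: cycle_reps_def)
  let ?f = "dim_vec (Lambda n E)"
  \<comment> \<open>the dimensions of \<open>\<Lambda> E\<close> are those of \<open>\<Lambda> U\<close> for a point \<open>U\<close> of the stratum\<close>
  obtain U where U: "U \<in> points (quiver_gr (cycle_quiver n) M e)"
    and iso: "rep_iso (cycle_quiver n) \<lparr>qspace = U, qmap = qmap M\<rparr> E"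
    using assms(4) unfolding gsub_def stratum_def by blast
  let ?U = "\<lparr>qspace = U, qmap = qmap M\<rparr>"
  have "points (quiver_gr (cycle_quiver n) M e) = {U \<in> PiE (verts (cycle_quiver n)) (\<lambda>v. gr_points (e v) (qspace M v)).
          \<forall>r\<in>arcs (cycle_quiver n). qmap M r ` U (tail (cycle_quiver n) r) \<subseteq> U (head (cycle_quiver n) r)}"
    using M unfolding is_rep_def by (intro points_quiver_gr fin_dim_subspace_subspace) blast
  then have UG: "U i \<in> gr_points (e i) (qspace M i)" and Uq: "qmap M i ` U i \<subseteq> U ((i + 1) mod n)" if "i < n" for i
    using U that by (auto simp: cycle_quiver_def)
  have Usub: "U i \<subseteq> qspace M i" if "i < n" for i using UG[OF that] by (simp add: gr_points_def)
  have Ur: "is_rep (cycle_quiver n) ?U"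
    unfolding is_rep_def
  proof (intro conjI ballI)
    fix i assume "i \<in> verts (cycle_quiver n)"
    then have i: "i < n" by (simp add: cycle_quiver_def)
    show "fin_dim_subspace (qspace ?U i)" using gr_points_fin_dim[OF cycle_rep_space(1)[OF M i] UG[OF i]] by simp
  next
    fix i assume "i \<in> arcs (cycle_quiver n)"
    then have i: "i < n" by (simp add: cycle_quiver_def)
    have "clinear_on (U i) (qmap M i)"
      using cycle_rep_space(2)[OF M i] Usub[OF i] unfolding clinear_on_def by (meson subsetD)
    then show "clinear_on (qspace ?U (tail (cycle_quiver n) i)) (qmap ?U i)" by (simp add: cycle_quiver_def)
    show "qmap ?U i ` qspace ?U (tail (cycle_quiver n) i) \<subseteq> qspace ?U (head (cycle_quiver n) i)"
      using Uq[OF i] by (simp add: cycle_quiver_def)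
  qed
  have fU: "?f (i, k) = complex_vector.dim (Lambda_space n ?U (i, k))" if "i < n" for i k
    using dim_Lambda_space_iso[OF Ur iso that, of k] by (simp add: dim_vec_def Lambda_def del: Lambda_space.simps)
  have pa: "?f ((i + n - 1) mod n, k + 1) \<le> ?f (i, k)"
    and aq: "?f (i, k) \<le> ?f (i, k + 1) +
       (complex_vector.dim (Lambda_space n M (i, k)) - complex_vector.dim (Lambda_space n M (i, k + 1)))"
    if "i < n" "1 \<le> k" for i k
    using dim_Lambda_space_bounds[OF M Ur _ _ that] Usub fU[OF that(1)] fU[of "(i + n - 1) mod n"] assms(1)
    by (simp_all del: Lambda_space.simps)
  have dimM: "dim_vec (Lambda n M) v = complex_vector.dim (Lambda_space n M v)" for v
    by (simp add: dim_vec_def Lambda_def del: Lambda_space.simps)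
  let ?X = "tower n N M ?f" and ?p = "\<lambda>k U. restrict U ({..<n} \<times> {k+1..N})"
  show ?thesis
  proof (rule exI[of _ ?X], rule exI[of _ ?p], intro conjI ballI)
    show "variety (?X k)" if "k \<in> {1..N}" for k
      by (rule variety_quiver_gr[OF is_rep_Lambda[OF M]])
        (use that cylinder_above_ends in \<open>auto simp: cylinder_above_def\<close>)
    show "?X 1 = quiver_gr (cylinder_quiver n N) (Lambda n M) ?f" by (simp only: cylinder_above_1)
    show "isomorphic (?X N) (Prod_fspace {..<n} (\<lambda>i. gr (?f (i, N)) (coord_space (dim_vec (Lambda n M) (i, N)))))"
      using top_of_tower[OF M, of N ?f] unfolding dimM .
    fix k assume "k \<in> {1..<N}"
    then have k: "1 \<le> k" "k < N" by auto
    let ?a = "\<lambda>i. ?f (i, k) - ?f ((i + n - 1) mod n, k + 1)"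
    let ?b = "\<lambda>i. ?f (i, k + 1) + (complex_vector.dim (Lambda_space n M (i, k)) -
         complex_vector.dim (Lambda_space n M (i, k + 1))) - ?f ((i + n - 1) mod n, k + 1)"
    have "\<forall>j<n. ?a j \<le> ?b j" using aq k(1) by (meson diff_le_mono)
    moreover have "fibration (?X k) (?X (k + 1)) (?p k) (Prod_fspace {..<n} (\<lambda>j. gr (?a j) (coord_space (?b j))))"
      by (rule fibration_tower[OF assms(3,1) k pa[OF _ k(1)] aq[OF _ k(1)]])
    ultimately show "\<exists>(r :: nat) a b. (\<forall>j<r. a j \<le> b j) \<and>
       fibration (?X k) (?X (k + 1)) (?p k) (Prod_fspace {..<r} (\<lambda>j. gr (a j) (coord_space (b j))))"       by (intro exI[of _ n] exI[of _ ?a] exI[of _ ?b] conjI)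
  qed
qed

end
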